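(* Let $B=\{(x,y)\in\mathbb{R}^2 : x^2+y^2<1\}$ be the Euclidean unit disk and let $H\in C^1(B)$ be a real-valued function with $\sup_B|H|<\infty$ and $\sup_B|\nabla H|<\infty$. Let $\psi$ be a solution of $$\partial\!\!\!/\,\psi=[U(\psi)\Gamma_++V(\psi)\Gamma_-]\psi$$ which is smooth on $B\setminus\{0\}$ (the equation being satisfied on $B\setminus\{0\}$), with $U,V$ given by one of the following three choices: (i) $U=\overline{V}=-(H-i)|\psi|^2$; (ii) $U=V=-H|\psi|^2-\frac{i}{2}(|\psi_1|^2-|\psi_2|^2)$; (iii) $U=-H|\psi|^2-i\big(\frac32|\psi_2|^2-|\psi_1|^2\big)$ and $V=-H|\psi|^2-i\big(|\psi_2|^2-\frac32|\psi_1|^2\big)$. If $$\int_B|\psi|^4<\infty,$$ then $\psi$ extends to a smooth solution on the whole of $B$.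
   Context: The spinor bundle of $B$ for its (unique) spin structure is trivial with fibre $\mathbb{C}^2$, and a spinor field is $\psi=(\psi_1,\psi_2)^T$ with values in $\mathbb{C}^2$ and $|\psi|^2=|\psi_1|^2+|\psi_2|^2$. Clifford multiplication by the standard frame $e_1,e_2$ is represented by $\sigma_1=\begin{pmatrix}0&1\\-1&0\end{pmatrix}$, $\sigma_2=\begin{pmatrix}0&i\\ i&0\end{pmatrix}$, and the Dirac operator is $\partial\!\!\!/\,\psi=\sigma_1\partial_x\psi+\sigma_2\partial_y\psi$. The chirality operator is $\Gamma:=i\,e_1\cdot e_2\cdot$ (Clifford multiplication), and $\Gamma_+:=\frac12(\mathrm{Id}+\Gamma)$, $\Gamma_-:=\frac12(\mathrm{Id}-\Gamma)$. The three choices of $(U,V)$ are those arising for surfaces immersed in the Lie groups $SU(2)$, $Nil$ and $\widetilde{SL_2}$ respectively.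
   Formalization: Since H is only C^1, a C^∞ extension can fail (e.g. H = r^3); "smooth solution on B" is therefore read as: the extension is a C^1 solution on all of B, and is C^k on B whenever H is C^k, for every k including infinity. *)

theory Defs
  imports "HOL-Analysis.Analysis" "HOL-Library.Extended_Nat"
begin

(* On an open set S this is the usual class C^n: the derivative exists at every point of S and
   all directional derivatives are again of class C^(n-1).  Open sets only: the derivatives are
   taken "at x", not "at x within S". *)
primrec higher_differentiable_on ::
    "nat \<Rightarrow> 'a::real_normed_vector set \<Rightarrow> ('a \<Rightarrow> 'b::real_normed_vector) \<Rightarrow> bool" where
  "higher_differentiable_on 0 S f \<longleftrightarrow> continuous_on S f"
| "higher_differentiable_on (Suc n) S f \<longleftrightarrow>
     (\<forall>x\<in>S. f differentiable (at x)) \<and>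
     (\<forall>v. higher_differentiable_on n S (\<lambda>x. frechet_derivative f (at x) v))"

definition C_on ::
    "enat \<Rightarrow> 'a::real_normed_vector set \<Rightarrow> ('a \<Rightarrow> 'b::real_normed_vector) \<Rightarrow> bool" where
  "C_on k S f \<longleftrightarrow> (\<forall>n. enat n \<le> k \<longrightarrow> higher_differentiable_on n S f)"

type_synonym plane = "real \<times> real"
type_synonym spinor = "complex ^ 2"

definition disk :: "plane set" where
  "disk = {(x, y). x\<^sup>2 + y\<^sup>2 < 1}"

definition partial_x :: "(plane \<Rightarrow> 'a::real_normed_vector) \<Rightarrow> plane \<Rightarrow> 'a" where
  "partial_x f p = frechet_derivative f (at p) (1, 0)"

definition partial_y :: "(plane \<Rightarrow> 'a::real_normed_vector) \<Rightarrow> plane \<Rightarrow> 'a" where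
  "partial_y f p = frechet_derivative f (at p) (0, 1)"

definition grad :: "(plane \<Rightarrow> real) \<Rightarrow> plane \<Rightarrow> plane" where
  "grad f p = (partial_x f p, partial_y f p)"

definition sigma1 :: "complex ^ 2 ^ 2" where
  "sigma1 = vector [vector [0, 1], vector [-1, 0]]"

definition sigma2 :: "complex ^ 2 ^ 2" where
  "sigma2 = vector [vector [0, \<i>], vector [\<i>, 0]]"

definition Dirac :: "(plane \<Rightarrow> spinor) \<Rightarrow> plane \<Rightarrow> spinor" where
  "Dirac \<psi> p = sigma1 *v partial_x \<psi> p + sigma2 *v partial_y \<psi> p"

definition chirality :: "spinor \<Rightarrow> spinor" where
  "chirality s = \<i> *s (sigma1 *v (sigma2 *v s))"

definition Gamma_plus :: "spinor \<Rightarrow> spinor" where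
  "Gamma_plus s = (1/2) *s (s + chirality s)"

definition Gamma_minus :: "spinor \<Rightarrow> spinor" where
  "Gamma_minus s = (1/2) *s (s - chirality s)"

(* The potentials depend on the value h of the function H and the value s of the spinor field at
   a point; norm s is the Hermitian norm of C^2. *)
type_synonym potential = "real \<Rightarrow> spinor \<Rightarrow> complex"

definition U_SU2 :: potential where
  "U_SU2 h s = - (of_real h - \<i>) * of_real ((norm s)\<^sup>2)"

definition V_SU2 :: potential where
  "V_SU2 h s = cnj (U_SU2 h s)"

definition U_Nil :: potential where
  "U_Nil h s = - of_real (h * (norm s)\<^sup>2)
     - (\<i> / 2) * of_real ((norm (s $ 1))\<^sup>2 - (norm (s $ 2))\<^sup>2)"

definition V_Nil :: potential where
  "V_Nil = U_Nil"

definition U_SL2 :: potential where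
  "U_SL2 h s = - of_real (h * (norm s)\<^sup>2)
     - \<i> * of_real (3/2 * (norm (s $ 2))\<^sup>2 - (norm (s $ 1))\<^sup>2)"

definition V_SL2 :: potential where
  "V_SL2 h s = - of_real (h * (norm s)\<^sup>2)
     - \<i> * of_real ((norm (s $ 2))\<^sup>2 - 3/2 * (norm (s $ 1))\<^sup>2)"

definition solves_on ::
    "plane set \<Rightarrow> (plane \<Rightarrow> real) \<Rightarrow> potential \<Rightarrow> potential \<Rightarrow> (plane \<Rightarrow> spinor) \<Rightarrow> bool" where
  "solves_on S H U V \<psi> \<longleftrightarrow>
     (\<forall>p\<in>S. Dirac \<psi> p =
        U (H p) (\<psi> p) *s Gamma_plus (\<psi> p) + V (H p) (\<psi> p) *s Gamma_minus (\<psi> p))"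

end

theory Submission imports Defs begin

text \<open>
  Put \<open>w\<^sub>1 = cnj \<psi>\<^sub>1\<close>, \<open>w\<^sub>2 = \<psi>\<^sub>2\<close> and let \<open>dbar = (\<partial>\<^sub>x + \<i> \<partial>\<^sub>y) / 2\<close>.  Away from the origin the Dirac equation
  is the system \<open>dbar w\<^sub>1 = - cnj U cnj w\<^sub>2 / 2\<close>, \<open>dbar w\<^sub>2 = V cnj w\<^sub>1 / 2\<close>.  The potentials are quadratic in
  the spinor with bounded coefficients, so \<open>|dbar w| \<le> A |w|\<^sup>3\<close>, where \<open>w\<close> lies in \<open>L\<^sup>4\<close>.  This growth is
  exactly critical: integrability alone cannot be bootstrapped, and smallness has to be used once.

  The only analytic tool is an inequality of Cauchy-Pompeiu type
  (\<open>pompeiu_difference\<close>): for \<open>u\<close> of class \<open>C\<^sup>1\<close> with compact support,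
  \<open>c |u a - u b| \<le> \<integral> |dbar u z| |a - b| / (|z - a| |z - b|)\<close>.  It follows from Green's formula for a
  regularised Cauchy kernel whose \<open>dbar\<close> is an approximate identity.  A cut-off shows that it persists for
  functions that are \<open>C\<^sup>1\<close> only off the origin and \<open>o(1/|z|)\<close> there (\<open>pompeiu_difference_punctured\<close>).

  \<^item> \<open>eps_regularity\<close>: on a disk of radius \<open>\<rho>\<close> with small energy \<open>\<integral> |w|\<^sup>4\<close>, the value \<open>|w|\<^sup>4 \<rho>\<^sup>2\<close> at the
    centre is bounded by the energy.  Hence \<open>|w| \<le> \<delta> |z| powr (-1/2)\<close> near the origin with \<open>\<delta>\<close> as small as
    desired, and \<open>|dbar w| \<le> \<kappa> |w| / |z|\<close> with \<open>\<kappa>\<close> small.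

  \<^item> \<open>critical_decay\<close>: for small \<open>\<kappa>\<close> the integral operator with kernel \<open>\<kappa> / (|z| |z - a|)\<close> is a contraction for
    both weights \<open>|z| powr (-1/2)\<close> and \<open>|z| powr (-1/4)\<close>, which improves the first bound to the second.  Now
    \<open>dbar w = O(|z| powr (-3/4))\<close> is subcritical, and \<open>holder_punctured\<close> makes \<open>w\<close> Hoelder continuous up to the
    origin.

  \<^item> \<open>derivatives_holder\<close>: if \<open>w\<close> is Hoelder continuous with exponent \<open>\<alpha>\<close>, an interior gradient estimate and
    a point picking argument give \<open>|D w| = O(|z| powr (\<alpha> - 1))\<close>.  Since \<open>dbar (D w) = D (dbar w)\<close> is controlled by
    \<open>1 + |D w|\<close>, \<open>holder_punctured\<close> applies to \<open>D w\<close>.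

  The last step can be iterated as often as \<open>H\<close> is differentiable, because every derivative of \<open>dbar w\<close> is a
  polynomial in derivatives of \<open>w\<close>, \<open>cnj w\<close> and \<open>H\<close> (\<open>regularity\<close>).  A function all of whose derivatives up to
  order \<open>n\<close> have limits at the origin extends as a \<open>C\<^sup>n\<close> function (\<open>extend_Ck_on\<close>), and the equation holds at
  the origin by continuity.
\<close>

section \<open>Directional derivatives and the Cauchy-Riemann operator\<close>

text \<open>The directional derivative of \<open>f\<close> at \<open>z\<close> in direction \<open>v\<close>.\<close>

definition dd :: "plane \<Rightarrow> (plane \<Rightarrow> 'a::real_normed_vector) \<Rightarrow> plane \<Rightarrow> 'a" where
  "dd v f z = frechet_derivative f (at z) v"

abbreviation ex :: plane where "ex \<equiv> (1, 0)"
abbreviation ey :: plane where "ey \<equiv> (0, 1)"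

text \<open>The Wirtinger derivative \<open>(\<partial>\<^sub>x + \<i> \<partial>\<^sub>y) / 2\<close>; its kernel consists of the holomorphic functions.\<close>

definition dbar :: "(plane \<Rightarrow> complex) \<Rightarrow> plane \<Rightarrow> complex" where
  "dbar f z = (dd ex f z + \<i> * dd ey f z) / 2"

abbreviation "Ck_on \<equiv> higher_differentiable_on"

abbreviation "C1_on \<equiv> higher_differentiable_on (Suc 0)"

lemma partial_x_dd: "partial_x f = dd ex f" and partial_y_dd: "partial_y f = dd ey f"
  by (auto simp: partial_x_def partial_y_def dd_def)

lemma Ck_on_Suc:
  "Ck_on (Suc n) S f \<longleftrightarrow> (\<forall>x\<in>S. f differentiable (at x)) \<and> (\<forall>v. Ck_on n S (dd v f))"
  by (simp add: dd_def[abs_def])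

declare higher_differentiable_on.simps(2) [simp del]

lemma C1_onD:
  assumes "C1_on S f"
  shows "\<And>z. z \<in> S \<Longrightarrow> f differentiable (at z)" "continuous_on S (dd v f)"
  using assms unfolding Ck_on_Suc higher_differentiable_on.simps(1) by blast+

lemma dd_eqI: "(f has_derivative f') (at z) \<Longrightarrow> dd v f z = f' v"
  unfolding dd_def by (metis frechet_derivative_at)

lemma dd_works: "f differentiable (at z) \<Longrightarrow> (f has_derivative (\<lambda>v. dd v f z)) (at z)"
  unfolding dd_def by (metis frechet_derivative_works eta_contract_eq)

lemma plane_decomp: "(v::plane) = fst v *\<^sub>R ex + snd v *\<^sub>R ey"
  by (cases v) auto

lemma dd_decomp:
  assumes "f differentiable (at z)"
  shows "dd v f z = fst v *\<^sub>R dd ex f z + snd v *\<^sub>R dd ey f z"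
proof -
  interpret bounded_linear "\<lambda>v. dd v f z" using dd_works[OF assms] by (rule has_derivative_bounded_linear)
  show ?thesis by (subst plane_decomp) (simp only: add scaleR)
qed

lemma norm_dd_le:
  assumes "f differentiable (at z)"
  shows "norm (dd v f z) \<le> norm v * (norm (dd ex f z) + norm (dd ey f z))"
proof -
  have "norm (dd v f z) \<le> \<bar>fst v\<bar> * norm (dd ex f z) + \<bar>snd v\<bar> * norm (dd ey f z)"
    by (subst dd_decomp[OF assms]) (metis norm_triangle_ineq norm_scaleR)
  also have "\<dots> \<le> norm v * norm (dd ex f z) + norm v * norm (dd ey f z)"
    using norm_fst_le[of "fst v" "snd v"] norm_snd_le[of "snd v" "fst v"]
    by (intro add_mono mult_right_mono) auto
  finally show ?thesis by (simp add: algebra_simps)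
qed

lemma dd_add:
  assumes "f differentiable (at z)" "g differentiable (at z)"
  shows "dd v (\<lambda>x. f x + g x) z = dd v f z + dd v g z"
  by (rule dd_eqI) (intro has_derivative_add dd_works assms)

lemma dd_mult:
  fixes f g :: "plane \<Rightarrow> 'a::real_normed_algebra"
  assumes "f differentiable (at z)" "g differentiable (at z)"
  shows "dd v (\<lambda>x. f x * g x) z = f z * dd v g z + dd v f z * g z"
  by (rule dd_eqI[where f' = "\<lambda>v. f z * dd v g z + dd v f z * g z"]) (intro has_derivative_mult dd_works assms)

lemma dd_linear:
  assumes "f differentiable (at z)" "bounded_linear L"
  shows "dd v (\<lambda>x. L (f x)) z = L (dd v f z)"
  by (rule dd_eqI[OF bounded_linear.has_derivative[OF assms(2) dd_works[OF assms(1)]]])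

lemma dd_cong:
  assumes "open S" "z \<in> S" "\<And>x. x \<in> S \<Longrightarrow> f x = g x"
  shows "dd v f z = dd v g z"
proof -
  have "(f has_derivative D) (at z) \<longleftrightarrow> (g has_derivative D) (at z)" for D
    using has_derivative_transform_within_open[of f D z UNIV S g] has_derivative_transform_within_open[of g D z UNIV S f] assms
    by auto
  thus ?thesis by (simp add: dd_def frechet_derivative_def)
qed

lemma differentiable_cong_open:
  assumes "open S" "z \<in> S" "\<And>x. x \<in> S \<Longrightarrow> f x = g x" "f differentiable (at z)"
  shows "g differentiable (at z)"
  using assms(4) has_derivative_transform_within_open[of f _ z UNIV S g] assms(1-3) unfolding differentiable_def
  by blast

lemma dbar_cong:
  assumes "open S" "z \<in> S" "\<And>x. x \<in> S \<Longrightarrow> f x = g x"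
  shows "dbar f z = dbar g z"
  unfolding dbar_def by (simp only: dd_cong[OF assms])

lemma Ck_on_cong:
  fixes S :: "plane set"
  assumes "open S" "Ck_on n S f" "\<And>x. x \<in> S \<Longrightarrow> f x = g x"
  shows "Ck_on n S g"
  using assms(2,3)
proof (induction n arbitrary: f g)
  case 0 thus ?case by (simp cong: continuous_on_cong)
next
  case (Suc n)
  show ?case unfolding Ck_on_Suc
  proof (intro conjI allI ballI)
    fix x assume "x \<in> S"
    thus "g differentiable (at x)" using differentiable_cong_open[OF assms(1)] Suc.prems by (metis Ck_on_Suc)
  next
    fix v show "Ck_on n S (dd v g)"
      using Suc.IH[of "dd v f" "dd v g"] Suc.prems dd_cong[OF assms(1)] by (metis Ck_on_Suc)
  qed
qed

lemma Ck_on_subset: "Ck_on n S f \<Longrightarrow> (T::plane set) \<subseteq> S \<Longrightarrow> Ck_on n T f"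
  by (induction n arbitrary: f) (auto simp: Ck_on_Suc simp del: split_paired_All intro: continuous_on_subset)

lemma Ck_on_SucD: "Ck_on (Suc n) (S::plane set) f \<Longrightarrow> Ck_on n S f"
proof (induction n arbitrary: f)
  case 0
  thus ?case by (auto simp: Ck_on_Suc intro!: continuous_at_imp_continuous_on differentiable_imp_continuous_within)
next
  case (Suc n) thus ?case by (metis Ck_on_Suc)
qed

lemma Ck_on_mono: "Ck_on n (S::plane set) f \<Longrightarrow> m \<le> n \<Longrightarrow> Ck_on m S f"
  by (induction n) (use Ck_on_SucD le_Suc_eq in blast)+

lemma Ck_on_add:
  fixes S :: "plane set"
  assumes "open S"
  shows "Ck_on n S f \<Longrightarrow> Ck_on n S g \<Longrightarrow> Ck_on n S (\<lambda>x. f x + g x)"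
proof (induction n arbitrary: f g)
  case 0 thus ?case by (auto intro: continuous_on_add)
next
  case (Suc n)
  show ?case unfolding Ck_on_Suc
  proof (intro conjI allI ballI)
    fix v
    have "Ck_on n S (\<lambda>x. dd v f x + dd v g x)" using Suc unfolding Ck_on_Suc by blast
    thus "Ck_on n S (dd v (\<lambda>x. f x + g x))"
      using Suc.prems by (elim Ck_on_cong[OF assms]) (metis dd_add Ck_on_Suc)
  qed (use Suc.prems in \<open>auto simp: Ck_on_Suc intro: differentiable_add\<close>)
qed

lemma Ck_on_linear:
  fixes S :: "plane set"
  assumes "open S" "bounded_linear L"
  shows "Ck_on n S f \<Longrightarrow> Ck_on n S (\<lambda>x. L (f x))"
proof (induction n arbitrary: f)
  case 0 thus ?case using assms(2) by (auto intro: bounded_linear.continuous_on)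
next
  case (Suc n)
  have d: "f differentiable (at x)" if "x \<in> S" for x using that Suc.prems by (auto simp: Ck_on_Suc)
  show ?case unfolding Ck_on_Suc
  proof (intro conjI allI ballI)
    fix v
    have "Ck_on n S (\<lambda>x. L (dd v f x))" using Suc unfolding Ck_on_Suc by blast
    thus "Ck_on n S (dd v (\<lambda>x. L (f x)))"
      by (elim Ck_on_cong[OF assms(1)]) (simp add: dd_linear d assms)
  next
    fix x assume "x \<in> S"
    thus "(\<lambda>x. L (f x)) differentiable at x"
      using bounded_linear.has_derivative[OF assms(2) dd_works[OF d]] differentiable_def by blast
  qed
qed

lemma Ck_on_const: "Ck_on n S (\<lambda>x::plane. c)"
proof (induction n arbitrary: c)
  case (Suc n)
  have "dd v (\<lambda>x::plane. c) = (\<lambda>x. 0)" for v using dd_eqI[OF has_derivative_const] by blast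
  thus ?case using Suc unfolding Ck_on_Suc by simp
qed simp

lemma Ck_on_basisI:
  assumes "open S" "\<And>x. x \<in> S \<Longrightarrow> f differentiable (at x)" "Ck_on n S (dd ex f)" "Ck_on n S (dd ey f)"
  shows "Ck_on (Suc n) S f"
  unfolding Ck_on_Suc
proof (intro conjI allI ballI assms)
  fix v
  have "Ck_on n S (\<lambda>x. fst v *\<^sub>R dd ex f x + snd v *\<^sub>R dd ey f x)"
    by (intro Ck_on_add Ck_on_linear[OF _ bounded_linear_scaleR_right] assms)
  thus "Ck_on n S (dd v f)"
    by (elim Ck_on_cong[OF assms(1)]) (metis dd_decomp assms(2))
qed

lemma C1_on_continuous: "C1_on (S::plane set) f \<Longrightarrow> continuous_on S f"
  using Ck_on_SucD[of 0] by simp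

lemma C1_on_mult:
  fixes f g :: "plane \<Rightarrow> 'a::real_normed_algebra"
  assumes "open S" "C1_on S f" "C1_on S g"
  shows "C1_on S (\<lambda>x. f x * g x)"
  unfolding Ck_on_Suc
proof (intro conjI allI ballI)
  fix x assume "x \<in> S"
  thus "(\<lambda>x. f x * g x) differentiable at x"
    by (intro differentiable_mult C1_onD(1)[OF assms(2)] C1_onD(1)[OF assms(3)])
next
  fix v
  have "Ck_on 0 S (\<lambda>z. f z * dd v g z + dd v f z * g z)"
    using C1_onD(2)[OF assms(2)] C1_onD(2)[OF assms(3)] C1_on_continuous[OF assms(2)] C1_on_continuous[OF assms(3)]
    by (simp add: continuous_intros)
  thus "Ck_on 0 S (dd v (\<lambda>x. f x * g x))"
    by (elim Ck_on_cong[OF assms(1)]) (simp only: dd_mult C1_onD(1)[OF assms(2)] C1_onD(1)[OF assms(3)])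
qed

lemma dbar_add:
  "f differentiable (at z) \<Longrightarrow> g differentiable (at z) \<Longrightarrow> dbar (\<lambda>x. f x + g x) z = dbar f z + dbar g z"
  by (simp add: dbar_def dd_add field_simps)

lemma dbar_mult:
  "f differentiable (at z) \<Longrightarrow> g differentiable (at z) \<Longrightarrow> dbar (\<lambda>x. f x * g x) z = f z * dbar g z + dbar f z * g z"
  by (simp add: dbar_def dd_mult field_simps)

lemma continuous_on_dbar: "C1_on S f \<Longrightarrow> continuous_on S (dbar f)"
  unfolding dbar_def[abs_def] by (intro continuous_intros C1_onD) auto

lemma dd_translate: "dd v (\<lambda>x. f (x - a)) z = dd v f (z - a)" for a :: plane
proof -
  have "((\<lambda>x. f (x - a)) has_derivative D) (at z) \<longleftrightarrow> (f has_derivative D) (at (z - a))" for D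
  proof
    assume "((\<lambda>x. f (x - a)) has_derivative D) (at z)"
    hence 1: "((\<lambda>x. f (x - a)) has_derivative D) (at ((z - a) + a))" by simp
    have "((\<lambda>x::plane. x + a) has_derivative (\<lambda>x. x)) (at (z - a))" by (auto intro!: derivative_eq_intros)
    from diff_chain_at[OF this, of "\<lambda>x. f (x - a)" D] 1
    show "(f has_derivative D) (at (z - a))" by (simp add: o_def)
  next
    assume 1: "(f has_derivative D) (at (z - a))"
    have "((\<lambda>x::plane. x - a) has_derivative (\<lambda>x. x)) (at z)" by (auto intro!: derivative_eq_intros)
    from diff_chain_at[OF this, of f D] 1
    show "((\<lambda>x. f (x - a)) has_derivative D) (at z)" by (simp add: o_def)
  qed
  thus ?thesis by (simp add: dd_def frechet_derivative_def)
qed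

lemma dbar_translate: "dbar (\<lambda>x. f (x - a)) z = dbar f (z - a)"
  by (simp add: dbar_def dd_translate)

section \<open>Integrals of powers of the distance\<close>

lemma nn_integral_plane_prod:
  fixes g :: "real \<Rightarrow> ennreal"
  assumes [measurable]: "g \<in> borel_measurable borel"
  shows "(\<integral>\<^sup>+z. g (fst z) * g (snd z) \<partial>(lborel :: plane measure)) = (\<integral>\<^sup>+x. g x \<partial>lborel)\<^sup>2"
proof -
  have "(\<integral>\<^sup>+z. (\<Prod>b\<in>Basis. g (z \<bullet> b)) \<partial>(lborel :: plane measure)) = (\<Prod>b\<in>(Basis::plane set). \<integral>\<^sup>+x. g x \<partial>lborel)"
    by (rule nn_integral_lborel_prod) auto
  moreover have "(\<Prod>b\<in>Basis. g (z \<bullet> b)) = g (fst z) * g (snd z)" for z :: plane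
    by (cases z) (simp add: Basis_prod_def prod.union_disjoint mult.commute)
  moreover have "(\<Prod>b\<in>(Basis::plane set). c) = c\<^sup>2" for c :: ennreal
    by (simp add: Basis_prod_def power2_eq_square)
  ultimately show ?thesis by simp
qed

lemma nn_integral_translate:
  fixes a :: "'a::euclidean_space"
  assumes [measurable]: "g \<in> borel_measurable borel"
  shows "(\<integral>\<^sup>+z. g (z - a) \<partial>lborel) = (\<integral>\<^sup>+z. g z \<partial>lborel)"
  by (subst (2) lborel_distr_plus[of "-a", symmetric]) (simp add: nn_integral_distr)

lemma nn_integral_reflect:
  assumes [measurable]: "g \<in> borel_measurable (borel :: real measure)"
  shows "(\<integral>\<^sup>+x. g (- x) \<partial>lborel) = (\<integral>\<^sup>+x. g x \<partial>lborel)"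
  by (subst (2) lborel_distr_uminus[symmetric]) (simp add: nn_integral_distr)

lemma nn_integral_abs_powr:
  assumes "s < 1" "0 \<le> r"
  shows "(\<integral>\<^sup>+x. ennreal (\<bar>x\<bar> powr (-s)) * indicator {-r..r} x \<partial>(lborel :: real measure))
           \<le> ennreal (2 / (1 - s) * r powr (1 - s))"
proof -
  define h where "h = (\<lambda>x::real. ennreal (x powr (-s)) * indicator {0..r} x)"
  have h[measurable]: "h \<in> borel_measurable borel" unfolding h_def by measurable
  have I: "(\<integral>\<^sup>+x. h x \<partial>lborel) = ennreal (r powr (1 - s) / (1 - s))"
    unfolding h_def using nn_integral_has_integral_lebesgue'[OF _ has_integral_powr_from_0[of "-s" r]] assms
    by (simp add: add.commute)
  have "(\<integral>\<^sup>+x. ennreal (\<bar>x\<bar> powr (-s)) * indicator {-r..r} x \<partial>(lborel :: real measure)) \<le> (\<integral>\<^sup>+x. h x + h (-x) \<partial>lborel)"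
    by (intro nn_integral_mono) (auto simp: h_def indicator_def)
  also have "\<dots> = (\<integral>\<^sup>+x. h x \<partial>lborel) + (\<integral>\<^sup>+x. h x \<partial>lborel)"
    by (subst nn_integral_add) (simp_all add: nn_integral_reflect)
  also have "\<dots> = ennreal (2 / (1 - s) * r powr (1 - s))"
    using assms by (simp add: I ennreal_plus[symmetric] del: ennreal_plus)
  finally show ?thesis .
qed

lemma nn_integral_max_powr:
  assumes "1 < s" "0 < r"
  shows "(\<integral>\<^sup>+x. ennreal ((max r \<bar>x\<bar>) powr (-s)) \<partial>(lborel :: real measure))
           \<le> ennreal ((2 + 2 / (s - 1)) * r powr (1 - s))"
proof -
  define h where "h = (\<lambda>x::real. ennreal (x powr (-s)) * indicator {r..} x)"
  define k where "k = (\<lambda>x::real. ennreal (r powr (-s)) * indicator {-r..r} x)"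
  have h[measurable]: "h \<in> borel_measurable borel" unfolding h_def by measurable
  have k[measurable]: "k \<in> borel_measurable borel" unfolding k_def by measurable
  have "- (r powr (- s + 1)) / (- s + 1) = r powr (1 - s) / (s - 1)"
    using assms by (simp add: field_simps)
  hence I: "(\<integral>\<^sup>+x. h x \<partial>lborel) = ennreal (r powr (1 - s) / (s - 1))"
    unfolding h_def using nn_integral_has_integral_lebesgue'[OF _ has_integral_powr_to_inf[of "-s" r]] assms
    by simp
  have "(\<integral>\<^sup>+x. k x \<partial>lborel) = ennreal (r powr (-s)) * ennreal (2 * r)"
    unfolding k_def using assms by (subst nn_integral_cmult) auto
  also have "\<dots> = ennreal (2 * r powr (1 - s))"
    using assms by (simp add: ennreal_mult[symmetric] powr_diff powr_minus field_simps)
  finally have K: "(\<integral>\<^sup>+x. k x \<partial>lborel) = ennreal (2 * r powr (1 - s))" .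
  have "(\<integral>\<^sup>+x. ennreal ((max r \<bar>x\<bar>) powr (-s)) \<partial>(lborel :: real measure)) \<le> (\<integral>\<^sup>+x. k x + (h x + h (-x)) \<partial>lborel)"
    using assms by (intro nn_integral_mono) (auto simp: h_def k_def indicator_def max_def)
  also have "\<dots> = (\<integral>\<^sup>+x. k x \<partial>lborel) + ((\<integral>\<^sup>+x. h x \<partial>lborel) + (\<integral>\<^sup>+x. h x \<partial>lborel))"
    by (subst nn_integral_add, simp, simp, subst nn_integral_add) (simp_all add: nn_integral_reflect)
  also have "\<dots> = ennreal ((2 + 2 / (s - 1)) * r powr (1 - s))"
  proof -
    have "2 * r powr (1 - s) + (r powr (1 - s) / (s - 1) + r powr (1 - s) / (s - 1)) = (2 + 2 / (s - 1)) * r powr (1 - s)"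
      by (simp add: algebra_simps)
    thus ?thesis using assms by (simp add: I K ennreal_plus[symmetric] del: ennreal_plus)
  qed
  finally show ?thesis .
qed

lemma abs_coord_le_norm: "\<bar>fst z\<bar> \<le> norm z" "\<bar>snd z\<bar> \<le> norm z" for z :: plane
  using norm_fst_le[of "fst z" "snd z"] norm_snd_le[of "snd z" "fst z"] by auto

lemma powr_minus_half_mult:
  fixes x y n q :: real
  assumes "0 < x" "x \<le> n" "0 < y" "y \<le> n" "0 \<le> q"
  shows "n powr (-q) \<le> x powr (-(q/2)) * y powr (-(q/2))"
proof -
  have "n powr (-q) = n powr (-(q/2)) * n powr (-(q/2))" by (simp add: powr_add[symmetric])
  also have "\<dots> \<le> x powr (-(q/2)) * y powr (-(q/2))"
    using assms by (intro mult_mono powr_mono2') auto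
  finally show ?thesis .
qed

text \<open>Powers of the distance in the plane are estimated by products of powers of the two coordinates, which avoids polar
  coordinates.\<close>

lemma nn_integral_powr_cball:
  assumes "0 \<le> q" "q < 2"
  obtains C where "0 < C" "\<And>(a::plane) r. 0 \<le> r \<Longrightarrow>
    (\<integral>\<^sup>+z. ennreal (norm (z - a) powr (-q)) * indicator (cball a r) z \<partial>lborel) \<le> ennreal (C * r powr (2 - q))"
proof
  define c where "c = 2 / (1 - q/2)"
  show "0 < c\<^sup>2" using assms by (auto simp: c_def)
  fix a :: plane and r :: real assume r: "0 \<le> r"
  define g where "g = (\<lambda>x::real. ennreal (\<bar>x\<bar> powr (-(q/2))) * indicator {-r..r} x)"
  have [measurable]: "g \<in> borel_measurable borel" unfolding g_def by measurable
  have "(\<integral>\<^sup>+z. ennreal (norm (z - a) powr (-q)) * indicator (cball a r) z \<partial>lborel)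
      = (\<integral>\<^sup>+z. ennreal (norm (z - a) powr (-q)) * indicator (cball 0 r) (z - a) \<partial>lborel)"
    by (intro nn_integral_cong) (auto simp: indicator_def dist_norm norm_minus_commute)
  also have "\<dots> = (\<integral>\<^sup>+z. ennreal (norm z powr (-q)) * indicator (cball 0 r) z \<partial>(lborel :: plane measure))"
    by (rule nn_integral_translate[where g = "\<lambda>z. ennreal (norm z powr (-q)) * indicator (cball 0 r) z"])
       (intro borel_measurable_times_ennreal borel_measurable_indicator; simp)
  also have "\<dots> \<le> (\<integral>\<^sup>+z. g (fst z) * g (snd z) \<partial>(lborel :: plane measure))"
  \<comment> \<open>Powers of zero vanish by convention, so the product bound fails on the two axes.\<close>
  proof (rule nn_integral_mono_AE)
    have "AE z in (lborel :: plane measure). z \<bullet> ex \<noteq> 0" "AE z in (lborel :: plane measure). z \<bullet> ey \<noteq> 0"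
      by (auto intro!: AE_lborel_inner_neq simp: Basis_prod_def)
    thus "AE z in (lborel :: plane measure). ennreal (norm z powr (-q)) * indicator (cball 0 r) z \<le> g (fst z) * g (snd z)"
    proof eventually_elim
      case (elim z)
      have nz: "fst z \<noteq> 0" "snd z \<noteq> 0" using elim by (cases z; simp)+
      show ?case
      proof (cases "norm z \<le> r")
        case True
        have "fst z \<in> {-r..r}" "snd z \<in> {-r..r}" using True abs_coord_le_norm[of z] by auto
        hence "g (fst z) * g (snd z) = ennreal (\<bar>fst z\<bar> powr (-(q/2)) * \<bar>snd z\<bar> powr (-(q/2)))"
          by (simp add: g_def ennreal_mult)
        moreover have "norm z powr (-q) \<le> \<bar>fst z\<bar> powr (-(q/2)) * \<bar>snd z\<bar> powr (-(q/2))"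
          using nz assms by (intro powr_minus_half_mult abs_coord_le_norm) auto
        ultimately show ?thesis using True by (simp add: ennreal_leI)
      qed simp
    qed
  qed
  also have "\<dots> = (\<integral>\<^sup>+x. g x \<partial>lborel)\<^sup>2" by (rule nn_integral_plane_prod) measurable
  also have "\<dots> \<le> (ennreal (c * r powr (1 - q/2)))\<^sup>2"
    unfolding g_def c_def using assms r by (intro power_mono nn_integral_abs_powr) auto
  also have "\<dots> = ennreal (c\<^sup>2 * r powr (2 - q))"
  proof -
    have "r powr (1 - q/2) * r powr (1 - q/2) = r powr (2 - q)" by (simp add: powr_add[symmetric])
    thus ?thesis using assms by (simp add: power2_eq_square ennreal_mult[symmetric] c_def algebra_simps)
  qed
  finally show "(\<integral>\<^sup>+z. ennreal (norm (z - a) powr (-q)) * indicator (cball a r) z \<partial>lborel) \<le> ennreal (c\<^sup>2 * r powr (2 - q))" .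
qed

lemma nn_integral_powr_exterior:
  assumes "2 < q"
  obtains C where "0 < C" "\<And>r. 0 < r \<Longrightarrow>
    (\<integral>\<^sup>+z. ennreal (norm z powr (-q)) * indicator {z. r \<le> norm z} z \<partial>(lborel :: plane measure)) \<le> ennreal (C * r powr (2 - q))"
proof
  define c where "c = 2 + 2 / (q/2 - 1)"
  have c: "0 < c" using assms by (auto simp: c_def intro!: add_pos_pos)
  thus "0 < c\<^sup>2" by simp
  fix r :: real assume r: "0 < r"
  define g where "g = (\<lambda>x::real. ennreal ((max r \<bar>x\<bar>) powr (-(q/2))))"
  have [measurable]: "g \<in> borel_measurable borel" unfolding g_def by measurable
  have "(\<integral>\<^sup>+z. ennreal (norm z powr (-q)) * indicator {z. r \<le> norm z} z \<partial>(lborel :: plane measure))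
      \<le> (\<integral>\<^sup>+z. g (fst z) * g (snd z) \<partial>(lborel :: plane measure))"
  proof (rule nn_integral_mono)
    fix z :: plane
    show "ennreal (norm z powr (-q)) * indicator {z. r \<le> norm z} z \<le> g (fst z) * g (snd z)"
    proof (cases "r \<le> norm z")
      case True
      have "norm z powr (-q) \<le> (max r \<bar>fst z\<bar>) powr (-(q/2)) * (max r \<bar>snd z\<bar>) powr (-(q/2))"
        using assms r True by (intro powr_minus_half_mult) (auto intro: abs_coord_le_norm)
      thus ?thesis using True by (simp add: g_def ennreal_mult[symmetric] ennreal_leI)
    qed simp
  qed
  also have "\<dots> = (\<integral>\<^sup>+x. g x \<partial>lborel)\<^sup>2" by (rule nn_integral_plane_prod) measurable
  also have "\<dots> \<le> (ennreal (c * r powr (1 - q/2)))\<^sup>2"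
    unfolding g_def c_def using assms r by (intro power_mono nn_integral_max_powr) auto
  also have "\<dots> = ennreal (c\<^sup>2 * r powr (2 - q))"
  proof -
    have "r powr (1 - q/2) * r powr (1 - q/2) = r powr (2 - q)" by (simp add: powr_add[symmetric])
    thus ?thesis using c by (simp add: power2_eq_square ennreal_mult[symmetric] algebra_simps)
  qed
  finally show "(\<integral>\<^sup>+z. ennreal (norm z powr (-q)) * indicator {z. r \<le> norm z} z \<partial>(lborel :: plane measure)) \<le> ennreal (c\<^sup>2 * r powr (2 - q))" .
qed


lemma nn_integral_cball_norm:
  obtains C where "0 < C" "\<And>(a::plane) b r. 0 \<le> r \<Longrightarrow> b \<in> cball a r \<Longrightarrow>
    (\<integral>\<^sup>+z. ennreal (1 / norm (z - b)) * indicator (cball a r) z \<partial>lborel) \<le> ennreal (C * r)"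
proof -
  obtain C where C: "0 < C" "\<And>(a::plane) r. 0 \<le> r \<Longrightarrow>
    (\<integral>\<^sup>+z. ennreal (norm (z - a) powr (-1)) * indicator (cball a r) z \<partial>lborel) \<le> ennreal (C * r powr (2 - 1))"
    using nn_integral_powr_cball[of 1] by auto
  show ?thesis
  proof
    show "0 < 2 * C" using C by simp
    fix a b :: plane and r :: real assume r: "0 \<le> r" "b \<in> cball a r"
    have "cball a r \<subseteq> cball b (2 * r)"
    proof
      fix x assume "x \<in> cball a r"
      thus "x \<in> cball b (2 * r)" using r dist_triangle[of b x a] by (simp add: dist_commute)
    qed
    hence "(\<integral>\<^sup>+z. ennreal (1 / norm (z - b)) * indicator (cball a r) z \<partial>lborel)
       \<le> (\<integral>\<^sup>+z. ennreal (norm (z - b) powr (-1)) * indicator (cball b (2 * r)) z \<partial>lborel)"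
      by (intro nn_integral_mono) (auto simp: powr_minus_divide indicator_def)
    also have "\<dots> \<le> ennreal (C * (2 * r) powr (2 - 1))" using C r by (intro C) auto
    finally show "(\<integral>\<^sup>+z. ennreal (1 / norm (z - b)) * indicator (cball a r) z \<partial>lborel) \<le> ennreal (2 * C * r)"
      using r by (simp add: mult_ac)
  qed
qed

text \<open>The bound is homogeneous in \<open>a\<close>, which makes it usable for a critical right-hand side.  The plane is divided into
  the part far from both singularities and the parts nearer to one of them.\<close>

lemma nn_integral_two_singularities:
  assumes "1 < p" "p < 2"
  obtains C where "0 < C" "\<And>a::plane. a \<noteq> 0 \<Longrightarrow>
    (\<integral>\<^sup>+z. ennreal (norm z powr (-p) / norm (z - a)) \<partial>lborel) \<le> ennreal (C * norm a powr (1 - p))"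
proof -
  obtain C1 where C1: "0 < C1" "\<And>(a::plane) r. 0 \<le> r \<Longrightarrow>
    (\<integral>\<^sup>+z. ennreal (norm (z - a) powr (-p)) * indicator (cball a r) z \<partial>lborel) \<le> ennreal (C1 * r powr (2 - p))"
    using nn_integral_powr_cball[of p] assms by auto
  obtain C2 where C2: "0 < C2" "\<And>(a::plane) r. 0 \<le> r \<Longrightarrow>
    (\<integral>\<^sup>+z. ennreal (norm (z - a) powr (-1)) * indicator (cball a r) z \<partial>lborel) \<le> ennreal (C2 * r powr (2 - 1))"
    using nn_integral_powr_cball[of 1] by auto
  obtain C3 where C3: "0 < C3" "\<And>r. 0 < r \<Longrightarrow>
    (\<integral>\<^sup>+z. ennreal (norm z powr (-(p+1))) * indicator {z. r \<le> norm z} z \<partial>(lborel::plane measure)) \<le> ennreal (C3 * r powr (2 - (p+1)))"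
    using nn_integral_powr_exterior[of "p+1"] assms by auto
  show ?thesis
  proof
    let ?C = "2 * C1 * 2 powr (2-p) + 2 powr p * C2 * 3 + 2 * C3 * 2 powr (1-p)"
    show "0 < ?C" using C1 C2 C3 by (intro add_pos_pos mult_pos_pos) auto
    fix a :: plane assume a: "a \<noteq> 0"
    define m where "m = norm a"
    have m: "0 < m" using a by (simp add: m_def)
    define f1 where "f1 = (\<lambda>z::plane. ennreal (2 / m) * (ennreal (norm (z - 0) powr (-p)) * indicator (cball 0 (2*m)) z))"
    define f2 where "f2 = (\<lambda>z::plane. ennreal ((m/2) powr (-p)) * (ennreal (norm (z - a) powr (-1)) * indicator (cball a (3*m)) z))"
    define f3 where "f3 = (\<lambda>z::plane. ennreal 2 * (ennreal (norm z powr (-(p+1))) * indicator {z. 2*m \<le> norm z} z))"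
    have [measurable]: "{z::plane. 2*m \<le> norm z} \<in> sets borel" by measurable
    have [measurable]: "f1 \<in> borel_measurable borel" "f2 \<in> borel_measurable borel" "f3 \<in> borel_measurable borel"
      unfolding f1_def f2_def f3_def by (intro borel_measurable_times_ennreal borel_measurable_indicator; simp)+
    have pw: "ennreal (norm z powr (-p) / norm (z - a)) \<le> f1 z + (f2 z + f3 z)" for z :: plane
    proof -
      have tri: "m \<le> norm z + norm (z - a)" unfolding m_def using norm_triangle_sub[of a z] by (simp add: norm_minus_commute)
      consider (far) "2 * m \<le> norm z" | (a) "norm z < 2 * m" "norm z \<le> norm (z - a)" | (b) "norm z < 2 * m" "norm (z - a) \<le> norm z"
        by linarith
      thus ?thesis
      proof cases
        case far
        have "norm z \<le> m + norm (z - a)" unfolding m_def using norm_triangle_sub[of z a] by simp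
        hence "norm z / 2 \<le> norm (z - a)" using far by linarith
        moreover have "0 < norm z" using far m by linarith
        ultimately have "norm z powr (-p) / norm (z - a) \<le> norm z powr (-p) / (norm z / 2)"
          by (intro divide_left_mono mult_pos_pos) auto
        also have "\<dots> = 2 * norm z powr (-(p+1))" using \<open>0 < norm z\<close> by (simp add: powr_diff)
        finally have "ennreal (norm z powr (-p) / norm (z - a)) \<le> f3 z"
          using far ennreal_leI[of _ "2 * norm z powr (-(p+1))"] by (simp add: f3_def ennreal_mult)
        thus ?thesis by (simp add: add_increasing)
      next
        case a
        hence "m / 2 \<le> norm (z - a)" using tri by linarith
        hence "norm z powr (-p) / norm (z - a) \<le> norm z powr (-p) / (m / 2)"
          using m by (intro divide_left_mono mult_pos_pos) auto
        hence "ennreal (norm z powr (-p) / norm (z - a)) \<le> f1 z"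
          using a m by (simp add: f1_def ennreal_mult[symmetric] ennreal_leI mult.commute)
        thus ?thesis by (simp add: add_increasing2)
      next
        case b
        hence h: "m / 2 \<le> norm z" using tri by linarith
        have "norm (z - a) \<le> norm z + m" unfolding m_def by (rule norm_triangle_ineq4)
        hence i: "dist a z \<le> 3 * m" using b by (simp add: dist_norm norm_minus_commute)
        have "norm z powr (-p) / norm (z - a) \<le> (m/2) powr (-p) / norm (z - a)"
          using h m assms by (intro divide_right_mono powr_mono2') auto
        hence "ennreal (norm z powr (-p) / norm (z - a)) \<le> f2 z"
          using i by (simp add: f2_def ennreal_mult[symmetric] ennreal_leI powr_minus_divide)
        thus ?thesis by (simp add: add_increasing add_increasing2)
      qed
    qed
    have I1: "(\<integral>\<^sup>+z. f1 z \<partial>lborel) \<le> ennreal (2 / m) * ennreal (C1 * (2*m) powr (2-p))"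
      unfolding f1_def using m C1(2)[of "2*m" 0]
      by (subst nn_integral_cmult) (auto intro!: mult_left_mono borel_measurable_times_ennreal borel_measurable_indicator)
    have I2: "(\<integral>\<^sup>+z. f2 z \<partial>lborel) \<le> ennreal ((m/2) powr (-p)) * ennreal (C2 * (3*m) powr (2-1))"
      unfolding f2_def using m C2(2)[of "3*m" a]
      by (subst nn_integral_cmult) (auto intro!: mult_left_mono borel_measurable_times_ennreal borel_measurable_indicator)
    have I3: "(\<integral>\<^sup>+z. f3 z \<partial>lborel) \<le> ennreal 2 * ennreal (C3 * (2*m) powr (2-(p+1)))"
      unfolding f3_def using m C3(2)[of "2*m"]
      by (subst nn_integral_cmult) (auto intro!: mult_left_mono borel_measurable_times_ennreal borel_measurable_indicator)
    have "(\<integral>\<^sup>+z. ennreal (norm z powr (-p) / norm (z - a)) \<partial>lborel) \<le> (\<integral>\<^sup>+z. f1 z + (f2 z + f3 z) \<partial>lborel)"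
      by (intro nn_integral_mono pw)
    also have "\<dots> = (\<integral>\<^sup>+z. f1 z \<partial>lborel) + ((\<integral>\<^sup>+z. f2 z \<partial>lborel) + (\<integral>\<^sup>+z. f3 z \<partial>lborel))"
      by (simp add: nn_integral_add)
    also have "\<dots> \<le> ennreal (2 / m) * ennreal (C1 * (2*m) powr (2-p)) + (ennreal ((m/2) powr (-p)) * ennreal (C2 * (3*m) powr (2-1)) + ennreal 2 * ennreal (C3 * (2*m) powr (2-(p+1))))"
      by (intro add_mono I1 I2 I3)
    also have "\<dots> = ennreal (2 / m * (C1 * (2*m) powr (2-p)) + ((m/2) powr (-p) * (C2 * (3*m) powr (2-1)) + 2 * (C3 * (2*m) powr (2-(p+1)))))"
      using C1(1) C2(1) C3(1) m by (simp add: ennreal_mult[symmetric] ennreal_plus[symmetric] ennreal_numeral[symmetric] del: ennreal_plus ennreal_numeral)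
    also have "2 / m * (C1 * (2*m) powr (2-p)) + ((m/2) powr (-p) * (C2 * (3*m) powr (2-1)) + 2 * (C3 * (2*m) powr (2-(p+1))))
       = ?C * m powr (1 - p)"
    proof -
      have "(2*m) powr (2-p) = 2 powr (2-p) * (m * m powr (1-p))"
        using m by (simp add: powr_mult powr_add[symmetric] powr_mult_base)
      moreover have "(m/2) powr (-p) * (3*m) = 2 powr p * 3 * m powr (1-p)"
        using m by (simp add: powr_divide powr_minus powr_diff field_simps)
      moreover have "(2*m) powr (2-(p+1)) = 2 powr (1-p) * m powr (1-p)"
        using m by (simp add: powr_mult)
      ultimately show ?thesis using m by (simp add: field_simps)
    qed
    finally show "(\<integral>\<^sup>+z. ennreal (norm z powr (-p) / norm (z - a)) \<partial>lborel) \<le> ennreal (?C * norm a powr (1 - p))"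
      by (simp add: m_def)
  qed
qed

text \<open>One of \<open>a\<close>, \<open>b\<close> has distance at least \<open>|a - b| / 2\<close> from \<open>z\<close>.  This trades a part of the kernel for the power
  \<open>|a - b| powr \<alpha>\<close> and leaves an integrable power of the distance to the nearest singularity.\<close>

lemma nn_integral_three_singularities:
  assumes "0 \<le> p" "0 < \<alpha>" "p + \<alpha> < 1"
  obtains C where "0 < C" "\<And>a b::plane. a \<in> cball 0 1 \<Longrightarrow> b \<in> cball 0 1 \<Longrightarrow> a \<noteq> b \<Longrightarrow>
    (\<integral>\<^sup>+z. ennreal (norm z powr (-p) * (norm (a - b) / (norm (z - a) * norm (z - b)))) * indicator (cball 0 1) z \<partial>lborel)
      \<le> ennreal (C * norm (a - b) powr \<alpha>)"
proof -
  define q where "q = p + 1 + \<alpha>"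
  obtain C where C: "0 < C" "\<And>(a::plane) r. 0 \<le> r \<Longrightarrow>
    (\<integral>\<^sup>+z. ennreal (norm (z - a) powr (-q)) * indicator (cball a r) z \<partial>lborel) \<le> ennreal (C * r powr (2 - q))"
    using nn_integral_powr_cball[of q] assms by (auto simp: q_def)
  define D where "D = C * 2 powr (2 - q)"
  have D: "0 < D" using C by (simp add: D_def)
  have ID: "(\<integral>\<^sup>+z. ennreal (norm (z - a) powr (-q)) * indicator (cball 0 1) z \<partial>lborel) \<le> ennreal D"
    if "a \<in> cball 0 1" for a :: plane
  proof -
    have "cball 0 1 \<subseteq> cball a 2"
    proof
      fix x :: plane assume "x \<in> cball 0 1"
      thus "x \<in> cball a 2" using that dist_triangle[of a x 0] by (simp add: dist_commute)
    qed
    hence "(\<integral>\<^sup>+z. ennreal (norm (z - a) powr (-q)) * indicator (cball 0 1) z \<partial>lborel)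
       \<le> (\<integral>\<^sup>+z. ennreal (norm (z - a) powr (-q)) * indicator (cball a 2) z \<partial>lborel)"
      by (intro nn_integral_mono) (auto simp: indicator_def)
    also have "\<dots> \<le> ennreal D" unfolding D_def by (rule C) simp
    finally show ?thesis .
  qed
  show ?thesis
  proof
    show "0 < 2 powr (1 - \<alpha>) * (4 * D)" using D by simp
    fix a b :: plane assume ab: "a \<in> cball 0 1" "b \<in> cball 0 1" "a \<noteq> b"
    define d where "d = norm (a - b)"
    have d: "0 < d" using ab by (simp add: d_def)
    define k where "k = (\<lambda>c z::plane. ennreal (norm (z - c) powr (-q)) * indicator (cball 0 1) z)"
    have [measurable]: "k c \<in> borel_measurable borel" for c
      unfolding k_def by (intro borel_measurable_times_ennreal borel_measurable_indicator; simp)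
    define e where "e = d * (d/2) powr (\<alpha> - 1)"
    have e: "e = 2 powr (1 - \<alpha>) * d powr \<alpha>" using d unfolding e_def by (simp add: powr_divide powr_diff field_simps)
    have key: "x powr (-p) * (d / (s * t)) \<le> e * (x powr (-q) + s powr (-q))"
      if "0 < s" "0 < x" "s \<le> t" "d / 2 \<le> t" for x s t :: real
    proof -
      have "t powr (-\<alpha>) * t powr (\<alpha> - 1) = 1 / t" "s powr (-1) = 1 / s"
        using that by (simp_all add: powr_diff powr_minus field_simps)
      hence "d / (s * t) = d * (s powr (-1) * (t powr (-\<alpha>) * t powr (\<alpha> - 1)))" by simp
      also have "\<dots> \<le> d * (s powr (-1) * (s powr (-\<alpha>) * (d/2) powr (\<alpha> - 1)))"
        using that d assms by (intro mult_left_mono mult_mono powr_mono2') auto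
      also have "\<dots> = e * (s powr (-1) * s powr (-\<alpha>))" by (simp add: e_def)
      also have "s powr (-1) * s powr (-\<alpha>) = s powr (-(1+\<alpha>))" by (simp only: powr_add[symmetric]) simp
      finally have 1: "x powr (-p) * (d / (s * t)) \<le> e * (x powr (-p) * s powr (-(1+\<alpha>)))"
        by (metis (no_types, opaque_lifting) mult.left_commute mult_left_mono powr_ge_zero)
      have "x powr (-p) * s powr (-(1+\<alpha>)) \<le> x powr (-q) + s powr (-q)"
      proof (cases "x \<le> s")
        case True
        have "x powr (-p) * s powr (-(1+\<alpha>)) \<le> x powr (-p) * x powr (-(1+\<alpha>))"
          using True that assms by (intro mult_left_mono powr_mono2') auto
        also have "\<dots> = x powr (-q)" by (simp add: q_def powr_add[symmetric] algebra_simps)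
        finally show ?thesis by (simp add: add_increasing2)
      next
        case False
        have "x powr (-p) * s powr (-(1+\<alpha>)) \<le> s powr (-p) * s powr (-(1+\<alpha>))"
          using False that assms by (intro mult_right_mono powr_mono2') auto
        also have "\<dots> = s powr (-q)" by (simp add: q_def powr_add[symmetric] algebra_simps)
        finally show ?thesis by (simp add: add_increasing)
      qed
      hence "e * (x powr (-p) * s powr (-(1+\<alpha>))) \<le> e * (x powr (-q) + s powr (-q))"
        using d by (intro mult_left_mono) (auto simp: e_def)
      with 1 show ?thesis by linarith
    qed
    have pw: "ennreal (norm z powr (-p) * (d / (norm (z - a) * norm (z - b)))) * indicator (cball 0 1) z
        \<le> ennreal e * (2 * k 0 z + (k a z + k b z))" for z
    proof (cases "z = 0 \<or> z = a \<or> z = b \<or> z \<notin> cball 0 1")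
      case False
      hence nz: "0 < norm z" "0 < norm (z - a)" "0 < norm (z - b)" by auto
      have tri: "d \<le> norm (z - a) + norm (z - b)" unfolding d_def
        using norm_triangle_ineq4[of "z - b" "z - a"] by simp
      have e0: "0 \<le> e" using d by (simp add: e_def)
      have "norm z powr (-p) * (d / (norm (z - a) * norm (z - b))) \<le> e * (2 * norm z powr (-q) + (norm (z - a) powr (-q) + norm (z - b) powr (-q)))"
      proof (cases "norm (z - a) \<le> norm (z - b)")
        case True
        have "norm z powr (-p) * (d / (norm (z - a) * norm (z - b))) \<le> e * (norm z powr (-q) + norm (z - a) powr (-q))"
          using True tri nz by (intro key) auto
        also have "\<dots> \<le> e * (2 * norm z powr (-q) + (norm (z - a) powr (-q) + norm (z - b) powr (-q)))"
          using e0 by (intro mult_left_mono) auto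
        finally show ?thesis .
      next
        case False
        have "norm z powr (-p) * (d / (norm (z - b) * norm (z - a))) \<le> e * (norm z powr (-q) + norm (z - b) powr (-q))"
          using False tri nz by (intro key) auto
        also have "\<dots> \<le> e * (2 * norm z powr (-q) + (norm (z - a) powr (-q) + norm (z - b) powr (-q)))"
          using e0 by (intro mult_left_mono) auto
        finally show ?thesis by (simp add: mult.commute)
      qed
      moreover have "ennreal (e * (2 * norm z powr (-q) + (norm (z - a) powr (-q) + norm (z - b) powr (-q)))) = ennreal e * (2 * k 0 z + (k a z + k b z))"
        using False e0 by (simp add: k_def ennreal_mult ennreal_plus)
      ultimately show ?thesis using False by (metis (no_types, lifting) ennreal_leI indicator_simps(1) mult.right_neutral)
    next
      case True
      then consider "z = a" | "z = b" | "z = 0" "z \<noteq> a" "z \<noteq> b" | "z \<notin> cball 0 1" by blast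
      thus ?thesis by cases (auto simp: indicator_def)
    qed
    have "(\<integral>\<^sup>+z. ennreal (norm z powr (-p) * (d / (norm (z - a) * norm (z - b)))) * indicator (cball 0 1) z \<partial>lborel)
       \<le> (\<integral>\<^sup>+z. ennreal e * (2 * k 0 z + (k a z + k b z)) \<partial>lborel)"
      by (intro nn_integral_mono_AE AE_I2 pw)
    also have "\<dots> = ennreal e * (2 * (\<integral>\<^sup>+z. k 0 z \<partial>lborel) + ((\<integral>\<^sup>+z. k a z \<partial>lborel) + (\<integral>\<^sup>+z. k b z \<partial>lborel)))"
      by (simp add: nn_integral_add nn_integral_cmult)
    also have "\<dots> \<le> ennreal e * (2 * ennreal D + (ennreal D + ennreal D))"
      unfolding k_def by (intro mult_left_mono add_mono ID ab) auto
    also have "\<dots> = ennreal (2 powr (1 - \<alpha>) * (4 * D) * d powr \<alpha>)"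
      using D d by (simp add: e ennreal_mult[symmetric] ennreal_plus[symmetric] ennreal_numeral[symmetric] mult_ac del: ennreal_plus ennreal_numeral)
    finally show "(\<integral>\<^sup>+z. ennreal (norm z powr (-p) * (norm (a - b) / (norm (z - a) * norm (z - b)))) * indicator (cball 0 1) z \<partial>lborel)
      \<le> ennreal (2 powr (1 - \<alpha>) * (4 * D) * norm (a - b) powr \<alpha>)" by (simp add: d_def)
  qed
qed

section \<open>The Cauchy-Pompeiu inequality\<close>

lemma C1_translate:
  assumes "C1_on UNIV (f :: plane \<Rightarrow> 'a::real_normed_vector)"
  shows "C1_on UNIV (\<lambda>x. f (x - a))"
  unfolding Ck_on_Suc
proof (intro conjI allI ballI)
  fix x
  have "(f has_derivative (\<lambda>v. dd v f (x - a))) (at (x - a))" by (intro dd_works C1_onD(1)[OF assms]) simp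
  moreover have "((\<lambda>x::plane. x - a) has_derivative (\<lambda>x. x)) (at x)" by (auto intro!: derivative_eq_intros)
  ultimately have "(f \<circ> (\<lambda>x. x - a) has_derivative (\<lambda>v. dd v f (x - a)) \<circ> (\<lambda>x. x)) (at x)"
    using diff_chain_at[of "\<lambda>x. x - a" "\<lambda>x. x" x f] by blast
  thus "(\<lambda>x. f (x - a)) differentiable at x" by (auto simp: differentiable_def o_def)
next
  fix v
  have "continuous_on UNIV (\<lambda>x. dd v f (x - a))"
    by (rule continuous_on_compose2[OF C1_onD(2)[OF assms]]) (auto intro: continuous_intros)
  thus "Ck_on 0 UNIV (dd v (\<lambda>x. f (x - a)))" by (simp add: dd_translate[abs_def])
qed

lemma vanish_outside:
  fixes u :: "plane \<Rightarrow> complex"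
  assumes "\<And>z::plane. M < norm z \<Longrightarrow> u z = 0" "M < norm z"
  shows "dd v u z = 0" "dbar u z = 0"
proof -
  have o: "open {z::plane. M < norm z}" by (intro open_Collect_less continuous_intros)
  have e: "dd v u z = 0" for v
  proof -
    have "dd v u z = dd v (\<lambda>x. 0) z" by (rule dd_cong[OF o]) (use assms in auto)
    also have "\<dots> = 0" by (rule dd_eqI[OF has_derivative_const])
    finally show ?thesis .
  qed
  show "dd v u z = 0" by (rule e)
  show "dbar u z = 0" by (simp add: dbar_def e)
qed

lemma integrable_compact_support:
  fixes f :: "plane \<Rightarrow> 'a::{banach, second_countable_topology}"
  assumes "continuous_on UNIV f" "\<And>z. M < norm z \<Longrightarrow> f z = 0"
  shows "integrable lborel f"
proof -
  have "integrable lborel (\<lambda>x. indicator (cball 0 M) x *\<^sub>R f x)"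
    by (intro borel_integrable_compact continuous_on_subset[OF assms(1)]) auto
  moreover have "(\<lambda>x. indicator (cball 0 M) x *\<^sub>R f x) = f"
  proof
    fix z show "indicator (cball 0 M) z *\<^sub>R f z = f z"
      using assms(2)[of z] by (cases "M < norm z") simp_all
  qed
  ultimately show ?thesis by simp
qed

lemma integral_line_derivative_zero:
  fixes g g' :: "real \<Rightarrow> complex"
  assumes "\<And>x. (g has_vector_derivative g' x) (at x)" "continuous_on UNIV g'" "\<And>x. M < \<bar>x\<bar> \<Longrightarrow> g x = 0"
    "\<And>x. M < \<bar>x\<bar> \<Longrightarrow> g' x = 0"
  shows "(\<integral>x. g' x \<partial>lborel) = 0"
proof -
  define N where "N = max 0 M + 1"
  have "(\<integral>x. g' x \<partial>lborel) = (\<integral>x. indicator {-N..N} x *\<^sub>R g' x \<partial>lborel)"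
    by (intro Bochner_Integration.integral_cong) (auto simp: indicator_def assms(4) N_def)
  also have "\<dots> = g N - g (-N)"
    using assms by (intro integral_FTC_Icc) (auto simp: N_def intro: has_vector_derivative_at_within continuous_on_subset)
  also have "\<dots> = 0" using assms(3)[of N] assms(3)[of "-N"] by (simp add: N_def)
  finally show ?thesis .
qed

lemma slice_derivative:
  assumes "C1_on UNIV (u :: plane \<Rightarrow> complex)"
  shows "((\<lambda>x. u (x, y)) has_vector_derivative dd ex u (x, y)) (at x)"
    and "((\<lambda>y. u (x, y)) has_vector_derivative dd ey u (x, y)) (at y)"
proof -
  have d: "(u has_derivative (\<lambda>v. dd v u (x, y))) (at (x, y))" by (rule dd_works, rule C1_onD(1)[OF assms], rule UNIV_I)
  have dec: "dd v u (x, y) = fst v *\<^sub>R dd ex u (x, y) + snd v *\<^sub>R dd ey u (x, y)" for v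
    by (rule dd_decomp, rule C1_onD(1)[OF assms], rule UNIV_I)
  have 1: "((\<lambda>x. (x, y)) has_derivative (\<lambda>h. (h, 0))) (at x)"
    by (intro has_derivative_Pair has_derivative_ident has_derivative_const)
  have "((\<lambda>x. u (x, y)) has_derivative (\<lambda>h. dd (h, 0) u (x, y))) (at x)"
    using has_derivative_compose[OF 1 d] .
  thus "((\<lambda>x. u (x, y)) has_vector_derivative dd ex u (x, y)) (at x)"
    unfolding has_vector_derivative_def by (rule has_derivative_eq_rhs) (rule ext, rule trans[OF dec], simp)
  have 2: "((\<lambda>y. (x, y)) has_derivative (\<lambda>h. (0, h))) (at y)"
    by (intro has_derivative_Pair has_derivative_ident has_derivative_const)
  have "((\<lambda>y. u (x, y)) has_derivative (\<lambda>h. dd (0, h) u (x, y))) (at y)"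
    using has_derivative_compose[OF 2 d] .
  thus "((\<lambda>y. u (x, y)) has_vector_derivative dd ey u (x, y)) (at y)"
    unfolding has_vector_derivative_def by (rule has_derivative_eq_rhs) (rule ext, rule trans[OF dec], simp)
qed

lemma integral_dbar_zero:
  fixes u :: "plane \<Rightarrow> complex"
  assumes u: "C1_on UNIV u" and supp: "\<And>z. M < norm z \<Longrightarrow> u z = 0"
  shows "(\<integral>z. dbar u z \<partial>lborel) = 0"
proof -
  have int: "integrable lborel (dd v u)" for v
    by (rule integrable_compact_support[OF C1_onD(2)[OF u]]) (rule vanish_outside[OF supp])
  have big: "M < norm (x, y)" if "M < \<bar>x\<bar> \<or> M < \<bar>y\<bar>" for x y :: real
    using that norm_fst_le[of x y] norm_snd_le[of y x] by auto
  have c: "continuous_on UNIV (\<lambda>x. dd v u (x, y))" "continuous_on UNIV (\<lambda>y. dd v u (x, y))" for v x y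
    by (rule continuous_on_compose2[OF C1_onD(2)[OF u]]; intro continuous_intros subset_UNIV)+
  have X: "(\<integral>z. dd ex u z \<partial>lborel) = 0"
  proof -
    have i: "integrable (lborel \<Otimes>\<^sub>M lborel) (case_prod (\<lambda>x y. dd ex u (x, y)))"
      unfolding lborel_prod using int[of ex] by (rule back_subst[where P = "integrable lborel"]) (rule ext, simp add: split_beta)
    have "(\<integral>z. dd ex u z \<partial>lborel) = (\<integral>y. (\<integral>x. dd ex u (x, y) \<partial>lborel) \<partial>lborel)"
      unfolding lborel_pair.integral_snd[OF i] lborel_prod
      by (rule Bochner_Integration.integral_cong[OF refl]) (simp add: split_beta)
    moreover have "(\<integral>x. dd ex u (x, y) \<partial>lborel) = 0" for y
    proof (rule integral_line_derivative_zero[where g = "\<lambda>x. u (x, y)" and M = M])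
      show "((\<lambda>x. u (x, y)) has_vector_derivative dd ex u (x, y)) (at x)" for x by (rule slice_derivative[OF u])
      fix x :: real assume "M < \<bar>x\<bar>"
      hence *: "M < norm (x, y)" by (intro big) simp
      show "u (x, y) = 0" by (rule supp[OF *])
      show "dd ex u (x, y) = 0" by (rule vanish_outside(1)[OF supp *])
    qed (rule c)
    ultimately show ?thesis by simp
  qed
  have Y: "(\<integral>z. dd ey u z \<partial>lborel) = 0"
  proof -
    have i: "integrable (lborel \<Otimes>\<^sub>M lborel) (case_prod (\<lambda>x y. dd ey u (x, y)))"
      unfolding lborel_prod using int[of ey] by (rule back_subst[where P = "integrable lborel"]) (rule ext, simp add: split_beta)
    have "(\<integral>z. dd ey u z \<partial>lborel) = (\<integral>x. (\<integral>y. dd ey u (x, y) \<partial>lborel) \<partial>lborel)"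
      unfolding lborel_pair.integral_fst[OF i] lborel_prod
      by (rule Bochner_Integration.integral_cong[OF refl]) (simp add: split_beta)
    moreover have "(\<integral>y. dd ey u (x, y) \<partial>lborel) = 0" for x
    proof (rule integral_line_derivative_zero[where g = "\<lambda>y. u (x, y)" and M = M])
      show "((\<lambda>y. u (x, y)) has_vector_derivative dd ey u (x, y)) (at y)" for y by (rule slice_derivative[OF u])
      fix y :: real assume "M < \<bar>y\<bar>"
      hence *: "M < norm (x, y)" by (intro big) simp
      show "u (x, y) = 0" by (rule supp[OF *])
      show "dd ey u (x, y) = 0" by (rule vanish_outside(1)[OF supp *])
    qed (rule c)
    ultimately show ?thesis by simp
  qed
  have "(\<integral>z. dbar u z \<partial>lborel) = ((\<integral>z. dd ex u z \<partial>lborel) + \<i> * (\<integral>z. dd ey u z \<partial>lborel)) / 2"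
    unfolding dbar_def using int[of ex] int[of ey] by simp
  thus ?thesis using X Y by simp
qed

text \<open>The plane as the complex numbers.\<close>

definition to_complex :: "plane \<Rightarrow> complex" where "to_complex z = Complex (fst z) (snd z)"

lemma to_complex_simps: "to_complex (a - b) = to_complex a - to_complex b" "to_complex (a + b) = to_complex a + to_complex b" "norm (to_complex z) = norm z" "to_complex 0 = 0"
  by (auto simp: to_complex_def complex_eq_iff cmod_def norm_prod_def)

lemma bounded_linear_to_complex: "bounded_linear to_complex"
  by (rule bounded_linear_intro[where K = 1])
     (auto simp: to_complex_simps(2,3) complex_eq_iff, auto simp: to_complex_def)

text \<open>The regularised Cauchy kernel \<open>cnj z / (|z|\<^sup>2 + t\<^sup>2)\<close>, which tends to \<open>1 / z\<close> as \<open>t\<close> tends to \<open>0\<close>.\<close>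

definition cauchy_kernel :: "real \<Rightarrow> plane \<Rightarrow> complex" where
  "cauchy_kernel t z = of_real (inverse ((fst z)\<^sup>2 + (snd z)\<^sup>2 + t\<^sup>2)) * cnj (to_complex z)"

text \<open>The \<open>dbar\<close>-derivative of the regularised Cauchy kernel, an approximate identity as \<open>t\<close> tends to \<open>0\<close>.\<close>

definition mollifier :: "real \<Rightarrow> plane \<Rightarrow> real" where
  "mollifier t z = t\<^sup>2 / ((norm z)\<^sup>2 + t\<^sup>2)\<^sup>2"

lemma norm_plane_sq: "(norm z)\<^sup>2 = (fst z)\<^sup>2 + (snd z)\<^sup>2" for z :: plane
  by (cases z) (simp add: norm_prod_def)

lemma cauchy_kernel_C1:
  assumes "0 < t"
  shows "C1_on UNIV (cauchy_kernel t)" and "dbar (cauchy_kernel t) z = of_real (mollifier t z)"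
proof -
  define g where "g = (\<lambda>z::plane. (fst z)\<^sup>2 + (snd z)\<^sup>2 + t\<^sup>2)"
  have g: "0 < g z" for z using assms by (auto simp: g_def intro!: add_nonneg_pos)
  define D where "D = (\<lambda>v z. of_real (- ((2 * fst z * fst v + 2 * snd z * snd v) / (g z)\<^sup>2)) * cnj (to_complex z)
      + of_real (inverse (g z)) * cnj (to_complex v))"
  have dg: "((\<lambda>z. inverse (g z)) has_derivative (\<lambda>v. - ((2 * fst z * fst v + 2 * snd z * snd v) / (g z)\<^sup>2))) (at z)" for z
  proof -
    have "(g has_derivative (\<lambda>v. 2 * fst z * fst v + 2 * snd z * snd v)) (at z)"
      unfolding g_def by (auto intro!: derivative_eq_intros simp: fun_eq_iff)
    from Deriv.has_derivative_inverse[OF _ this] g[of z] show ?thesis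
      by (simp add: divide_inverse power2_eq_square mult_ac)
  qed
  have dc: "((\<lambda>z. cnj (to_complex z)) has_derivative (\<lambda>v. cnj (to_complex v))) (at z)" for z
    using bounded_linear_compose[OF bounded_linear_cnj bounded_linear_to_complex] by (rule bounded_linear_imp_has_derivative)
  have hd: "(cauchy_kernel t has_derivative (\<lambda>v. D v z)) (at z)" for z
  proof -
    have "((\<lambda>z. of_real (inverse (g z)) * cnj (to_complex z)) has_derivative
      (\<lambda>v. of_real (inverse (g z)) * cnj (to_complex v) + of_real (- ((2 * fst z * fst v + 2 * snd z * snd v) / (g z)\<^sup>2)) * cnj (to_complex z))) (at z)"
      by (intro has_derivative_mult dc has_derivative_of_real dg)
    thus ?thesis unfolding cauchy_kernel_def[abs_def] D_def g_def by (simp add: add.commute)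
  qed
  have ddD: "dd v (cauchy_kernel t) = D v" for v using dd_eqI[OF hd] by blast
  have "continuous_on UNIV (D v)" for v
  proof -
    have "continuous_on UNIV g" unfolding g_def by (intro continuous_intros)
    moreover have "continuous_on UNIV to_complex" by (rule linear_continuous_on[OF bounded_linear_to_complex])
    ultimately show ?thesis
      unfolding D_def using less_imp_neq[OF g, symmetric] by (intro continuous_intros ballI) simp_all
  qed
  thus "C1_on UNIV (cauchy_kernel t)"
    unfolding Ck_on_Suc ddD higher_differentiable_on.simps(1) using hd differentiableI by blast
  have "dbar (cauchy_kernel t) z = of_real (mollifier t z)" if "z = (x, y)" for x y
  proof -
    have "dbar (cauchy_kernel t) z = of_real (inverse (g z)) - of_real ((x\<^sup>2 + y\<^sup>2) / (g z)\<^sup>2)"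
      unfolding dbar_def ddD D_def that
      by (simp add: complex_eq_iff to_complex_def power2_eq_square add_divide_distrib) (simp add: field_simps)
    also have "\<dots> = of_real (mollifier t z)"
    proof -
      have G: "x\<^sup>2 + y\<^sup>2 = g z - t\<^sup>2" "mollifier t z = t\<^sup>2 / (g z)\<^sup>2"
        by (simp_all add: mollifier_def norm_plane_sq g_def that)
      have "inverse (g z) - (x\<^sup>2 + y\<^sup>2) / (g z)\<^sup>2 = mollifier t z"
        unfolding G using g[of z] by (simp add: field_simps power2_eq_square)
      thus ?thesis by (metis of_real_diff)
    qed
    finally show ?thesis .
  qed
  thus "dbar (cauchy_kernel t) z = of_real (mollifier t z)" by (cases z) blast
qed

text \<open>The bound is the same as for the kernel \<open>1 / z\<close> itself and does not depend on \<open>t\<close>.\<close>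

lemma norm_cauchy_kernel_diff_le:
  assumes "a \<noteq> 0" "b \<noteq> 0"
  shows "norm (cauchy_kernel t a - cauchy_kernel t b) \<le> norm (a - b) / (norm a * norm b)"
proof -
  define A B where "A = to_complex a" and "B = to_complex b"
  have AB: "A \<noteq> 0" "B \<noteq> 0" using assms by (metis A_def B_def to_complex_simps(3) norm_eq_zero)+
  define p q where "p = (norm A)\<^sup>2 + t\<^sup>2" and "q = (norm B)\<^sup>2 + t\<^sup>2"
  have pq: "0 < p" "0 < q" using AB by (auto simp: p_def q_def intro!: add_pos_nonneg)
  have k: "cauchy_kernel t a = cnj A / of_real p" "cauchy_kernel t b = cnj B / of_real q"
    by (simp_all add: cauchy_kernel_def A_def B_def p_def q_def to_complex_simps norm_plane_sq divide_inverse mult.commute)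
  have n2: "complex_of_real ((norm w)\<^sup>2) = w * cnj w" for w using complex_norm_square[of w] by simp
  have "cauchy_kernel t a - cauchy_kernel t b = (cnj A * of_real q - cnj B * of_real p) / of_real (p * q)"
    using pq by (simp add: k field_simps)
  also have "cnj A * of_real q - cnj B * of_real p = cnj A * cnj B * (B - A) + of_real (t\<^sup>2) * cnj (A - B)"
    unfolding p_def q_def of_real_add n2 by (simp add: algebra_simps)
  finally have "norm (cauchy_kernel t a - cauchy_kernel t b) = norm (cnj A * cnj B * (B - A) + of_real (t\<^sup>2) * cnj (A - B)) / (p * q)"
    using pq by (simp add: norm_divide norm_mult)
  also have "norm (cnj A * cnj B * (B - A) + of_real (t\<^sup>2) * cnj (A - B))
     \<le> norm (cnj A * cnj B * (B - A)) + norm (of_real (t\<^sup>2) * cnj (A - B))" by (rule norm_triangle_ineq)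
  also have "\<dots> = norm (A - B) * (norm A * norm B + t\<^sup>2)"
    by (simp only: norm_mult complex_mod_cnj norm_minus_commute[of B A] norm_of_real) (simp add: algebra_simps)
  finally have 1: "norm (cauchy_kernel t a - cauchy_kernel t b) \<le> norm (A - B) * ((norm A * norm B + t\<^sup>2) / (p * q))"
    using pq by (simp add: divide_right_mono)
  have "(norm A * norm B + t\<^sup>2) * (norm A * norm B) \<le> p * q"
  proof -
    have "norm A * norm B \<le> (norm A)\<^sup>2 + (norm B)\<^sup>2"
      using sum_squares_bound[of "norm A" "norm B"] zero_le_power2[of "norm A"]  zero_le_power2[of "norm B"] mult_nonneg_nonneg[OF norm_ge_zero norm_ge_zero, of A B] by linarith
    hence "t\<^sup>2 * (norm A * norm B) \<le> t\<^sup>2 * ((norm A)\<^sup>2 + (norm B)\<^sup>2)" by (rule mult_left_mono) simp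
    moreover have "0 \<le> t\<^sup>2 * t\<^sup>2" by simp
    ultimately show ?thesis unfolding p_def q_def by (simp add: algebra_simps power2_eq_square)
  qed
  hence "(norm A * norm B + t\<^sup>2) / (p * q) \<le> 1 / (norm A * norm B)"
    using pq AB by (simp add: field_simps)
  hence "norm (A - B) * ((norm A * norm B + t\<^sup>2) / (p * q)) \<le> norm (A - B) * (1 / (norm A * norm B))"
    by (rule mult_left_mono) simp
  with 1 have "norm (cauchy_kernel t a - cauchy_kernel t b) \<le> norm (A - B) / (norm A * norm B)" by simp
  thus ?thesis by (simp add: A_def B_def to_complex_simps flip: to_complex_simps(1))
qed

text \<open>The mass of the mollifier.  Its value is \<open>\<pi>\<close>, but only its positivity is used.\<close>

definition pompeiu_const :: real where
  "pompeiu_const = (\<integral>z. mollifier 1 z \<partial>(lborel :: plane measure))"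

lemma mollifier_integrable: "integrable lborel (mollifier 1)" and pompeiu_const_pos: "0 < pompeiu_const"
proof -
  have den: "0 < (norm z)\<^sup>2 + (1::real)" for z :: plane by (intro add_nonneg_pos) auto
  have cont: "continuous_on UNIV (mollifier 1)"
    unfolding mollifier_def[abs_def] using less_imp_neq[OF den] by (auto intro!: continuous_intros)
  have m[measurable]: "mollifier 1 \<in> borel_measurable borel" using cont by (rule borel_measurable_continuous_onI)
  define g where "g = (\<lambda>x::real. ennreal ((max 1 \<bar>x\<bar>) powr (-2)))"
  have [measurable]: "g \<in> borel_measurable borel" unfolding g_def by measurable
  have pos: "0 < mollifier 1 z" for z using den[of z] by (simp add: mollifier_def)
  have "(\<integral>\<^sup>+z. ennreal (norm (mollifier 1 z)) \<partial>lborel) \<le> (\<integral>\<^sup>+z. g (fst z) * g (snd z) \<partial>(lborel :: plane measure))"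
  proof (rule nn_integral_mono)
    fix z :: plane
    let ?x = "max 1 \<bar>fst z\<bar>" and ?y = "max 1 \<bar>snd z\<bar>" and ?n = "(norm z)\<^sup>2 + 1"
    have "?x\<^sup>2 \<le> ?n" "?y\<^sup>2 \<le> ?n" by (auto simp: norm_plane_sq max_def)
    hence "?x\<^sup>2 * ?y\<^sup>2 \<le> ?n * ?n" by (intro mult_mono) auto
    hence "1 / (?n * ?n) \<le> 1 / (?x\<^sup>2 * ?y\<^sup>2)" by (intro divide_left_mono mult_pos_pos den) (auto simp: max_def)
    also have "\<dots> = ?x powr (-2) * ?y powr (-2)"
      by (simp add: powr_minus_divide powr_numeral)
    finally have "mollifier 1 z \<le> ?x powr (-2) * ?y powr (-2)" by (simp add: mollifier_def power2_eq_square)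
    thus "ennreal (norm (mollifier 1 z)) \<le> g (fst z) * g (snd z)"
      using pos[of z] by (simp add: g_def ennreal_mult[symmetric] ennreal_leI)
  qed
  also have "\<dots> = (\<integral>\<^sup>+x. g x \<partial>lborel)\<^sup>2" by (rule nn_integral_plane_prod) measurable
  also have "\<dots> \<le> (ennreal ((2 + 2 / (2 - 1)) * 1 powr (1 - 2)))\<^sup>2"
    unfolding g_def by (intro power_mono nn_integral_max_powr) auto
  also have "\<dots> < \<infinity>" by (simp add: ennreal_power)
  finally show i: "integrable lborel (mollifier 1)" by (intro integrableI_bounded) auto
  have "0 \<le> pompeiu_const" unfolding pompeiu_const_def using pos by (intro Bochner_Integration.integral_nonneg) (simp add: less_imp_le)
  moreover have "pompeiu_const \<noteq> 0"
  proof
    assume "pompeiu_const = 0"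
    hence "AE z in lborel. mollifier 1 z = 0"
      unfolding pompeiu_const_def using integral_nonneg_eq_0_iff_AE[OF i] pos by (simp add: less_imp_le)
    hence "AE z in (lborel :: plane measure). False" using pos by (simp add: less_imp_neq[symmetric] order.strict_iff_not)
    hence "emeasure (lborel :: plane measure) (space lborel) = 0" by (auto simp: AE_iff_null)
    thus False by simp
  qed
  ultimately show "0 < pompeiu_const" by simp
qed

lemma integral_affine_plane:
  fixes f :: "plane \<Rightarrow> 'a::{banach, second_countable_topology}"
  assumes "f \<in> borel_measurable borel" "0 < t"
  shows "(\<integral>z. f z \<partial>lborel) = (\<integral>z. t\<^sup>2 *\<^sub>R f (a + t *\<^sub>R z) \<partial>lborel)"
proof -
  have [measurable]: "f \<in> borel_measurable borel" by fact
  have "lborel = density (distr lborel borel (\<lambda>x::plane. a + t *\<^sub>R x)) (\<lambda>_. ennreal (\<bar>t\<bar>^DIM(plane)))"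
    using assms(2) by (intro lborel_affine) simp
  also have "\<dots> = density (distr lborel borel (\<lambda>x::plane. a + t *\<^sub>R x)) (\<lambda>_. ennreal (t\<^sup>2))" by (simp add: power2_eq_square)
  finally have "(\<integral>z. f z \<partial>lborel) = (\<integral>z. f z \<partial>density (distr lborel borel (\<lambda>x::plane. a + t *\<^sub>R x)) (\<lambda>_. ennreal (t\<^sup>2)))"
    by simp
  thus ?thesis by (simp add: integral_density integral_distr)
qed

lemma mollify_limit:
  fixes u :: "plane \<Rightarrow> complex"
  assumes u: "continuous_on UNIV u" and supp: "\<And>z. M < norm z \<Longrightarrow> u z = 0"
  shows "(\<lambda>n. \<integral>z. u z * of_real (mollifier (1 / Suc n) (z - a)) \<partial>lborel) \<longlonglongrightarrow> of_real pompeiu_const * u a"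
proof -
  have um[measurable]: "u \<in> borel_measurable borel" using u by (rule borel_measurable_continuous_onI)
  have mm[measurable]: "mollifier t \<in> borel_measurable borel" for t unfolding mollifier_def[abs_def] by measurable
  have "bounded (u ` cball 0 M)"
    by (intro compact_imp_bounded compact_continuous_image continuous_on_subset[OF u]) auto
  then obtain B where "\<forall>x\<in>u ` cball 0 M. norm x \<le> B" unfolding bounded_iff by blast
  hence B: "norm (u z) \<le> B" if "z \<in> cball 0 M" for z using that by blast
  have B': "norm (u z) \<le> max 0 B" for z
    using B[of z] supp[of z] by (cases "M < norm z") (auto simp: le_max_iff_disj)
  have eq: "(\<integral>z. u z * of_real (mollifier t (z - a)) \<partial>lborel) = (\<integral>z. u (a + t *\<^sub>R z) * of_real (mollifier 1 z) \<partial>lborel)" if "0 < t" for t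
  proof -
    have "t\<^sup>2 * mollifier t (t *\<^sub>R z) = mollifier 1 z" for z :: plane
    proof -
      have "((norm (t *\<^sub>R z))\<^sup>2 + t\<^sup>2)\<^sup>2 = (t\<^sup>2)\<^sup>2 * ((norm z)\<^sup>2 + 1)\<^sup>2"
        by (simp add: power2_eq_square algebra_simps)
      thus ?thesis using that by (simp add: mollifier_def power2_eq_square)
    qed
    hence "t\<^sup>2 *\<^sub>R (u (a + t *\<^sub>R z) * of_real (mollifier t ((a + t *\<^sub>R z) - a))) = u (a + t *\<^sub>R z) * of_real (mollifier 1 z)" for z
    proof -
      have "complex_of_real (mollifier 1 z) = of_real (t\<^sup>2) * of_real (mollifier t (t *\<^sub>R z))"
        unfolding of_real_mult[symmetric] by (simp only: \<open>\<And>z. t\<^sup>2 * mollifier t (t *\<^sub>R z) = mollifier 1 z\<close>)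
      thus ?thesis by (simp add: scaleR_conv_of_real)
    qed
    thus ?thesis
      by (subst integral_affine_plane[OF _ that, where a = a]) simp_all
  qed
  have "(\<lambda>n. \<integral>z. u (a + (1 / Suc n) *\<^sub>R z) * of_real (mollifier 1 z) \<partial>lborel) \<longlonglongrightarrow> (\<integral>z. u a * of_real (mollifier 1 z) \<partial>lborel)"
  proof (rule integral_dominated_convergence[where w = "\<lambda>z. max 0 B * mollifier 1 z"])
    show "integrable lborel (\<lambda>z. max 0 B * mollifier 1 z)" using mollifier_integrable by simp
    show "AE z in lborel. (\<lambda>n. u (a + (1 / Suc n) *\<^sub>R z) * of_real (mollifier 1 z)) \<longlonglongrightarrow> u a * of_real (mollifier 1 z)"
    proof (rule AE_I2)
      fix z :: plane
      have "(\<lambda>n. a + (1 / Suc n) *\<^sub>R z) \<longlonglongrightarrow> a + 0 *\<^sub>R z"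
        by (intro tendsto_intros LIMSEQ_Suc lim_1_over_n)
      moreover have "isCont u a" using u continuous_on_eq_continuous_at[OF open_UNIV] by blast
      ultimately have "(\<lambda>n. u (a + (1 / Suc n) *\<^sub>R z)) \<longlonglongrightarrow> u a" using isCont_tendsto_compose by fastforce
      thus "(\<lambda>n. u (a + (1 / Suc n) *\<^sub>R z) * of_real (mollifier 1 z)) \<longlonglongrightarrow> u a * of_real (mollifier 1 z)"
        by (intro tendsto_intros)
    qed
    show "AE z in lborel. norm (u (a + (1 / Suc n) *\<^sub>R z) * of_real (mollifier 1 z)) \<le> max 0 B * mollifier 1 z" for n
    proof (rule AE_I2)
      fix z :: plane
      have "0 \<le> mollifier 1 z" by (simp add: mollifier_def)
      thus "norm (u (a + (1 / Suc n) *\<^sub>R z) * of_real (mollifier 1 z)) \<le> max 0 B * mollifier 1 z"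
        unfolding norm_mult norm_of_real by (simp add: mult_right_mono B' del: max.absorb1 max.absorb2)
    qed
  qed simp_all
  moreover have "(\<integral>z. u a * of_real (mollifier 1 z) \<partial>lborel) = of_real pompeiu_const * u a"
    unfolding pompeiu_const_def by (subst mult.commute) simp
  moreover have "(\<lambda>n. \<integral>z. u z * of_real (mollifier (1 / Suc n) (z - a)) \<partial>lborel)
      = (\<lambda>n. \<integral>z. u (a + (1 / Suc n) *\<^sub>R z) * of_real (mollifier 1 z) \<partial>lborel)"
    by (rule ext, rule eq) simp
  ultimately show ?thesis by metis
qed

text \<open>Green's formula for the product of \<open>u\<close> and a translate of the regularised kernel represents a mollification of
  \<open>u\<close>; the difference of two such representations is estimated uniformly in \<open>t\<close>.\<close>

proposition pompeiu_difference:
  fixes u :: "plane \<Rightarrow> complex"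
  assumes u: "C1_on UNIV u" and supp: "\<And>z. M < norm z \<Longrightarrow> u z = 0"
  shows "ennreal (pompeiu_const * norm (u a - u b))
     \<le> (\<integral>\<^sup>+z. ennreal (norm (dbar u z) * (norm (a - b) / (norm (z - a) * norm (z - b)))) \<partial>lborel)" (is "_ \<le> ?R")
proof -
  have id: "integrable lborel (\<lambda>z. dbar u z * cauchy_kernel t (z - a))"
    "(\<integral>z. u z * of_real (mollifier t (z - a)) \<partial>lborel) = - (\<integral>z. dbar u z * cauchy_kernel t (z - a) \<partial>lborel)" if t: "0 < t" for t a
  proof -
    let ?k = "\<lambda>z. cauchy_kernel t (z - a)"
    have k: "C1_on UNIV ?k" by (intro C1_translate cauchy_kernel_C1 t)
    have dk: "dbar ?k z = of_real (mollifier t (z - a))" for z by (simp add: dbar_translate cauchy_kernel_C1(2)[OF t])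
    have d: "dbar (\<lambda>z. u z * ?k z) z = u z * of_real (mollifier t (z - a)) + dbar u z * ?k z" for z
      using dbar_mult[OF C1_onD(1)[OF u] C1_onD(1)[OF k], of z] dk by simp
    have cu: "continuous_on UNIV u" "continuous_on UNIV ?k" "continuous_on UNIV (dbar u)" "continuous_on UNIV (\<lambda>z. complex_of_real (mollifier t (z - a)))"
      using continuous_on_dbar[OF k] by (auto simp: dk intro: C1_on_continuous u k continuous_on_dbar)
    have i1: "integrable lborel (\<lambda>z. u z * of_real (mollifier t (z - a)))"
      by (rule integrable_compact_support[where M = M]) (use cu supp in \<open>auto intro!: continuous_intros\<close>)
    show i2: "integrable lborel (\<lambda>z. dbar u z * ?k z)"
      by (rule integrable_compact_support[where M = M]) (use cu vanish_outside(2)[OF supp] in \<open>auto intro!: continuous_intros\<close>)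
    have "(\<integral>z. dbar (\<lambda>z. u z * ?k z) z \<partial>lborel) = 0"
      by (rule integral_dbar_zero[where M = M]) (use supp in \<open>auto intro!: C1_on_mult u k\<close>)
    thus "(\<integral>z. u z * of_real (mollifier t (z - a)) \<partial>lborel) = - (\<integral>z. dbar u z * cauchy_kernel t (z - a) \<partial>lborel)"
      unfolding d using i1 i2 by (simp add: add_eq_0_iff2)
  qed
  define I where "I = (\<lambda>n a. \<integral>z. u z * of_real (mollifier (1 / Suc n) (z - a)) \<partial>lborel)"
  have bd: "ennreal (norm (I n a - I n b)) \<le> ?R" for n
  proof -
    define t where "t = 1 / real (Suc n)"
    have t: "0 < t" by (simp add: t_def)
    have "I n a - I n b = (\<integral>z. dbar u z * cauchy_kernel t (z - b) - dbar u z * cauchy_kernel t (z - a) \<partial>lborel)"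
      unfolding I_def t_def[symmetric] using id(1)[OF t] by (simp add: id(2)[OF t])
    also have "ennreal (norm \<dots>) \<le> (\<integral>\<^sup>+z. ennreal (norm (dbar u z * cauchy_kernel t (z - b) - dbar u z * cauchy_kernel t (z - a))) \<partial>lborel)"
      by (intro integral_norm_bound_ennreal Bochner_Integration.integrable_diff id t)
    also have "\<dots> \<le> ?R"
    proof (rule nn_integral_mono_AE)
      have "AE z in lborel. z \<noteq> a" "AE z in lborel. z \<noteq> b" by (auto intro: AE_lborel_singleton)
      thus "AE z in lborel. ennreal (norm (dbar u z * cauchy_kernel t (z - b) - dbar u z * cauchy_kernel t (z - a))) \<le>
         ennreal (norm (dbar u z) * (norm (a - b) / (norm (z - a) * norm (z - b))))"
      proof eventually_elim
        case (elim z)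
        have "norm (dbar u z * cauchy_kernel t (z - b) - dbar u z * cauchy_kernel t (z - a)) = norm (dbar u z) * norm (cauchy_kernel t (z - a) - cauchy_kernel t (z - b))"
          by (metis norm_mult norm_minus_commute right_diff_distrib)
        also have "\<dots> \<le> norm (dbar u z) * (norm ((z - a) - (z - b)) / (norm (z - a) * norm (z - b)))"
          using elim by (intro mult_left_mono norm_cauchy_kernel_diff_le) auto
        finally show ?case by (simp add: norm_minus_commute ennreal_leI)
      qed
    qed
    finally show ?thesis .
  qed
  have lim: "(\<lambda>n. norm (I n a - I n b)) \<longlonglongrightarrow> norm (of_real pompeiu_const * u a - of_real pompeiu_const * u b)"
    unfolding I_def by (intro tendsto_intros mollify_limit[where M = M] C1_on_continuous u supp)
  have n: "norm (of_real pompeiu_const * u a - of_real pompeiu_const * u b) = pompeiu_const * norm (u a - u b)"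
    using pompeiu_const_pos by (simp add: norm_mult flip: right_diff_distrib)
  show ?thesis
  proof (cases ?R)
    case (real r)
    have "norm (I n a - I n b) \<le> r" for n using bd[of n] real by (simp add: ennreal_le_iff)
    hence "pompeiu_const * norm (u a - u b) \<le> r" using lim unfolding n by (intro LIMSEQ_le_const2) auto
    thus ?thesis using real by (simp add: ennreal_leI)
  qed simp
qed

section \<open>Cut-off functions and punctured domains\<close>

lemma C1_on_Un:
  assumes "open S" "open T" "C1_on S f" "C1_on T f"
  shows "C1_on (S \<union> T) (f :: plane \<Rightarrow> 'a::real_normed_vector)"
  using assms C1_onD(2)[OF assms(3)] C1_onD(2)[OF assms(4)] unfolding Ck_on_Suc higher_differentiable_on.simps(1)
  by (metis Un_iff continuous_on_open_Un)

text \<open>The square of the positive part, the building block of \<open>C\<^sup>1\<close> cut-off functions.\<close>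

definition sqpos :: "real \<Rightarrow> real" where "sqpos x = (max 0 x)\<^sup>2"

lemma sqpos_deriv: "(sqpos has_real_derivative 2 * max 0 x) (at x)"
proof -
  consider "x < 0" | "x = 0" | "0 < x" by linarith
  thus ?thesis
  proof cases
    case 1
    have "((\<lambda>x. 0) has_real_derivative 0) (at x)" by simp
    thus ?thesis using 1
      by (elim has_field_derivative_transform_within_open[where S = "{..<0}", THEN DERIV_cong]) (auto simp: sqpos_def)
  next
    case 2
    have "((\<lambda>y::real. max 0 y) \<longlongrightarrow> max 0 0) (at 0)" by (intro tendsto_intros)
    moreover have "\<forall>\<^sub>F y::real in at 0. max 0 y = (sqpos y - sqpos 0) / (y - 0)"
      by (auto simp: eventually_at sqpos_def max_def power2_eq_square intro!: exI[of _ 1])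
    ultimately have "((\<lambda>y. (sqpos y - sqpos 0) / (y - 0)) \<longlongrightarrow> max 0 0) (at 0)"
      by (rule Lim_transform_eventually)
    hence "((\<lambda>y. (sqpos y - sqpos 0) / (y - 0)) \<longlongrightarrow> 0) (at 0)" by simp
    thus ?thesis using 2 by (simp add: has_field_derivative_iff)
  next
    case 3
    have "((\<lambda>x. x\<^sup>2) has_real_derivative 2 * x) (at x)" by (auto intro!: derivative_eq_intros)
    thus ?thesis using 3
      by (elim has_field_derivative_transform_within_open[where S = "{0<..}", THEN DERIV_cong]) (auto simp: sqpos_def)
  qed
qed

lemma sqpos_simps: "x \<le> 0 \<Longrightarrow> sqpos x = 0" "0 \<le> sqpos x" "sqpos 1 = 1" "0 \<le> x \<Longrightarrow> x \<le> 1 \<Longrightarrow> sqpos x \<le> 1" "1 \<le> x \<Longrightarrow> 1 \<le> sqpos x"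
  by (auto simp: sqpos_def max_def power_le_one)

text \<open>A radial \<open>C\<^sup>1\<close> function equal to \<open>1\<close> for \<open>|z| \<le> r\<close> and to \<open>0\<close> for \<open>|z|\<^sup>2 \<ge> 2 r\<^sup>2\<close>.\<close>

definition cutoff :: "real \<Rightarrow> plane \<Rightarrow> real" where
  "cutoff r z = sqpos (1 - sqpos ((norm z)\<^sup>2 / r\<^sup>2 - 1))"

lemma cutoff_bounds: "0 \<le> cutoff r z" "cutoff r z \<le> 1"
  unfolding cutoff_def using sqpos_simps(2)[of "(norm z)\<^sup>2 / r\<^sup>2 - 1"]
  by (cases "0 \<le> 1 - sqpos ((norm z)\<^sup>2 / r\<^sup>2 - 1)"; simp add: sqpos_simps)+

lemma cutoff_one: "0 < r \<Longrightarrow> norm z \<le> r \<Longrightarrow> cutoff r z = 1"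
  by (simp add: cutoff_def sqpos_simps power_mono)

lemma cutoff_zero:
  assumes "0 < r" "3 / 2 * r \<le> norm z" shows "cutoff r z = 0"
proof -
  have "(3 / 2 * r)\<^sup>2 \<le> (norm z)\<^sup>2" using assms by (intro power_mono) auto
  hence "9 / 4 * r\<^sup>2 \<le> (norm z)\<^sup>2" by (simp add: power_mult_distrib power_divide)
  hence "2 * r\<^sup>2 \<le> (norm z)\<^sup>2" using zero_le_power2[of r] by linarith
  hence "1 \<le> (norm z)\<^sup>2 / r\<^sup>2 - 1" using assms by (simp add: field_simps)
  thus ?thesis by (simp add: cutoff_def sqpos_simps)
qed

lemma cutoff_derivative:
  assumes r: "0 < r"
  shows "C1_on UNIV (\<lambda>z. complex_of_real (cutoff r z))"
    and "norm (dbar (\<lambda>z. complex_of_real (cutoff r z)) z) \<le> 4 * norm z / r\<^sup>2"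
    and "2 * r \<le> norm z \<Longrightarrow> dbar (\<lambda>z. complex_of_real (cutoff r z)) z = 0"
proof -
  define t where "t = (\<lambda>z::plane. (norm z)\<^sup>2 / r\<^sup>2 - 1)"
  define k where "k = (\<lambda>z. - (2 * max 0 (1 - sqpos (t z)) * (2 * max 0 (t z))))"
  have dt: "(t has_derivative (\<lambda>v. (2 * fst z * fst v + 2 * snd z * snd v) / r\<^sup>2)) (at z)" for z
    unfolding t_def norm_plane_sq using r by (auto intro!: derivative_eq_intros simp: fun_eq_iff field_simps)
  define D where "D = (\<lambda>v z. complex_of_real (k z * ((2 * fst z * fst v + 2 * snd z * snd v) / r\<^sup>2)))"
  have dc: "((\<lambda>z. complex_of_real (cutoff r z)) has_derivative (\<lambda>v. D v z)) (at z)" for z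
  proof -
    have "((\<lambda>z. sqpos (t z)) has_derivative (\<lambda>v. (2 * fst z * fst v + 2 * snd z * snd v) / r\<^sup>2 * (2 * max 0 (t z)))) (at z)"
      by (rule DERIV_compose_FDERIV[OF sqpos_deriv dt])
    hence "((\<lambda>z. 1 - sqpos (t z)) has_derivative (\<lambda>v. 0 - (2 * fst z * fst v + 2 * snd z * snd v) / r\<^sup>2 * (2 * max 0 (t z)))) (at z)"
      by (intro has_derivative_diff has_derivative_const)
    from DERIV_compose_FDERIV[OF sqpos_deriv this]
    have "((\<lambda>z. cutoff r z) has_derivative (\<lambda>v. k z * ((2 * fst z * fst v + 2 * snd z * snd v) / r\<^sup>2))) (at z)"
      unfolding cutoff_def[abs_def] t_def by (rule has_derivative_eq_rhs) (simp add: k_def t_def fun_eq_iff)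
    thus ?thesis unfolding D_def by (rule has_derivative_of_real)
  qed
  have ddD: "dd v (\<lambda>z. complex_of_real (cutoff r z)) = D v" for v using dd_eqI[OF dc] by blast
  have cs: "continuous_on UNIV sqpos" using sqpos_deriv DERIV_isCont by (intro continuous_at_imp_continuous_on) blast
  have ct: "continuous_on UNIV t" unfolding t_def using r by (auto intro!: continuous_intros)
  have "continuous_on UNIV k" unfolding k_def
    by (intro continuous_intros ct continuous_on_compose2[OF cs ct]) auto
  hence cD: "continuous_on UNIV (D v)" for v unfolding D_def using r by (auto intro!: continuous_intros)
  show "C1_on UNIV (\<lambda>z. complex_of_real (cutoff r z))"
    unfolding Ck_on_Suc ddD higher_differentiable_on.simps(1) using dc cD differentiableI by blast
  have db: "dbar (\<lambda>z. complex_of_real (cutoff r z)) z = of_real (k z / r\<^sup>2) * to_complex z" for z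
    unfolding dbar_def ddD D_def to_complex_def by (simp add: complex_eq_iff)
  have k2: "1 \<le> t z \<Longrightarrow> k z = 0" for z :: plane
    using sqpos_simps(5)[of "t z"] by (simp add: k_def)
  have k3: "\<bar>k z\<bar> \<le> 4" for z
  proof (cases "0 < t z \<and> t z < 1")
    case True
    have "\<bar>k z\<bar> = (2 * max 0 (1 - sqpos (t z))) * (2 * max 0 (t z))" by (simp add: k_def)
    also have "\<dots> \<le> 2 * 2" using True sqpos_simps(2)[of "t z"] by (intro mult_mono) auto
    finally show ?thesis by simp
  next
    case False thus ?thesis using k2[of z] by (cases "1 \<le> t z") (auto simp: k_def)
  qed
  show "norm (dbar (\<lambda>z. complex_of_real (cutoff r z)) z) \<le> 4 * norm z / r\<^sup>2"
  proof -
    have "norm (dbar (\<lambda>z. complex_of_real (cutoff r z)) z) = \<bar>k z\<bar> * norm z / r\<^sup>2"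
      unfolding db norm_mult norm_of_real to_complex_simps by simp
    also have "\<dots> \<le> 4 * norm z / r\<^sup>2" by (intro divide_right_mono mult_right_mono k3) auto
    finally show ?thesis .
  qed
  show "2 * r \<le> norm z \<Longrightarrow> dbar (\<lambda>z. complex_of_real (cutoff r z)) z = 0"
  proof -
    assume "2 * r \<le> norm z"
    hence "(2 * r)\<^sup>2 \<le> (norm z)\<^sup>2" using r by (intro power_mono) auto
    hence "4 * r\<^sup>2 \<le> (norm z)\<^sup>2" by (simp add: power_mult_distrib)
    hence "2 * r\<^sup>2 \<le> (norm z)\<^sup>2" using zero_le_power2[of r] by linarith
    hence "1 \<le> t z" using r by (simp add: t_def field_simps)
    thus ?thesis by (simp add: db k2)
  qed
qed

text \<open>The function \<open>w\<close> cut off to the disk of radius \<open>s\<close> about \<open>p\<close>, unchanged on the disk of radius \<open>s / 2\<close>.\<close>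

definition cut :: "plane \<Rightarrow> real \<Rightarrow> (plane \<Rightarrow> complex) \<Rightarrow> plane \<Rightarrow> complex" where
  "cut p s w z = of_real (cutoff (s/2) (z - p)) * w z"

lemma cut_C1:
  assumes s: "0 < s" and S: "open S" "C1_on S w" and T: "T \<subseteq> S \<union> {z. 3/4 * s < norm (z - p)}"
  shows "C1_on T (cut p s w)"
proof -
  let ?E = "{z. 3/4 * s < norm (z - p)}"
  have "C1_on S (cut p s w)" unfolding cut_def
    by (intro C1_on_mult S Ck_on_subset[OF C1_translate[OF cutoff_derivative(1)]]) (use s in auto)
  moreover have o: "open ?E" by (intro open_Collect_less continuous_intros)
  moreover have "C1_on ?E (cut p s w)"
    by (rule Ck_on_cong[OF o Ck_on_const[where c = 0]]) (use s in \<open>auto simp: cut_def cutoff_zero\<close>)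
  ultimately have "C1_on (S \<union> ?E) (cut p s w)" using S by (intro C1_on_Un)
  thus ?thesis using T by (rule Ck_on_subset)
qed

lemma cut_outside: "0 < s \<Longrightarrow> s < norm (z - p) \<Longrightarrow> cut p s w z = 0"
  by (simp add: cut_def cutoff_zero)

lemma cut_inside: "0 < s \<Longrightarrow> norm (z - p) \<le> s / 2 \<Longrightarrow> cut p s w z = w z"
  by (simp add: cut_def cutoff_one)

lemma cut_norm: "norm (cut p s w z) \<le> norm (w z)"
  using cutoff_bounds[of "s/2" "z - p"] by (simp add: cut_def norm_mult mult_left_le_one_le)

lemma cut_dbar:
  assumes s: "0 < s" and w: "w differentiable (at z)"
  shows "norm (dbar (cut p s w) z) \<le> norm (dbar w z) + 16 * norm (z - p) / s\<^sup>2 * norm (w z)"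
proof -
  let ?c = "\<lambda>z. complex_of_real (cutoff (s/2) (z - p))"
  have c: "?c differentiable (at z)"
    using C1_onD(1)[OF C1_translate[OF cutoff_derivative(1)]] s by simp
  have "dbar (cut p s w) z = ?c z * dbar w z + dbar ?c z * w z"
    unfolding cut_def by (rule dbar_mult[OF c w])
  also have "norm \<dots> \<le> norm (?c z * dbar w z) + norm (dbar ?c z * w z)" by (rule norm_triangle_ineq)
  also have "\<dots> \<le> norm (dbar w z) + 16 * norm (z - p) / s\<^sup>2 * norm (w z)"
  proof (rule add_mono)
    show "norm (?c z * dbar w z) \<le> norm (dbar w z)"
      using cutoff_bounds[of "s/2" "z - p"] by (simp add: norm_mult mult_left_le_one_le)
    have "norm (dbar ?c z) \<le> 4 * norm (z - p) / (s/2)\<^sup>2"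
      using dbar_translate[of "\<lambda>z. complex_of_real (cutoff (s/2) z)" p z] cutoff_derivative(2)[of "s/2" "z - p"] s by simp
    hence "norm (dbar ?c z) * norm (w z) \<le> 4 * norm (z - p) / (s/2)\<^sup>2 * norm (w z)" by (rule mult_right_mono) simp
    thus "norm (dbar ?c z * w z) \<le> 16 * norm (z - p) / s\<^sup>2 * norm (w z)"
      by (simp add: norm_mult power_divide)
  qed
  finally show ?thesis .
qed

text \<open>The singularity is removed by an inner cut-off of radius \<open>r\<close>.  Its derivative contributes at most
  \<open>(1/r) sup |G|\<close> times an area of order \<open>r\<^sup>2\<close>, which tends to zero since \<open>G = o(1/|z|)\<close>.\<close>

proposition pompeiu_difference_punctured:
  fixes G :: "plane \<Rightarrow> complex"
  assumes G: "C1_on (- {0}) G" and supp: "\<And>z. M < norm z \<Longrightarrow> G z = 0"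
    and small: "\<And>e. 0 < e \<Longrightarrow> \<exists>d>0. \<forall>z. 0 < norm z \<and> norm z < d \<longrightarrow> norm z * norm (G z) \<le> e"
    and B: "\<And>z. z \<noteq> 0 \<Longrightarrow> norm (dbar G z) \<le> B z"
    and ab: "a \<noteq> 0" "b \<noteq> 0"
  shows "ennreal (pompeiu_const * norm (G a - G b))
     \<le> (\<integral>\<^sup>+z. ennreal (B z * (norm (a - b) / (norm (z - a) * norm (z - b)))) \<partial>lborel)" (is "_ \<le> ?R")
proof (rule ennreal_le_epsilon)
  define K where "K = (\<lambda>z. norm (a - b) / (norm (z - a) * norm (z - b)))"
  have K0: "0 \<le> K z" for z by (simp add: K_def)
  obtain C where C: "0 < C" "\<And>(a::plane) b r. 0 \<le> r \<Longrightarrow> b \<in> cball a r \<Longrightarrow>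
    (\<integral>\<^sup>+z. ennreal (1 / norm (z - b)) * indicator (cball a r) z \<partial>lborel) \<le> ennreal (C * r)"
    using nn_integral_cball_norm by blast
  define k where "k = 4 * norm (a - b) / (norm a * norm b)"
  have k0: "0 \<le> k" by (simp add: k_def)
  fix e :: real assume e: "0 < e"
  define e' where "e' = e / (k + 1) / (16 * C)"
  have e': "0 < e'" using e C k0 by (simp add: e'_def)
  obtain d where d: "0 < d" "\<And>z. 0 < norm z \<Longrightarrow> norm z < d \<Longrightarrow> norm z * norm (G z) \<le> e'"
    using small[OF e'] by blast
  define r where "r = min (d / 4) (min (norm a / 4) (norm b / 4))"
  have r: "0 < r" "4 * r \<le> d" "4 * r \<le> norm a" "4 * r \<le> norm b" using d ab by (auto simp: r_def)
  let ?c = "\<lambda>z. complex_of_real (cutoff r z)"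
  define u where "u = (\<lambda>z. (1 + of_real (-1) * ?c z) * G z)"
  have c1: "C1_on UNIV (\<lambda>z. 1 + of_real (-1) * ?c z)"
    by (intro Ck_on_add Ck_on_const Ck_on_linear[OF _ bounded_linear_mult_right] cutoff_derivative r) auto
  have uC1: "C1_on UNIV u"
  proof -
    have 1: "C1_on (- {0}) u" unfolding u_def
      by (intro C1_on_mult G Ck_on_subset[OF c1]) auto
    have 2: "C1_on (ball 0 r) u"
      by (rule Ck_on_cong[OF _ Ck_on_const[where c = 0]]) (auto simp: u_def cutoff_one r)
    have "- {0} \<union> ball (0::plane) r = UNIV" using r by auto
    thus ?thesis using C1_on_Un[OF _ _ 1 2] by (simp add: open_Compl)
  qed
  have usupp: "M < norm z \<Longrightarrow> u z = 0" for z by (simp add: u_def supp)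
  have uab: "u a = G a" "u b = G b" using r by (auto simp: u_def cutoff_zero)
  have pw: "ennreal (norm (dbar u z) * K z) \<le> ennreal (norm (dbar G z) * K z) * indicator (- {0}) z
     + ennreal (8 * e' * k / r) * (ennreal (1 / norm (z - 0)) * indicator (cball 0 (2 * r)) z)" for z
  proof (cases "z = 0")
    case True
    have "dbar u z = dbar (\<lambda>z. 0) z"
      by (rule dbar_cong[of "ball 0 r"]) (use r True in \<open>auto simp: u_def cutoff_one\<close>)
    thus ?thesis by (simp add: dbar_def dd_def)
  next
    case False
    have Gd: "G differentiable (at z)" using C1_onD(1)[OF G] False by simp
    have dc: "dbar (\<lambda>z. 1 + of_real (-1) * ?c z) z = - dbar ?c z"
    proof -
      have "?c differentiable (at z)" by (rule C1_onD(1)[OF cutoff_derivative(1)]) (use r in auto)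
      hence "dd v (\<lambda>z. 1 + of_real (-1) * ?c z) z = - dd v ?c z" for v
        using dd_add[of "\<lambda>z. 1" z "\<lambda>z. of_real (-1) * ?c z" v]
          dd_linear[OF _ bounded_linear_mult_right[of "of_real (-1)"], of ?c z v] dd_eqI[OF has_derivative_const[of 1]]
        by (simp add: differentiable_minus)
      thus ?thesis by (simp add: dbar_def field_simps)
    qed
    have "dbar u z = (1 + of_real (-1) * ?c z) * dbar G z + (- dbar ?c z) * G z"
      unfolding u_def dc[symmetric] by (rule dbar_mult[OF C1_onD(1)[OF c1] Gd]) simp
    also have "norm \<dots> \<le> norm ((1 + of_real (-1) * ?c z) * dbar G z) + norm ((- dbar ?c z) * G z)" by (rule norm_triangle_ineq)
    also have "norm ((1 + of_real (-1) * ?c z) * dbar G z) \<le> norm (dbar G z)"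
    proof -
      have "1 + of_real (-1) * ?c z = of_real (1 - cutoff r z)" by simp
      hence "norm (1 + of_real (-1) * ?c z) \<le> 1" using cutoff_bounds[of r z] by (metis norm_of_real abs_of_nonneg diff_ge_0_iff_ge diff_le_eq le_add_same_cancel1)
      thus ?thesis by (simp only: norm_mult mult_left_le_one_le norm_ge_zero)
    qed
    finally have n: "norm (dbar u z) \<le> norm (dbar G z) + norm (dbar ?c z) * norm (G z)" by (simp add: norm_mult)
    show ?thesis
    proof (cases "2 * r \<le> norm z")
      case True
      hence "norm (dbar u z) \<le> norm (dbar G z)" using n cutoff_derivative(3)[OF r(1)] by simp
      hence "ennreal (norm (dbar u z) * K z) \<le> ennreal (norm (dbar G z) * K z)" by (intro ennreal_leI mult_right_mono K0)
      thus ?thesis using False by (simp add: add_increasing2)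
    next
      case less: False
      have "norm (dbar ?c z) * norm (G z) \<le> (8 * e' / r) * (1 / norm z)"
      proof -
        have "norm z * norm (G z) \<le> e'" using less r False by (intro d) auto
        hence "norm (G z) \<le> e' / norm z" using False by (simp add: field_simps)
        moreover have "norm (dbar ?c z) \<le> 8 / r"
        proof -
          have "norm (dbar ?c z) \<le> 4 * norm z / r\<^sup>2" by (rule cutoff_derivative(2)[OF r(1)])
          also have "\<dots> \<le> 4 * (2 * r) / r\<^sup>2" using less by (intro divide_right_mono) auto
          finally show ?thesis using r by (simp add: power2_eq_square)
        qed
        ultimately have "norm (dbar ?c z) * norm (G z) \<le> (8 / r) * (e' / norm z)" using r by (intro mult_mono) auto
        thus ?thesis by simp
      qed
      moreover have "K z \<le> k"
      proof -
        have "norm a / 2 \<le> norm (z - a)" using less r norm_triangle_sub[of a z] by (simp add: norm_minus_commute)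
        moreover have "norm b / 2 \<le> norm (z - b)" using less r norm_triangle_sub[of b z] by (simp add: norm_minus_commute)
        ultimately have "norm a / 2 * (norm b / 2) \<le> norm (z - a) * norm (z - b)" by (intro mult_mono) auto
        moreover have "0 < norm a / 2 * (norm b / 2)" using ab by simp
        ultimately have "K z \<le> norm (a - b) / (norm a / 2 * (norm b / 2))" unfolding K_def
          by (intro divide_left_mono) (auto intro: mult_pos_pos less_le_trans)
        thus ?thesis by (simp add: k_def mult.commute)
      qed
      ultimately have "norm (dbar ?c z) * norm (G z) * K z \<le> (8 * e' / r) * (1 / norm z) * k"
        by (rule mult_mono) (use K0 e' r in simp_all)
      moreover have "norm (dbar u z) * K z \<le> norm (dbar G z) * K z + norm (dbar ?c z) * norm (G z) * K z"
        using mult_right_mono[OF n K0] by (simp add: algebra_simps)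
      ultimately have "norm (dbar u z) * K z \<le> norm (dbar G z) * K z + (8 * e' * k / r) * (1 / norm z)"
        by (simp add: mult_ac)
      hence "ennreal (norm (dbar u z) * K z) \<le> ennreal (norm (dbar G z) * K z) + ennreal (8 * e' * k / r) * ennreal (1 / norm z)"
        using K0 e' k0 r by (simp add: ennreal_mult[symmetric] ennreal_plus[symmetric] ennreal_leI del: ennreal_plus)
      thus ?thesis using False less by simp
    qed
  qed
  have mG: "(\<lambda>z. ennreal (norm (dbar G z) * K z) * indicator (- {0}) z) \<in> borel_measurable borel"
  proof -
    have m: "(\<lambda>z. indicator (- {0}) z *\<^sub>R norm (dbar G z)) \<in> borel_measurable borel"
      by (intro borel_measurable_continuous_on_indicator continuous_intros continuous_on_dbar G) auto
    have "(\<lambda>z. ennreal ((indicator (- {0}) z *\<^sub>R norm (dbar G z)) * K z)) \<in> borel_measurable borel"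
      unfolding K_def by (intro measurable_compose[OF _ measurable_ennreal] borel_measurable_times m) simp
    also have "(\<lambda>z. ennreal ((indicator (- {0}) z *\<^sub>R norm (dbar G z)) * K z)) = (\<lambda>z. ennreal (norm (dbar G z) * K z) * indicator (- {0}) z)"
      by (rule ext) (simp add: indicator_def)
    finally show ?thesis .
  qed
  have "ennreal (pompeiu_const * norm (G a - G b)) \<le> (\<integral>\<^sup>+z. ennreal (norm (dbar u z) * K z) \<partial>lborel)"
    unfolding uab[symmetric] K_def by (rule pompeiu_difference[OF uC1 usupp])
  also have "\<dots> \<le> (\<integral>\<^sup>+z. ennreal (norm (dbar G z) * K z) * indicator (- {0}) z
     + ennreal (8 * e' * k / r) * (ennreal (1 / norm (z - 0)) * indicator (cball 0 (2 * r)) z) \<partial>lborel)"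
    by (intro nn_integral_mono pw)
  also have "\<dots> = (\<integral>\<^sup>+z. ennreal (norm (dbar G z) * K z) * indicator (- {0}) z \<partial>lborel)
     + ennreal (8 * e' * k / r) * (\<integral>\<^sup>+z. ennreal (1 / norm (z - 0)) * indicator (cball (0::plane) (2 * r)) z \<partial>lborel)"
    using mG by (subst nn_integral_add) (auto intro!: nn_integral_cmult borel_measurable_times_ennreal borel_measurable_indicator)
  also have "\<dots> \<le> ?R + ennreal (8 * e' * k / r) * ennreal (C * (2 * r))"
  proof (intro add_mono mult_left_mono C)
    show "(\<integral>\<^sup>+z. ennreal (norm (dbar G z) * K z) * indicator (- {0}) z \<partial>lborel) \<le> ?R"
    proof (rule nn_integral_mono)
      fix z
      have "ennreal (norm (dbar G z) * K z) \<le> ennreal (B z * K z)" if "z \<noteq> 0"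
        by (intro ennreal_leI mult_right_mono B K0 that)
      thus "ennreal (norm (dbar G z) * K z) * indicator (- {0}) z
          \<le> ennreal (B z * (norm (a - b) / (norm (z - a) * norm (z - b))))"
        by (cases "z = 0") (simp_all add: K_def)
    qed
  qed (use r in auto)
  also have "ennreal (8 * e' * k / r) * ennreal (C * (2 * r)) \<le> ennreal e"
  proof -
    have "8 * e' * k / r * (C * (2 * r)) = 16 * C * k * e'" using r(1) by simp
    also have "\<dots> = e * (k / (k + 1))" using C(1) unfolding e'_def by simp
    also have "\<dots> \<le> e * 1" using e k0 by (intro mult_left_mono) auto
    finally show ?thesis using r C k0 e' by (simp add: ennreal_mult[symmetric] ennreal_leI)
  qed
  finally show "ennreal (pompeiu_const * norm (G a - G b)) \<le> ?R + ennreal e" by (simp add: add_left_mono)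
qed

lemma norm_first_axis: "norm ((x, 0) :: plane) = \<bar>x\<bar>"
  by (simp add: norm_prod_def)

text \<open>With the second point at distance \<open>3 r\<close> from the centre, the kernel for differences reduces to twice the Cauchy kernel.\<close>

lemma far_kernel_le:
  fixes z a p :: plane
  assumes "0 < r" "z \<in> cball p r" "a \<in> cball p r"
  shows "norm (a - (p + (3 * r, 0))) / (norm (z - a) * norm (z - (p + (3 * r, 0)))) \<le> 2 / norm (z - a)"
proof -
  define b where "b = p + (3 * r, 0)"
  have n: "norm (p - b) = 3 * r" using assms norm_first_axis[of "3 * r"] unfolding b_def by (simp add: norm_minus_commute)
  have "norm (a - b) \<le> norm (a - p) + norm (p - b)" using norm_triangle_ineq[of "a - p" "p - b"] by simp
  hence 1: "norm (a - b) \<le> 4 * r" using assms n by (simp add: dist_norm norm_minus_commute)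
  have "norm (p - b) \<le> norm (p - z) + norm (z - b)" using norm_triangle_ineq[of "p - z" "z - b"] by simp
  hence 2: "2 * r \<le> norm (z - b)" using assms n by (simp add: dist_norm norm_minus_commute)
  have "norm (a - b) / norm (z - b) \<le> 4 * r / (2 * r)" using 1 2 assms by (intro frac_le) auto
  hence "norm (a - b) / norm (z - b) / norm (z - a) \<le> 2 / norm (z - a)" using assms by (intro divide_right_mono) auto
  thus ?thesis unfolding b_def by (simp add: mult.commute)
qed

lemma pompeiu_bound:
  fixes u :: "plane \<Rightarrow> complex"
  assumes u: "C1_on UNIV u" and r: "0 < r" and supp: "\<And>z. r < norm (z - p) \<Longrightarrow> u z = 0"
    and B: "\<And>z. z \<in> cball p r \<Longrightarrow> norm (dbar u z) \<le> B z" and a: "a \<in> cball p r"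
  shows "ennreal (pompeiu_const * norm (u a)) \<le> (\<integral>\<^sup>+z. ennreal (2 * B z / norm (z - a)) * indicator (cball p r) z \<partial>lborel)"
proof -
  let ?b = "p + (3 * r, 0)"
  have o: "open {z. r < norm (z - p)}" by (intro open_Collect_less continuous_intros)
  have out: "dbar u z = 0" if "r < norm (z - p)" for z
  proof -
    have "dbar u z = dbar (\<lambda>z. 0) z" by (rule dbar_cong[OF o]) (use that supp in auto)
    thus ?thesis by (simp add: dbar_def dd_def)
  qed
  have ub: "u ?b = 0" using r by (intro supp) (simp add: norm_first_axis)
  have s: "u z = 0" if "norm p + r < norm z" for z
    using norm_triangle_sub[of z p] that by (intro supp) linarith
  have "ennreal (pompeiu_const * norm (u a - u ?b)) \<le> (\<integral>\<^sup>+z. ennreal (norm (dbar u z) * (norm (a - ?b) / (norm (z - a) * norm (z - ?b)))) \<partial>lborel)"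
    by (rule pompeiu_difference[OF u s])
  also have "\<dots> \<le> (\<integral>\<^sup>+z. ennreal (2 * B z / norm (z - a)) * indicator (cball p r) z \<partial>lborel)"
  proof (rule nn_integral_mono)
    fix z
    show "ennreal (norm (dbar u z) * (norm (a - ?b) / (norm (z - a) * norm (z - ?b)))) \<le> ennreal (2 * B z / norm (z - a)) * indicator (cball p r) z"
    proof (cases "z \<in> cball p r")
      case True
      have "norm (dbar u z) * (norm (a - ?b) / (norm (z - a) * norm (z - ?b))) \<le> B z * (2 / norm (z - a))"
        using far_kernel_le[OF r True a] B[OF True] order_trans[OF norm_ge_zero B[OF True]] by (intro mult_mono) auto
      thus ?thesis using True by (simp add: ennreal_leI mult.commute)
    next
      case False
      thus ?thesis using out[of z] by (simp add: dist_norm norm_minus_commute)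
    qed
  qed
  finally show ?thesis using ub by simp
qed

lemma pompeiu_bound_punctured:
  fixes G :: "plane \<Rightarrow> complex"
  assumes G: "C1_on (- {0}) G" and r: "0 < r" and supp: "\<And>z. r < norm z \<Longrightarrow> G z = 0"
    and small: "\<And>e. 0 < e \<Longrightarrow> \<exists>d>0. \<forall>z. 0 < norm z \<and> norm z < d \<longrightarrow> norm z * norm (G z) \<le> e"
    and B: "\<And>z. z \<in> cball 0 r - {0} \<Longrightarrow> norm (dbar G z) \<le> B z" and B0: "0 \<le> B 0" and a: "a \<in> cball 0 r - {0}"
  shows "ennreal (pompeiu_const * norm (G a)) \<le> (\<integral>\<^sup>+z. ennreal (2 * B z / norm (z - a)) * indicator (cball 0 r) z \<partial>lborel)"
proof -
  let ?b = "0 + (3 * r, 0)"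
  have out: "dbar G z = 0" if "r < norm z" for z by (rule vanish_outside(2)[OF supp that])
  have ub: "G ?b = 0" using r by (intro supp) (simp add: norm_first_axis)
  define B' where "B' = (\<lambda>z. if z \<in> cball 0 r then B z else 0)"
  have "ennreal (pompeiu_const * norm (G a - G ?b)) \<le> (\<integral>\<^sup>+z. ennreal (B' z * (norm (a - ?b) / (norm (z - a) * norm (z - ?b)))) \<partial>lborel)"
  proof (rule pompeiu_difference_punctured[OF G supp small])
    show "norm (dbar G z) \<le> B' z" if "z \<noteq> 0" for z using that B[of z] out[of z] by (auto simp: B'_def)
  qed (use a r in \<open>auto simp: zero_prod_def\<close>)
  also have "\<dots> \<le> (\<integral>\<^sup>+z. ennreal (2 * B z / norm (z - a)) * indicator (cball 0 r) z \<partial>lborel)"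
  proof (rule nn_integral_mono)
    fix z
    show "ennreal (B' z * (norm (a - ?b) / (norm (z - a) * norm (z - ?b)))) \<le> ennreal (2 * B z / norm (z - a)) * indicator (cball 0 r) z"
    proof (cases "z \<in> cball 0 r")
      case True
      have "0 \<le> B z" using B[of z] B0 True order_trans[OF norm_ge_zero] by (cases "z = 0") auto
      hence "B' z * (norm (a - ?b) / (norm (z - a) * norm (z - ?b))) \<le> B z * (2 / norm (z - a))"
        using mult_left_mono[OF far_kernel_le[OF r True, of a], of "B z"] a True by (simp add: B'_def)
      thus ?thesis using True by (simp add: ennreal_leI mult.commute)
    qed (simp add: B'_def)
  qed
  finally show ?thesis using ub by simp
qed

section \<open>Point picking and regularity at small energy\<close>

text \<open>Near the chosen point, on a disk whose radius is comparable to the distance to the boundary, \<open>f\<close> is at most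
  doubled.  The point maximises \<open>(\<rho> - dist z0 z) * f z\<close>.\<close>

lemma point_picking:
  fixes f :: "'a::{heine_borel,real_normed_vector} \<Rightarrow> real"
  assumes f: "continuous_on (cball z0 \<rho>) f" and f0: "\<And>z. 0 \<le> f z" and \<rho>: "0 < \<rho>"
  obtains z1 \<sigma> where "0 \<le> \<sigma>" "cball z1 \<sigma> \<subseteq> cball z0 \<rho>" "\<sigma> \<le> \<rho>" "f z0 * \<rho> \<le> 2 * \<sigma> * f z1"
    "\<And>z. z \<in> cball z1 \<sigma> \<Longrightarrow> f z \<le> 2 * f z1"
proof -
  define g where "g = (\<lambda>z. (\<rho> - dist z0 z) * f z)"
  have "continuous_on (cball z0 \<rho>) g" unfolding g_def by (intro continuous_intros f)
  then obtain z1 where z1: "z1 \<in> cball z0 \<rho>" "\<And>z. z \<in> cball z0 \<rho> \<Longrightarrow> g z \<le> g z1"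
    using continuous_attains_sup[of "cball z0 \<rho>" g] \<rho> by auto
  define \<sigma> where "\<sigma> = (\<rho> - dist z0 z1) / 2"
  have \<sigma>: "0 \<le> \<sigma>" "dist z0 z1 = \<rho> - 2 * \<sigma>" using z1(1) by (simp_all add: \<sigma>_def field_simps)
  have d: "dist z0 z \<le> \<rho> - \<sigma>" if "z \<in> cball z1 \<sigma>" for z
    using that \<sigma> dist_triangle[of z0 z z1] by simp
  show ?thesis
  proof (rule that[of \<sigma> z1])
    show "cball z1 \<sigma> \<subseteq> cball z0 \<rho>" using d \<sigma> by fastforce
    show "\<sigma> \<le> \<rho>" using \<sigma> zero_le_dist[of z0 z1] by linarith
    have g1: "g z1 = 2 * \<sigma> * f z1" using \<sigma> by (simp add: g_def)
    show "f z0 * \<rho> \<le> 2 * \<sigma> * f z1" proof -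
      have "g z0 \<le> g z1" using \<rho> by (intro z1) simp
      thus ?thesis unfolding g1 by (simp add: g_def mult.commute)
    qed
    fix z assume z: "z \<in> cball z1 \<sigma>"
    show "f z \<le> 2 * f z1"
    proof (cases "\<sigma> = 0")
      case True thus ?thesis using z f0[of z] by auto
    next
      case False
      have "\<sigma> * f z \<le> g z" unfolding g_def using d[OF z] f0[of z] by (intro mult_right_mono) auto
      also have "\<dots> \<le> 2 * \<sigma> * f z1" using z1(2)[of z] d[OF z] \<sigma> g1 by simp
      finally have "\<sigma> * f z \<le> \<sigma> * (2 * f z1)" by (simp add: mult_ac)
      thus ?thesis using False \<sigma> by simp
    qed
  qed (use \<sigma> in auto)
qed

text \<open>At a picked point \<open>z1\<close> for \<open>|w|\<^sup>2\<close> the cubic right-hand side is at most a multiple of \<open>L\<^sup>3\<close>, where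
  \<open>L = |w z1|\<close>.  On a disk of radius \<open>s\<close> well below \<open>1 / L\<^sup>2\<close> this term is absorbed into \<open>L\<close>, and the cut-off
  term is estimated by the energy.  Small energy excludes that the picked radius \<open>\<sigma>\<close> exceeds that threshold.\<close>

proposition eps_regularity:
  assumes A: "0 < A"
  obtains C \<eta> where "0 < C" "0 < \<eta>"
    "\<And>w1 w2 S z0 \<rho> e. \<lbrakk>open S; cball z0 \<rho> \<subseteq> S; 0 < \<rho>; C1_on S w1; C1_on S w2;
       \<And>z. z \<in> cball z0 \<rho> \<Longrightarrow> norm (dbar w1 z) \<le> A * (norm (w1 z) + norm (w2 z)) ^ 3;
       \<And>z. z \<in> cball z0 \<rho> \<Longrightarrow> norm (dbar w2 z) \<le> A * (norm (w1 z) + norm (w2 z)) ^ 3;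
       (\<integral>\<^sup>+z. ennreal ((norm (w1 z) + norm (w2 z)) ^ 4) * indicator (cball z0 \<rho>) z \<partial>lborel) \<le> ennreal e;
       0 \<le> e; e \<le> \<eta>\<rbrakk> \<Longrightarrow> (norm (w1 z0) + norm (w2 z0)) ^ 4 * \<rho>\<^sup>2 \<le> C * e"
proof -
  obtain C1 where C1: "0 < C1" "\<And>(a::plane) b r. 0 \<le> r \<Longrightarrow> b \<in> cball a r \<Longrightarrow>
    (\<integral>\<^sup>+z. ennreal (1 / norm (z - b)) * indicator (cball a r) z \<partial>lborel) \<le> ennreal (C1 * r)"
    using nn_integral_cball_norm by blast
  let ?c = pompeiu_const
  have c: "0 < ?c" by (rule pompeiu_const_pos)
  define C2 where "C2 = 128 * (256 * C1) ^ 3 / ?c ^ 4"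
  define m where "m = ?c / (48 * A * C1)"
  define \<eta> where "\<eta> = m\<^sup>2 / (2 * C2)"
  have C2: "0 < C2" and m: "0 < m" using C1 c A by (auto simp: C2_def m_def)
  hence \<eta>: "0 < \<eta>" by (simp add: \<eta>_def)
  show ?thesis
  proof (rule that[of "4 * C2" \<eta>])
    fix w1 w2 S z0 \<rho> e
    assume S: "open S" "cball z0 \<rho> \<subseteq> S" "0 < \<rho>" "C1_on S w1" "C1_on S w2"
      and d1: "\<And>z. z \<in> cball z0 \<rho> \<Longrightarrow> norm (dbar w1 z) \<le> A * (norm (w1 z) + norm (w2 z)) ^ 3"
      and d2: "\<And>z. z \<in> cball z0 \<rho> \<Longrightarrow> norm (dbar w2 z) \<le> A * (norm (w1 z) + norm (w2 z)) ^ 3"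
      and E: "(\<integral>\<^sup>+z. ennreal ((norm (w1 z) + norm (w2 z)) ^ 4) * indicator (cball z0 \<rho>) z \<partial>lborel) \<le> ennreal e"
      and e: "0 \<le> e" "e \<le> \<eta>"
    define q where "q = (\<lambda>z. norm (w1 z) + norm (w2 z))"
    have q0: "0 \<le> q z" for z by (simp add: q_def)
    have cq: "continuous_on S q" unfolding q_def by (intro continuous_intros C1_on_continuous S)
    obtain z1 \<sigma> where z1: "0 \<le> \<sigma>" "cball z1 \<sigma> \<subseteq> cball z0 \<rho>" "(q z0)\<^sup>2 * \<rho> \<le> 2 * \<sigma> * (q z1)\<^sup>2"
      and dbl: "\<And>z. z \<in> cball z1 \<sigma> \<Longrightarrow> (q z)\<^sup>2 \<le> 2 * (q z1)\<^sup>2"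
    proof (rule point_picking[of z0 \<rho> "\<lambda>z. (q z)\<^sup>2"])
      show "continuous_on (cball z0 \<rho>) (\<lambda>z. (q z)\<^sup>2)" by (intro continuous_intros continuous_on_subset[OF cq] S(2))
    qed (use S(3) in auto)
    define L where "L = q z1"
    have key: "L ^ 4 * s\<^sup>2 \<le> C2 * e" if s: "0 < s" "s \<le> \<sigma>" "s \<le> m / L\<^sup>2" and L: "0 < L" for s
    proof -
      \<comment> \<open>The cut-off term is linear in \<open>q\<close>; splitting it as \<open>q \<le> a + q\<^sup>4 / a\<^sup>3\<close> makes the first part absorbable.\<close>
      define a where "a = ?c * L / (256 * C1)"
      have a: "0 < a" using c L C1 by (simp add: a_def)
      have sub: "cball z1 s \<subseteq> cball z1 \<sigma>" using s by auto
      have q3: "(q z) ^ 3 \<le> 3 * L ^ 3" if "z \<in> cball z1 s" for z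
      proof -
        have 1: "(q z)\<^sup>2 \<le> 2 * L\<^sup>2" unfolding L_def using that sub by (intro dbl) blast
        also have "\<dots> \<le> (3/2 * L)\<^sup>2" using zero_le_power2[of L] by (simp add: power_mult_distrib power_divide)
        finally have "q z \<le> 3/2 * L" by (rule power2_le_imp_le) (use L in auto)
        hence "(q z)\<^sup>2 * q z \<le> 2 * L\<^sup>2 * (3/2 * L)" using 1 q0[of z] by (intro mult_mono) auto
        thus ?thesis by (simp add: power2_eq_square power3_eq_cube)
      qed
      define b where "b = 6 * A * L ^ 3 + 32 * a / s"
      have b: "0 \<le> b" using A L a s by (simp add: b_def)
      have one: "?c * norm (w z1) \<le> b * (C1 * s) + 32 / (s\<^sup>2 * a ^ 3) * e"
        if w: "C1_on S w" "\<And>z. z \<in> cball z0 \<rho> \<Longrightarrow> norm (dbar w z) \<le> A * (q z) ^ 3" "\<And>z. norm (w z) \<le> q z" for w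
      proof -
        define B where "B = (\<lambda>z. A * (3 * L ^ 3) + 16 * norm (z - z1) / s\<^sup>2 * q z)"
        have "ennreal (?c * norm (cut z1 s w z1)) \<le> (\<integral>\<^sup>+z. ennreal (2 * B z / norm (z - z1)) * indicator (cball z1 s) z \<partial>lborel)"
        proof (rule pompeiu_bound[where u = "cut z1 s w" and a = z1 and B = B])
          show "C1_on UNIV (cut z1 s w)"
          proof (rule cut_C1[OF s(1) S(1) w(1)])
            show "UNIV \<subseteq> S \<union> {z. 3/4 * s < norm (z - z1)}"
            proof
              fix z
              have "z \<in> S" if "norm (z - z1) \<le> 3/4 * s"
                using that s sub z1(2) S(2) by (intro subsetD[OF S(2)] subsetD[OF z1(2)] subsetD[OF sub]) (simp add: dist_norm norm_minus_commute)
              thus "z \<in> S \<union> {z. 3/4 * s < norm (z - z1)}" by (auto simp: not_less)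
            qed
          qed
          show "norm (dbar (cut z1 s w) z) \<le> B z" if z: "z \<in> cball z1 s" for z
          proof -
            have zS: "z \<in> cball z0 \<rho>" "z \<in> S" using z sub z1(2) S(2) by blast+
            have "norm (dbar (cut z1 s w) z) \<le> norm (dbar w z) + 16 * norm (z - z1) / s\<^sup>2 * norm (w z)"
              by (rule cut_dbar[OF s(1) C1_onD(1)[OF w(1) zS(2)]])
            also have "\<dots> \<le> A * (3 * L ^ 3) + 16 * norm (z - z1) / s\<^sup>2 * q z"
              using order_trans[OF w(2)[OF zS(1)] mult_left_mono[OF q3[OF z], of A]] A by (intro add_mono mult_left_mono w(3)) auto
            finally show ?thesis by (simp add: B_def)
          qed
        qed (use s in \<open>auto simp: cut_outside\<close>)
        also have "\<dots> \<le> (\<integral>\<^sup>+z. ennreal b * (ennreal (1 / norm (z - z1)) * indicator (cball z1 s) z)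
            + ennreal (32 / (s\<^sup>2 * a ^ 3)) * (ennreal ((q z) ^ 4) * indicator (cball z1 s) z) \<partial>lborel)"
        proof (rule nn_integral_mono)
          fix z
          show "ennreal (2 * B z / norm (z - z1)) * indicator (cball z1 s) z \<le> ennreal b * (ennreal (1 / norm (z - z1)) * indicator (cball z1 s) z)
            + ennreal (32 / (s\<^sup>2 * a ^ 3)) * (ennreal ((q z) ^ 4) * indicator (cball z1 s) z)"
          proof (cases "z \<in> cball z1 s \<and> z \<noteq> z1")
            case True
            define d where "d = norm (z - z1)"
            have d: "0 < d" "d \<le> s" using True by (auto simp: d_def dist_norm norm_minus_commute)
            have young: "q z \<le> a + (q z) ^ 4 / a ^ 3"
            proof (cases "q z \<le> a")
              case False
              have "q z * a ^ 3 \<le> q z * q z ^ 3" using False a q0 by (intro mult_left_mono power_mono) auto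
              hence "q z \<le> (q z) ^ 4 / a ^ 3" using a by (simp add: field_simps power4_eq_xxxx power3_eq_cube)
              thus ?thesis using a by simp
            qed (simp add: add_increasing2 a less_imp_le)
            have "2 * B z / d = 6 * A * L ^ 3 / d + 32 / s\<^sup>2 * q z"
              unfolding B_def d_def[symmetric] using d by (simp add: field_simps)
            also have "\<dots> \<le> 6 * A * L ^ 3 / d + 32 / s\<^sup>2 * (a + (q z) ^ 4 / a ^ 3)"
              using young by (intro add_left_mono mult_left_mono) auto
            also have "\<dots> = 6 * A * L ^ 3 / d + 32 * a / (s * s) + 32 / (s\<^sup>2 * a ^ 3) * (q z) ^ 4"
              by (simp add: algebra_simps power2_eq_square)
            also have "32 * a / (s * s) \<le> 32 * a / (s * d)"
              using d s a by (intro divide_left_mono mult_left_mono) auto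
            also have "6 * A * L ^ 3 / d + 32 * a / (s * d) = b * (1 / d)" by (simp add: b_def add_divide_distrib)
            finally have "2 * B z / d \<le> b * (1 / d) + 32 / (s\<^sup>2 * a ^ 3) * (q z) ^ 4" by simp
            hence "ennreal (2 * B z / d) \<le> ennreal b * ennreal (1 / d) + ennreal (32 / (s\<^sup>2 * a ^ 3)) * ennreal ((q z) ^ 4)"
              using b d a s q0 by (simp add: ennreal_mult[symmetric] ennreal_plus[symmetric] ennreal_leI del: ennreal_plus)
            thus ?thesis using True by (simp add: d_def)
          next
            case False thus ?thesis by auto
          qed
        qed
        also have "\<dots> = ennreal b * (\<integral>\<^sup>+z. ennreal (1 / norm (z - z1)) * indicator (cball z1 s) z \<partial>lborel)
            + ennreal (32 / (s\<^sup>2 * a ^ 3)) * (\<integral>\<^sup>+z. ennreal ((q z) ^ 4) * indicator (cball z1 s) z \<partial>lborel)"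
        proof -
          have "cball z1 s \<subseteq> S" using sub z1(2) S(2) by blast
          hence "(\<lambda>z. indicator (cball z1 s) z *\<^sub>R (q z) ^ 4) \<in> borel_measurable borel"
            by (intro borel_measurable_continuous_on_indicator continuous_intros continuous_on_subset[OF cq]) auto
          hence "(\<lambda>z. ennreal (indicator (cball z1 s) z *\<^sub>R (q z) ^ 4)) \<in> borel_measurable borel" by simp
          also have "(\<lambda>z. ennreal (indicator (cball z1 s) z *\<^sub>R (q z) ^ 4)) = (\<lambda>z. ennreal ((q z) ^ 4) * indicator (cball z1 s) z)"
            by (rule ext) (simp add: indicator_def)
          finally have m2: "(\<lambda>z. ennreal ((q z) ^ 4) * indicator (cball z1 s) z) \<in> borel_measurable lborel" by simp
          have m1: "(\<lambda>z. ennreal (1 / norm (z - z1)) * indicator (cball z1 s) z) \<in> borel_measurable lborel"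
            by (intro borel_measurable_times_ennreal borel_measurable_indicator) auto
          show ?thesis
            by (subst nn_integral_add) (use m1 m2 in \<open>auto simp: nn_integral_cmult intro!: borel_measurable_times_ennreal\<close>)
        qed
        also have "\<dots> \<le> ennreal b * ennreal (C1 * s) + ennreal (32 / (s\<^sup>2 * a ^ 3)) * ennreal e"
        proof (intro add_mono mult_left_mono C1)
          have "(\<integral>\<^sup>+z. ennreal ((q z) ^ 4) * indicator (cball z1 s) z \<partial>lborel) \<le> (\<integral>\<^sup>+z. ennreal ((q z) ^ 4) * indicator (cball z0 \<rho>) z \<partial>lborel)"
          proof (intro nn_integral_mono mult_left_mono)
            show "indicator (cball z1 s) z \<le> (indicator (cball z0 \<rho>) z :: ennreal)" for z
              using sub z1(2) by (intro indicator_leI) blast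
          qed simp
          also have "\<dots> \<le> ennreal e" using E by (simp add: q_def)
          finally show "(\<integral>\<^sup>+z. ennreal ((q z) ^ 4) * indicator (cball z1 s) z \<partial>lborel) \<le> ennreal e" .
        qed (use s in auto)
        also have "\<dots> = ennreal (b * (C1 * s) + 32 / (s\<^sup>2 * a ^ 3) * e)"
          using b C1 s a e by (simp add: ennreal_mult[symmetric] ennreal_plus[symmetric] del: ennreal_plus)
        finally have "?c * norm (cut z1 s w z1) \<le> b * (C1 * s) + 32 / (s\<^sup>2 * a ^ 3) * e"
          using b C1 s a e by (subst (asm) ennreal_le_iff) auto
        thus ?thesis using s by (simp add: cut_inside)
      qed
      have "?c * L = ?c * norm (w1 z1) + ?c * norm (w2 z1)" by (simp add: L_def q_def algebra_simps)
      also have "\<dots> \<le> 2 * (b * (C1 * s) + 32 / (s\<^sup>2 * a ^ 3) * e)"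
        using one[OF S(4)] one[OF S(5)] d1 d2 by (simp add: q_def)
      also have "\<dots> = 12 * A * C1 * L * (L\<^sup>2 * s) + 64 * C1 * a + 64 * e / (s\<^sup>2 * a ^ 3)"
        unfolding b_def using s by (simp add: field_simps power2_eq_square power3_eq_cube)
      also have "12 * A * C1 * L * (L\<^sup>2 * s) \<le> 12 * A * C1 * L * m"
        using s L A C1 by (intro mult_left_mono) (auto simp: field_simps)
      also have "12 * A * C1 * L * m = ?c * L / 4" using A C1 by (simp add: m_def)
      also have "64 * C1 * a = ?c * L / 4" using C1 by (simp add: a_def)
      finally have "?c * L / 2 \<le> 64 * e / (s\<^sup>2 * a ^ 3)" by linarith
      hence "?c * L / 2 * (s\<^sup>2 * a ^ 3) \<le> 64 * e" using s a by (simp add: pos_le_divide_eq)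
      moreover have "?c * L / 2 * (s\<^sup>2 * a ^ 3) = 64 / C2 * (L ^ 4 * s\<^sup>2)"
        using c C1 by (simp add: a_def C2_def power_mult_distrib power_divide power3_eq_cube power4_eq_xxxx)
      ultimately have "64 / C2 * (L ^ 4 * s\<^sup>2) \<le> 64 * e" by linarith
      hence "C2 * (64 / C2 * (L ^ 4 * s\<^sup>2)) \<le> C2 * (64 * e)" using C2 by (intro mult_left_mono) auto
      thus ?thesis using C2 by simp
    qed
    show "(norm (w1 z0) + norm (w2 z0)) ^ 4 * \<rho>\<^sup>2 \<le> 4 * C2 * e"
    proof (cases "0 < L \<and> 0 < \<sigma>")
      case True
      \<comment> \<open>Otherwise the estimate at the threshold radius contradicts the smallness of the energy.\<close>
      have "\<sigma> < m / L\<^sup>2"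
      proof (rule ccontr)
        assume "\<not> \<sigma> < m / L\<^sup>2"
        hence "L ^ 4 * (m / L\<^sup>2)\<^sup>2 \<le> C2 * e" using True m by (intro key) auto
        moreover have "L ^ 4 * (m / L\<^sup>2)\<^sup>2 = m\<^sup>2" using True by (simp add: power_divide power2_eq_square power4_eq_xxxx)
        moreover have "C2 * e \<le> C2 * \<eta>" using e C2 by (intro mult_left_mono) auto
        moreover have "C2 * \<eta> = m\<^sup>2 / 2" using C2 by (simp add: \<eta>_def)
        moreover have "0 < m\<^sup>2" using m by simp
        ultimately show False by linarith
      qed
      hence k: "L ^ 4 * \<sigma>\<^sup>2 \<le> C2 * e" using True by (intro key) auto
      have "((q z0)\<^sup>2 * \<rho>)\<^sup>2 \<le> (2 * \<sigma> * L\<^sup>2)\<^sup>2" using z1(3) S(3) by (intro power_mono) (auto simp: L_def)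
      also have "\<dots> = 4 * (L ^ 4 * \<sigma>\<^sup>2)" by (simp add: power2_eq_square power4_eq_xxxx)
      finally show ?thesis using k by (simp add: q_def power2_eq_square power4_eq_xxxx mult_ac)
    next
      case False
      hence "2 * \<sigma> * (q z1)\<^sup>2 = 0" using z1(1) q0[of z1] by (auto simp: L_def)
      hence "(q z0)\<^sup>2 * \<rho> \<le> 0" using z1(3) by linarith
      hence "(q z0)\<^sup>2 = 0" using S(3) by (simp add: mult_le_0_iff)
      hence "q z0 = 0" by simp
      thus ?thesis using C2 e by (simp add: q_def)
    qed
  qed (use C2 \<eta> in auto)
qed

lemma small_of_powr:
  fixes G :: "plane \<Rightarrow> complex"
  assumes "p < 1" "0 < R" "\<And>z. 0 < norm z \<Longrightarrow> norm z < R \<Longrightarrow> norm (G z) \<le> K * norm z powr (-p)" "0 < e"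
  shows "\<exists>d>0. \<forall>z. 0 < norm z \<and> norm z < d \<longrightarrow> norm z * norm (G z) \<le> e"
proof -
  define k where "k = max K 0 + 1"
  have k: "0 < k" "K \<le> k" by (auto simp: k_def)
  define d where "d = min R ((e / k) powr (1 / (1 - p)))"
  have "0 < d" using assms k by (simp add: d_def)
  moreover have "norm z * norm (G z) \<le> e" if z: "0 < norm z" "norm z < d" for z
  proof -
    have "norm (G z) \<le> k * norm z powr (-p)"
    proof -
      have "norm (G z) \<le> K * norm z powr (-p)" using z by (intro assms(3)) (auto simp: d_def)
      also have "\<dots> \<le> k * norm z powr (-p)" using k by (intro mult_right_mono) auto
      finally show ?thesis .
    qed
    hence "norm z * norm (G z) \<le> norm z * (k * norm z powr (-p))" by (rule mult_left_mono) simp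
    also have "\<dots> = k * norm z powr (1 - p)" using z by (simp add: powr_diff powr_minus field_simps)
    also have "\<dots> \<le> k * ((e / k) powr (1 / (1 - p))) powr (1 - p)"
      using z assms k by (intro mult_left_mono powr_mono2) (auto simp: d_def)
    also have "\<dots> = e" using assms k by (simp add: powr_powr)
    finally show ?thesis .
  qed
  ultimately show ?thesis by blast
qed

section \<open>Decay and continuity at an isolated singularity\<close>

lemma cut_C1_punctured:
  assumes "0 < s" "s < R" "C1_on (ball 0 R - {0}) w"
  shows "C1_on (- {0}) (cut 0 s w)"
proof (rule cut_C1[OF assms(1) _ assms(3)])
  show "- {0} \<subseteq> ball 0 R - {0} \<union> {z. 3/4 * s < norm (z - 0)}"
    using assms by (auto simp: not_less)
qed auto

text \<open>The right-hand side is critical: it is bounded by \<open>1/|z|\<close> times the solution.  If \<open>|w|\<close> is bounded by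
  \<open>N |z| powr (-1/4) + M |z| powr (-1/2)\<close>, the representation of \<open>w\<close> gives the same bound with \<open>M / 2\<close> for \<open>M\<close>,
  because \<open>\<eta>\<close> is small against the homogeneous kernel bounds.  Iterating, \<open>M\<close> tends to \<open>0\<close>.\<close>

proposition critical_decay:
  obtains \<eta> where "0 < \<eta>"
    "\<And>w1 w2 R K. \<lbrakk>0 < R; R \<le> 1; C1_on (ball 0 R - {0}) w1; C1_on (ball 0 R - {0}) w2;
       \<And>z. z \<in> ball 0 R - {0} \<Longrightarrow> norm (w1 z) + norm (w2 z) \<le> K * norm z powr (-(1/2));
       \<And>z. z \<in> ball 0 R - {0} \<Longrightarrow> norm (dbar w1 z) \<le> \<eta> / norm z * (norm (w1 z) + norm (w2 z));
       \<And>z. z \<in> ball 0 R - {0} \<Longrightarrow> norm (dbar w2 z) \<le> \<eta> / norm z * (norm (w1 z) + norm (w2 z))\<rbrakk>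
      \<Longrightarrow> \<exists>N R'. 0 < R' \<and> R' \<le> R \<and> (\<forall>z\<in>ball 0 R' - {0}. norm (w1 z) + norm (w2 z) \<le> N * norm z powr (-(1/4)))"
proof -
  obtain Ca where Ca: "0 < Ca" "\<And>a::plane. a \<noteq> 0 \<Longrightarrow>
    (\<integral>\<^sup>+z. ennreal (norm z powr (-(5/4)) / norm (z - a)) \<partial>lborel) \<le> ennreal (Ca * norm a powr (1 - 5/4))"
    using nn_integral_two_singularities[of "5/4"] by auto
  obtain Cb where Cb: "0 < Cb" "\<And>a::plane. a \<noteq> 0 \<Longrightarrow>
    (\<integral>\<^sup>+z. ennreal (norm z powr (-(3/2)) / norm (z - a)) \<partial>lborel) \<le> ennreal (Cb * norm a powr (1 - 3/2))"
    using nn_integral_two_singularities[of "3/2"] by auto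
  define C where "C = max Ca Cb"
  have C: "0 < C" using Ca by (simp add: C_def)
  have Ca': "(\<integral>\<^sup>+z. ennreal (norm z powr (-(5/4)) / norm (z - a)) \<partial>lborel) \<le> ennreal (C * norm a powr (-(1/4)))" if "a \<noteq> 0" for a :: plane
  proof -
    have "(\<integral>\<^sup>+z. ennreal (norm z powr (-(5/4)) / norm (z - a)) \<partial>lborel) \<le> ennreal (Ca * norm a powr (-(1/4)))"
      using Ca(2)[OF that] by simp
    also have "\<dots> \<le> ennreal (C * norm a powr (-(1/4)))" by (intro ennreal_leI mult_right_mono) (auto simp: C_def)
    finally show ?thesis .
  qed
  have Cb': "(\<integral>\<^sup>+z. ennreal (norm z powr (-(3/2)) / norm (z - a)) \<partial>lborel) \<le> ennreal (C * norm a powr (-(1/2)))" if "a \<noteq> 0" for a :: plane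
  proof -
    have "(\<integral>\<^sup>+z. ennreal (norm z powr (-(3/2)) / norm (z - a)) \<partial>lborel) \<le> ennreal (Cb * norm a powr (-(1/2)))"
      using Cb(2)[OF that] by simp
    also have "\<dots> \<le> ennreal (C * norm a powr (-(1/2)))" by (intro ennreal_leI mult_right_mono) (auto simp: C_def)
    finally show ?thesis .
  qed
  let ?c = pompeiu_const
  have c: "0 < ?c" by (rule pompeiu_const_pos)
  define \<eta> where "\<eta> = ?c / (8 * C)"
  have \<eta>: "0 < \<eta>" using c C by (simp add: \<eta>_def)
  show ?thesis
  proof (rule that[OF \<eta>])
    fix w1 w2 R K
    assume R: "0 < R" "R \<le> 1" and w: "C1_on (ball 0 R - {0}) w1" "C1_on (ball 0 R - {0}) w2"
      and bd: "\<And>z. z \<in> ball 0 R - {0} \<Longrightarrow> norm (w1 z) + norm (w2 z) \<le> K * norm z powr (-(1/2))"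
      and d: "\<And>z. z \<in> ball 0 R - {0} \<Longrightarrow> norm (dbar w1 z) \<le> \<eta> / norm z * (norm (w1 z) + norm (w2 z))"
        "\<And>z. z \<in> ball 0 R - {0} \<Longrightarrow> norm (dbar w2 z) \<le> \<eta> / norm z * (norm (w1 z) + norm (w2 z))"
    define q where "q = (\<lambda>z. norm (w1 z) + norm (w2 z))"
    define s where "s = R / 2"
    have s: "0 < s" "s < R" "s \<le> 1" using R by (auto simp: s_def)
    have K: "0 \<le> K"
    proof -
      have "0 \<le> norm (w1 (s, 0)) + norm (w2 (s, 0))" by simp
      also have "\<dots> \<le> K * norm (s, 0::real) powr (-(1/2))" using s by (intro bd) (simp add: norm_first_axis prod_eq_iff)
      finally show ?thesis using s by (simp add: norm_first_axis zero_le_mult_iff)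
    qed
    define L where "L = 64 * C * K / (?c * s\<^sup>2)"
    \<comment> \<open>\<open>L\<close> comes from the cut-off term; the second summand covers the outer annulus \<open>|z| > s / 2\<close>.\<close>
    define N where "N = 2 * L + K * (s/2) powr (-(1/4))"
    have L: "0 \<le> L" using C K c s by (simp add: L_def)
    have N: "0 \<le> N" "2 * L \<le> N" "K * (s/2) powr (-(1/4)) \<le> N" using L K by (auto simp: N_def)
    have step: "q z \<le> N * norm z powr (-(1/4)) + M / 2 * norm z powr (-(1/2))"
      if IH: "\<And>z. z \<in> cball 0 s - {0} \<Longrightarrow> q z \<le> N * norm z powr (-(1/4)) + M * norm z powr (-(1/2))"
        and M: "0 \<le> M" and z: "z \<in> cball 0 s - {0}" for M z
    proof (cases "norm z \<le> s / 2")
      case False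
      have "norm z powr (-(1/2)) = norm z powr (-(1/4)) * norm z powr (-(1/4))" by (simp add: powr_add[symmetric])
      also have "\<dots> \<le> (s/2) powr (-(1/4)) * norm z powr (-(1/4))"
        using False s by (intro mult_right_mono powr_mono2') auto
      finally have "K * norm z powr (-(1/2)) \<le> K * ((s/2) powr (-(1/4)) * norm z powr (-(1/4)))"
        using K by (rule mult_left_mono)
      moreover have "q z \<le> K * norm z powr (-(1/2))" using z s unfolding q_def by (intro bd) auto
      ultimately have "q z \<le> (K * (s/2) powr (-(1/4))) * norm z powr (-(1/4))" by (simp add: mult_ac)
      also have "\<dots> \<le> N * norm z powr (-(1/4))" using N by (intro mult_right_mono) auto
      finally show ?thesis using M by (simp add: add_increasing2)
    next
      case True
      have z0: "z \<noteq> 0" using z by simp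
      define P where "P = \<eta> * N + 16 * K / s\<^sup>2"
      have P: "0 \<le> P" using \<eta> N K by (simp add: P_def)
      have one: "?c * norm (w z) \<le> 2 * P * (C * norm z powr (-(1/4))) + 2 * \<eta> * M * (C * norm z powr (-(1/2)))"
        if w: "C1_on (ball 0 R - {0}) w" and dw: "\<And>z. z \<in> ball 0 R - {0} \<Longrightarrow> norm (dbar w z) \<le> \<eta> / norm z * q z"
          and wq: "\<And>z. norm (w z) \<le> q z" for w
      proof -
        define B where "B = (\<lambda>y::plane. P * norm y powr (-(5/4)) + \<eta> * M * norm y powr (-(3/2)))"
        have "ennreal (?c * norm (cut 0 s w z)) \<le> (\<integral>\<^sup>+y. ennreal (2 * B y / norm (y - z)) * indicator (cball 0 s) y \<partial>lborel)"
        proof (rule pompeiu_bound_punctured[where G = "cut 0 s w" and a = z and B = B])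
          show "C1_on (- {0}) (cut 0 s w)" by (rule cut_C1_punctured[OF s(1,2) w])
          show "\<exists>d>0. \<forall>z. 0 < norm z \<and> norm z < d \<longrightarrow> norm z * norm (cut 0 s w z) \<le> e" if "0 < e" for e
          proof (rule small_of_powr[where p = "1/2" and R = R and K = K])
            fix y :: plane assume "0 < norm y" "norm y < R"
            hence "q y \<le> K * norm y powr (-(1/2))" unfolding q_def by (intro bd) auto
            thus "norm (cut 0 s w y) \<le> K * norm y powr (-(1/2))" using cut_norm[of 0 s w y] wq[of y] by linarith
          qed (use R that in auto)
          show "norm (dbar (cut 0 s w) y) \<le> B y" if y: "y \<in> cball 0 s - {0}" for y
          proof -
            have yR: "y \<in> ball 0 R - {0}" and yn: "0 < norm y" "norm y \<le> 1" using y s by auto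
            have "norm (dbar (cut 0 s w) y) \<le> norm (dbar w y) + 16 * norm (y - 0) / s\<^sup>2 * norm (w y)"
              by (rule cut_dbar[OF s(1) C1_onD(1)[OF w yR]])
            also have "norm (dbar w y) \<le> \<eta> / norm y * (N * norm y powr (-(1/4)) + M * norm y powr (-(1/2)))"
              using dw[OF yR] mult_left_mono[OF IH[OF y], of "\<eta> / norm y"] \<eta> by auto
            also have "\<dots> = \<eta> * N * norm y powr (-(5/4)) + \<eta> * M * norm y powr (-(3/2))"
            proof -
              have "norm y powr (-(5/4)) = norm y powr (-(1/4)) / norm y" "norm y powr (-(3/2)) = norm y powr (-(1/2)) / norm y"
                using yn powr_diff[of "norm y" "-(1/4)" 1] powr_diff[of "norm y" "-(1/2)" 1] by auto
              thus ?thesis by (simp add: add_divide_distrib algebra_simps)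
            qed
            also have "16 * norm (y - 0) / s\<^sup>2 * norm (w y) \<le> 16 / s\<^sup>2 * (K * norm y powr (-(5/4)))"
            proof -
              have "norm (w y) \<le> K * norm y powr (-(1/2))" using wq[of y] bd[OF yR] by (simp add: q_def)
              hence "norm y * norm (w y) \<le> 1 * (K * norm y powr (-(5/4)))"
              proof (intro mult_mono)
                assume "norm (w y) \<le> K * norm y powr (-(1/2))"
                also have "\<dots> \<le> K * norm y powr (-(5/4))" using yn K by (intro mult_left_mono powr_mono') auto
                finally show "norm (w y) \<le> K * norm y powr (-(5/4))" .
              qed (use yn in auto)
              hence "16 / s\<^sup>2 * (norm y * norm (w y)) \<le> 16 / s\<^sup>2 * (K * norm y powr (-(5/4)))"
                by (intro mult_left_mono) auto
              thus ?thesis by simp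
            qed
            finally show ?thesis by (simp add: B_def P_def algebra_simps)
          qed
        qed (use z s cut_outside[of s _ 0] in \<open>auto simp: B_def\<close>)
        also have "\<dots> \<le> (\<integral>\<^sup>+y. ennreal (2 * P) * ennreal (norm y powr (-(5/4)) / norm (y - z)) +
             ennreal (2 * \<eta> * M) * ennreal (norm y powr (-(3/2)) / norm (y - z)) \<partial>lborel)"
        proof (rule nn_integral_mono)
          fix y :: plane
          have "2 * B y / norm (y - z) = 2 * P * (norm y powr (-(5/4)) / norm (y - z)) + 2 * \<eta> * M * (norm y powr (-(3/2)) / norm (y - z))"
            by (simp add: B_def add_divide_distrib algebra_simps)
          hence "ennreal (2 * B y / norm (y - z)) = ennreal (2 * P) * ennreal (norm y powr (-(5/4)) / norm (y - z)) +
             ennreal (2 * \<eta> * M) * ennreal (norm y powr (-(3/2)) / norm (y - z))"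
            using P \<eta> M by (simp only: ennreal_mult[symmetric] ennreal_plus[symmetric] mult_nonneg_nonneg divide_nonneg_nonneg norm_ge_zero powr_ge_zero less_imp_le zero_le_numeral)
          thus "ennreal (2 * B y / norm (y - z)) * indicator (cball 0 s) y \<le> ennreal (2 * P) * ennreal (norm y powr (-(5/4)) / norm (y - z)) +
             ennreal (2 * \<eta> * M) * ennreal (norm y powr (-(3/2)) / norm (y - z))"
            by (simp add: indicator_def)
        qed
        also have "\<dots> = ennreal (2 * P) * (\<integral>\<^sup>+y. ennreal (norm y powr (-(5/4)) / norm (y - z)) \<partial>lborel) +
             ennreal (2 * \<eta> * M) * (\<integral>\<^sup>+y. ennreal (norm y powr (-(3/2)) / norm (y - z)) \<partial>lborel)"
          by (simp add: nn_integral_add nn_integral_cmult)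
        also have "\<dots> \<le> ennreal (2 * P) * ennreal (C * norm z powr (-(1/4))) + ennreal (2 * \<eta> * M) * ennreal (C * norm z powr (-(1/2)))"
          by (intro add_mono mult_left_mono Ca' Cb' z0) auto
        also have "\<dots> = ennreal (2 * P * (C * norm z powr (-(1/4))) + 2 * \<eta> * M * (C * norm z powr (-(1/2))))"
          using P \<eta> M C by (simp add: ennreal_mult[symmetric] ennreal_plus[symmetric] del: ennreal_plus)
        finally have "?c * norm (cut 0 s w z) \<le> 2 * P * (C * norm z powr (-(1/4))) + 2 * \<eta> * M * (C * norm z powr (-(1/2)))"
          using P \<eta> M C by (subst (asm) ennreal_le_iff) auto
        thus ?thesis using s True by (simp add: cut_inside)
      qed
      have "?c * q z = ?c * norm (w1 z) + ?c * norm (w2 z)" by (simp add: q_def algebra_simps)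
      also have "\<dots> \<le> 2 * (2 * P * (C * norm z powr (-(1/4))) + 2 * \<eta> * M * (C * norm z powr (-(1/2))))"
        using one[OF w(1)] one[OF w(2)] d by (simp add: q_def)
      also have "\<dots> = ?c * ((4 * C * P / ?c) * norm z powr (-(1/4)) + M / 2 * norm z powr (-(1/2)))"
        using c C by (simp add: \<eta>_def field_simps)
      finally have "q z \<le> (4 * C * P / ?c) * norm z powr (-(1/4)) + M / 2 * norm z powr (-(1/2))"
        using c by simp
      also have "4 * C * P / ?c = N / 2 + L" using c C s by (simp add: P_def \<eta>_def L_def field_simps)
      also have "(N / 2 + L) * norm z powr (-(1/4)) \<le> N * norm z powr (-(1/4))" using N by (intro mult_right_mono) auto
      finally show ?thesis by simp
    qed
    have iter: "\<forall>z\<in>cball 0 s - {0}. q z \<le> N * norm z powr (-(1/4)) + K / 2 ^ n * norm z powr (-(1/2))" for n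
    proof (induction n)
      case 0
      show ?case using bd s N by (fastforce simp: q_def intro: add_increasing)
    next
      case (Suc n)
      show ?case using step[of "K / 2 ^ n"] Suc K by (simp add: mult.commute)
    qed
    have "q z \<le> N * norm z powr (-(1/4))" if "z \<in> ball 0 s - {0}" for z
    proof -
      have "(\<lambda>n. N * norm z powr (-(1/4)) + K / 2 ^ n * norm z powr (-(1/2))) \<longlonglongrightarrow> N * norm z powr (-(1/4)) + 0 * norm z powr (-(1/2))"
        by (intro tendsto_intros LIMSEQ_divide_realpow_zero) auto
      moreover have "q z \<le> N * norm z powr (-(1/4)) + K / 2 ^ n * norm z powr (-(1/2))" for n
        using iter that by auto
      ultimately show ?thesis by (intro LIMSEQ_le_const) auto
    qed
    thus "\<exists>N R'. 0 < R' \<and> R' \<le> R \<and> (\<forall>z\<in>ball 0 R' - {0}. norm (w1 z) + norm (w2 z) \<le> N * norm z powr (-(1/4)))"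
      using s by (intro exI[of _ N] exI[of _ s]) (auto simp: q_def)
  qed
qed

text \<open>A removable singularity theorem: no smallness is needed once the right-hand side is a power above \<open>-1\<close>.\<close>

proposition holder_punctured:
  assumes R: "0 < R" "R \<le> 1" and p: "0 \<le> p" "0 < \<alpha>" "p + \<alpha> < 1"
    and g: "C1_on (ball 0 R - {0}) g"
    and bd: "\<And>z. z \<in> ball 0 R - {0} \<Longrightarrow> norm (g z) \<le> K * norm z powr (-p)"
    and db: "\<And>z. z \<in> ball 0 R - {0} \<Longrightarrow> norm (dbar g z) \<le> K * norm z powr (-p)"
  obtains C where "0 \<le> C" "\<And>a b. a \<in> ball 0 (R/4) - {0} \<Longrightarrow> b \<in> ball 0 (R/4) - {0} \<Longrightarrow> norm (g a - g b) \<le> C * norm (a - b) powr \<alpha>"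
proof -
  obtain D where D: "0 < D" "\<And>a b::plane. a \<in> cball 0 1 \<Longrightarrow> b \<in> cball 0 1 \<Longrightarrow> a \<noteq> b \<Longrightarrow>
    (\<integral>\<^sup>+z. ennreal (norm z powr (-p) * (norm (a - b) / (norm (z - a) * norm (z - b)))) * indicator (cball 0 1) z \<partial>lborel)
      \<le> ennreal (D * norm (a - b) powr \<alpha>)"
    using nn_integral_three_singularities[OF p] by blast
  let ?c = pompeiu_const
  have c: "0 < ?c" by (rule pompeiu_const_pos)
  define s where "s = R / 2"
  have s: "0 < s" "s < R" "s \<le> 1" using R by (auto simp: s_def)
  define P where "P = max K 0 * (1 + 16 / s\<^sup>2)"
  have P: "0 \<le> P" by (simp add: P_def)
  define B where "B = (\<lambda>z::plane. P * norm z powr (-p) * indicator (cball 0 1) z)"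
  show ?thesis
  proof (rule that[of "P * D / ?c"])
    show "0 \<le> P * D / ?c" using P D c by simp
    fix a b :: plane assume a: "a \<in> ball 0 (R/4) - {0}" and b: "b \<in> ball 0 (R/4) - {0}"
    show "norm (g a - g b) \<le> P * D / ?c * norm (a - b) powr \<alpha>"
    proof (cases "a = b")
      case False
      have "ennreal (?c * norm (cut 0 s g a - cut 0 s g b))
        \<le> (\<integral>\<^sup>+z. ennreal (B z * (norm (a - b) / (norm (z - a) * norm (z - b)))) \<partial>lborel)"
      proof (rule pompeiu_difference_punctured[where G = "cut 0 s g" and a = a and b = b and B = B and M = s])
        show "C1_on (- {0}) (cut 0 s g)" by (rule cut_C1_punctured[OF s(1,2) g])
        show supp: "cut 0 s g z = 0" if "s < norm z" for z using cut_outside[of s z 0 g] s that by simp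
        show "\<exists>d>0. \<forall>z. 0 < norm z \<and> norm z < d \<longrightarrow> norm z * norm (cut 0 s g z) \<le> e" if "0 < e" for e
        proof (rule small_of_powr[where p = p and R = R and K = K])
          fix y :: plane assume "0 < norm y" "norm y < R"
          hence "norm (g y) \<le> K * norm y powr (-p)" by (intro bd) auto
          thus "norm (cut 0 s g y) \<le> K * norm y powr (-p)" using cut_norm[of 0 s g y] by linarith
        qed (use R p that in auto)
        show "norm (dbar (cut 0 s g) y) \<le> B y" if y: "y \<noteq> 0" for y
        proof (cases "norm y \<le> s")
          case True
          have yR: "y \<in> ball 0 R - {0}" and yn: "0 < norm y" "norm y \<le> 1" using True y s by auto
          have k: "K * norm y powr (-p) \<le> max K 0 * norm y powr (-p)" by (intro mult_right_mono) auto
          have "norm (dbar (cut 0 s g) y) \<le> norm (dbar g y) + 16 * norm (y - 0) / s\<^sup>2 * norm (g y)"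
            by (rule cut_dbar[OF s(1) C1_onD(1)[OF g yR]])
          also have "\<dots> \<le> max K 0 * norm y powr (-p) + 16 * 1 / s\<^sup>2 * (max K 0 * norm y powr (-p))"
            using yn order_trans[OF bd[OF yR] k] order_trans[OF db[OF yR] k]
            by (intro add_mono mult_mono divide_right_mono) auto
          also have "\<dots> = B y" using yn by (simp add: B_def P_def algebra_simps)
          finally show ?thesis .
        next
          case False
          hence "dbar (cut 0 s g) y = 0" by (intro vanish_outside(2)[OF supp]) auto
          thus ?thesis using P by (simp add: B_def)
        qed
      qed (use a b in auto)
      also have "\<dots> = (\<integral>\<^sup>+z. ennreal P * (ennreal (norm z powr (-p) * (norm (a - b) / (norm (z - a) * norm (z - b)))) * indicator (cball 0 1) z) \<partial>lborel)"
        using P by (intro nn_integral_cong) (simp add: B_def indicator_def ennreal_mult[symmetric] mult.assoc)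
      also have "\<dots> = ennreal P * (\<integral>\<^sup>+z. (ennreal (norm z powr (-p) * (norm (a - b) / (norm (z - a) * norm (z - b)))) * indicator (cball 0 1) z) \<partial>lborel)"
        by (intro nn_integral_cmult borel_measurable_times_ennreal borel_measurable_indicator) auto
      also have "\<dots> \<le> ennreal P * ennreal (D * norm (a - b) powr \<alpha>)"
        using a b R False by (intro mult_left_mono D) auto
      also have "\<dots> = ennreal (P * (D * norm (a - b) powr \<alpha>))" using P D by (simp add: ennreal_mult[symmetric])
      finally have "?c * norm (cut 0 s g a - cut 0 s g b) \<le> P * (D * norm (a - b) powr \<alpha>)"
        using P D by (subst (asm) ennreal_le_iff) auto
      moreover have "cut 0 s g a = g a" "cut 0 s g b = g b" using a b s by (auto simp: cut_inside s_def)
      ultimately show ?thesis using c by (simp add: field_simps)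
    qed simp
  qed
qed

section \<open>An interior gradient estimate\<close>

lemma derivative_norm_le:
  fixes f :: "plane \<Rightarrow> complex"
  assumes f: "(f has_derivative D) (at p)" and r: "0 < r" and B: "\<And>h. norm h < r \<Longrightarrow> norm (f (p + h) - f p) \<le> B * norm h"
  shows "norm (D v) \<le> B * norm v"
proof (cases "v = 0")
  case True
  thus ?thesis using linear_0[OF has_derivative_linear[OF f]] by simp
next
  case False
  show ?thesis
  proof (rule field_le_epsilon)
    fix e :: real assume "0 < e"
    define e' where "e' = e / norm v"
    have e': "0 < e'" using \<open>0 < e\<close> False by (simp add: e'_def)
    obtain d where d: "0 < d" "\<And>y. norm (y - p) < d \<Longrightarrow> norm (f y - f p - D (y - p)) \<le> e' * norm (y - p)"
      using f e' unfolding has_derivative_at_alt by blast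
    define t where "t = min d r / (2 * norm v)"
    have t: "0 < t" using d r False by (simp add: t_def)
    have "norm (t *\<^sub>R v) = min d r / 2" using d r False by (simp add: t_def)
    hence n: "norm (t *\<^sub>R v) < d" "norm (t *\<^sub>R v) < r" using d r by linarith+
    have "t * norm (D v) = norm (D (t *\<^sub>R v))"
      using t has_derivative_linear[OF f] by (simp add: linear_scale)
    also have "\<dots> \<le> norm (f (p + t *\<^sub>R v) - f p) + norm (f (p + t *\<^sub>R v) - f p - D (t *\<^sub>R v))"
      using norm_triangle_ineq4[of "f (p + t *\<^sub>R v) - f p" "f (p + t *\<^sub>R v) - f p - D (t *\<^sub>R v)"] by simp
    also have "\<dots> \<le> B * norm (t *\<^sub>R v) + e' * norm (t *\<^sub>R v)"
      using d(2)[of "p + t *\<^sub>R v"] n by (intro add_mono B) simp_all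
    also have "\<dots> = t * (B * norm v + e)" using t False by (simp add: e'_def algebra_simps)
    finally show "norm (D v) \<le> B * norm v + e" using t by simp
  qed
qed

text \<open>The gradient at \<open>p\<close> is bounded by the oscillation \<open>M\<close> of \<open>g\<close> on a disk of radius \<open>s\<close>, the value of \<open>dbar g\<close> at
  \<open>p\<close> and the Lipschitz constant \<open>L\<close> of \<open>dbar g\<close>.\<close>

proposition gradient_estimate:
  obtains C where "0 < C"
    "\<And>S g p s L M v. \<lbrakk>open S; cball p s \<subseteq> S; 0 < s; C1_on S g; 0 \<le> L; 0 \<le> M;
       \<And>z. z \<in> cball p s \<Longrightarrow> norm (dbar g z - dbar g p) \<le> L * norm (z - p);
       \<And>z. z \<in> cball p s \<Longrightarrow> norm (g z - g p) \<le> M\<rbrakk>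
      \<Longrightarrow> norm (dd v g p) \<le> C * (M / s + norm (dbar g p) + L * s) * norm v"
proof -
  obtain C1 where C1: "0 < C1" "\<And>(a::plane) b r. 0 \<le> r \<Longrightarrow> b \<in> cball a r \<Longrightarrow>
    (\<integral>\<^sup>+z. ennreal (1 / norm (z - b)) * indicator (cball a r) z \<partial>lborel) \<le> ennreal (C1 * r)"
    using nn_integral_cball_norm by blast
  let ?c = pompeiu_const
  have c: "0 < ?c" by (rule pompeiu_const_pos)
  define C where "C = 16 * C1 / ?c + 1"
  have C: "0 < C" using C1 c by (simp add: C_def add_pos_pos)
  show ?thesis
  proof (rule that[OF C])
    fix S g p s L M and v :: plane
    assume S: "open S" "cball p s \<subseteq> S" "0 < s" "C1_on S g" "0 \<le> L" "0 \<le> M"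
      and Lip: "\<And>z. z \<in> cball p s \<Longrightarrow> norm (dbar g z - dbar g p) \<le> L * norm (z - p)"
      and osc: "\<And>z. z \<in> cball p s \<Longrightarrow> norm (g z - g p) \<le> M"
    define F where "F = dbar g p"
    \<comment> \<open>After subtracting the value and \<open>dbar g p * cnj (z - p)\<close>, both the function and its \<open>dbar\<close> vanish at \<open>p\<close>; this cancels one factor \<open>1 / |z - p|\<close> of the kernel.\<close>
    define k where "k = (\<lambda>z. - g p + (- F) * cnj (to_complex (z - p)))"
    define f where "f = (\<lambda>z. g z + k z)"
    have pS: "p \<in> S" using S by auto
    have bl: "bounded_linear (\<lambda>v. (- F) * cnj (to_complex v))"
      using bounded_linear_compose[OF bounded_linear_mult_right bounded_linear_compose[OF bounded_linear_cnj bounded_linear_to_complex]] .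
    have kd: "(k has_derivative (\<lambda>v. (- F) * cnj (to_complex v))) (at z)" for z
    proof -
      have "((\<lambda>z. z - p) has_derivative (\<lambda>v. v)) (at z)" by (auto intro!: derivative_eq_intros)
      from bounded_linear.has_derivative[OF bl this]
      have "((\<lambda>z. - g p + (- F) * cnj (to_complex (z - p))) has_derivative (\<lambda>v. 0 + (- F) * cnj (to_complex v))) (at z)"
        by (intro has_derivative_add has_derivative_const)
      thus ?thesis unfolding k_def by (simp only: add_0)
    qed
    have kdd: "dd v k z = (- F) * cnj (to_complex v)" for v z by (rule dd_eqI[OF kd])
    have kC1: "C1_on S k" unfolding Ck_on_Suc higher_differentiable_on.simps(1)
      using kd by (auto simp: differentiable_def kdd[abs_def])
    have fC1: "C1_on S f" unfolding f_def by (rule Ck_on_add[OF S(1,4) kC1])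
    have gd: "g differentiable (at z)" if "z \<in> S" for z using C1_onD(1)[OF S(4) that] .
    have fdbar: "dbar f z = dbar g z - F" if "z \<in> S" for z
    proof -
      have "dbar k z = - F" by (simp add: dbar_def kdd to_complex_def complex_eq_iff)
      thus ?thesis unfolding f_def using dbar_add[OF gd[OF that] C1_onD(1)[OF kC1 that]] by simp
    qed
    have fp: "f p = 0" by (simp add: f_def k_def to_complex_simps)
    have fb: "norm (f z) \<le> M + norm F * s" if z: "z \<in> cball p s" for z
    proof -
      have "f z = (g z - g p) - F * cnj (to_complex (z - p))" by (simp add: f_def k_def)
      also have "norm \<dots> \<le> norm (g z - g p) + norm (F * cnj (to_complex (z - p)))" by (rule norm_triangle_ineq4)
      also have "norm (F * cnj (to_complex (z - p))) = norm F * norm (z - p)" by (simp only: norm_mult complex_mod_cnj to_complex_simps(3))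
      also have "norm (g z - g p) + norm F * norm (z - p) \<le> M + norm F * s"
        using osc[OF z] z by (intro add_mono mult_left_mono) (auto simp: dist_norm norm_minus_commute)
      finally show ?thesis .
    qed
    define N where "N = L + 16 * (M + norm F * s) / s\<^sup>2"
    have N: "0 \<le> N" using S by (simp add: N_def)
    have uC1: "C1_on UNIV (cut p s f)"
    proof (rule cut_C1[OF S(3,1) fC1])
      show "UNIV \<subseteq> S \<union> {z. 3/4 * s < norm (z - p)}"
      proof
        fix z
        have "z \<in> S" if "norm (z - p) \<le> 3/4 * s"
          using that S(3) by (intro subsetD[OF S(2)]) (simp add: dist_norm norm_minus_commute)
        thus "z \<in> S \<union> {z. 3/4 * s < norm (z - p)}" by (auto simp: not_less)
      qed
    qed
    have ud: "norm (dbar (cut p s f) z) \<le> N * norm (z - p) * indicator (cball p s) z" for z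
    proof (cases "z \<in> cball p s")
      case True
      hence zS: "z \<in> S" using S by auto
      have "norm (dbar (cut p s f) z) \<le> norm (dbar f z) + 16 * norm (z - p) / s\<^sup>2 * norm (f z)"
        by (rule cut_dbar[OF S(3) C1_onD(1)[OF fC1 zS]])
      also have "\<dots> \<le> L * norm (z - p) + 16 * norm (z - p) / s\<^sup>2 * (M + norm F * s)"
        using Lip[OF True] fb[OF True] by (intro add_mono mult_left_mono) (auto simp: fdbar[OF zS] F_def)
      also have "\<dots> = N * norm (z - p)" by (simp add: N_def algebra_simps)
      finally show ?thesis using True by simp
    next
      case False
      have "dbar (cut p s f) z = dbar (\<lambda>z. 0) z"
        by (rule dbar_cong[of "- cball p s"]) (use False S cut_outside in \<open>auto simp: dist_norm norm_minus_commute\<close>)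
      thus ?thesis using N by (simp add: dbar_def dd_def)
    qed
    have lip: "norm (f (p + h) - f p) \<le> N * C1 * s / ?c * norm h" if h: "norm h < s / 2" for h
    proof (cases "h = 0")
      case False
      have "ennreal (?c * norm (cut p s f (p + h) - cut p s f p))
         \<le> (\<integral>\<^sup>+z. ennreal (norm (dbar (cut p s f) z) * (norm ((p + h) - p) / (norm (z - (p + h)) * norm (z - p)))) \<partial>lborel)"
      proof (rule pompeiu_difference[OF uC1, where M = "norm p + s"])
        show "cut p s f z = 0" if "norm p + s < norm z" for z
          using norm_triangle_sub[of z p] that by (intro cut_outside S) linarith
      qed
      also have "\<dots> \<le> (\<integral>\<^sup>+z. ennreal (N * norm h) * (ennreal (1 / norm (z - (p + h))) * indicator (cball p s) z) \<partial>lborel)"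
      proof (rule nn_integral_mono)
        fix z
        show "ennreal (norm (dbar (cut p s f) z) * (norm ((p + h) - p) / (norm (z - (p + h)) * norm (z - p))))
           \<le> ennreal (N * norm h) * (ennreal (1 / norm (z - (p + h))) * indicator (cball p s) z)"
        proof (cases "z \<in> cball p s \<and> z \<noteq> p")
          case True
          have "norm (dbar (cut p s f) z) * (norm ((p + h) - p) / (norm (z - (p + h)) * norm (z - p)))
             \<le> N * norm (z - p) * (norm h / (norm (z - (p + h)) * norm (z - p)))"
            using ud[of z] True by (simp del: times_divide_eq_right add: mult_right_mono)
          also have "\<dots> = N * norm h * (1 / norm (z - (p + h)))" using True by simp
          finally show ?thesis using True N by (simp add: ennreal_mult[symmetric] ennreal_leI)
        next
          case False
          thus ?thesis using ud[of z] by auto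
        qed
      qed
      also have "\<dots> = ennreal (N * norm h) * (\<integral>\<^sup>+z. (ennreal (1 / norm (z - (p + h))) * indicator (cball p s) z) \<partial>lborel)"
        by (intro nn_integral_cmult borel_measurable_times_ennreal borel_measurable_indicator) auto
      also have "\<dots> \<le> ennreal (N * norm h) * ennreal (C1 * s)"
        using h S by (intro mult_left_mono C1) (auto simp: dist_norm)
      also have "\<dots> = ennreal (N * norm h * (C1 * s))" using N C1 S by (simp add: ennreal_mult[symmetric])
      finally have "?c * norm (cut p s f (p + h) - cut p s f p) \<le> N * norm h * (C1 * s)"
        using N C1 S by (subst (asm) ennreal_le_iff) auto
      moreover have "cut p s f (p + h) = f (p + h)" "cut p s f p = f p" using S h by (auto intro!: cut_inside)
      ultimately show ?thesis using c by (simp add: field_simps)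
    qed simp
    have "norm (dd v f p) \<le> N * C1 * s / ?c * norm v"
      by (rule derivative_norm_le[OF dd_works[OF C1_onD(1)[OF fC1 pS]], where r = "s / 2", OF _ lip]) (use S in auto)
    moreover have "dd v g p = dd v f p + F * cnj (to_complex v)"
      unfolding f_def using dd_add[OF gd[OF pS] C1_onD(1)[OF kC1 pS]] kdd by simp
    moreover have "norm (dd v f p + F * cnj (to_complex v)) \<le> norm (dd v f p) + norm F * norm v"
      by (rule order_trans[OF norm_triangle_ineq]) (simp add: norm_mult to_complex_simps(3))
    ultimately have "norm (dd v g p) \<le> (N * C1 * s / ?c + norm F) * norm v" by (simp add: algebra_simps)
    also have "N * C1 * s / ?c + norm F = C1 / ?c * (L * s) + 16 * C1 / ?c * (M / s) + (16 * C1 / ?c + 1) * norm F"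
      using S c by (simp add: N_def field_simps power2_eq_square)
    also have "\<dots> \<le> C * (L * s) + C * (M / s) + C * norm F"
      using C1 c S by (intro add_mono mult_right_mono) (auto simp: C_def field_simps)
    also have "\<dots> = C * (M / s + norm (dbar g p) + L * s)" by (simp add: F_def algebra_simps)
    finally show "norm (dd v g p) \<le> C * (M / s + norm (dbar g p) + L * s) * norm v"
      by (simp add: mult_right_mono)
  qed
qed

section \<open>Commuting partial derivatives\<close>

lemma line_derivative:
  assumes "f differentiable (at (p + s *\<^sub>R u))"
  shows "((\<lambda>s. f (p + s *\<^sub>R u)) has_vector_derivative dd u f (p + s *\<^sub>R u)) (at s)"
proof -
  have 1: "((\<lambda>s. p + s *\<^sub>R u) has_derivative (\<lambda>h. h *\<^sub>R u)) (at s)" by (auto intro!: derivative_eq_intros)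
  have d: "(f has_derivative (\<lambda>v. dd v f (p + s *\<^sub>R u))) (at (p + s *\<^sub>R u))" by (rule dd_works[OF assms])
  from has_derivative_compose[OF 1 d] have "((\<lambda>s. f (p + s *\<^sub>R u)) has_derivative (\<lambda>h. dd (h *\<^sub>R u) f (p + s *\<^sub>R u))) (at s)" .
  moreover have "dd (h *\<^sub>R u) f (p + s *\<^sub>R u) = h *\<^sub>R dd u f (p + s *\<^sub>R u)" for h
    using has_derivative_linear[OF d] by (rule linear_scale)
  ultimately show ?thesis by (simp add: has_vector_derivative_def)
qed

lemma interval_mean_value:
  fixes \<phi> :: "real \<Rightarrow> 'a::real_normed_vector"
  assumes "0 \<le> t" "\<And>s. 0 \<le> s \<Longrightarrow> s \<le> t \<Longrightarrow> (\<phi> has_vector_derivative \<phi>' s) (at s)"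
    "\<And>s. 0 \<le> s \<Longrightarrow> s \<le> t \<Longrightarrow> norm (\<phi>' s) \<le> b"
  shows "norm (\<phi> t - \<phi> 0) \<le> b * t"
proof -
  have "norm (\<phi> t - \<phi> 0) \<le> b * norm (t - 0)"
  proof (rule differentiable_bound[of "{0..t}" \<phi> "\<lambda>s h. h *\<^sub>R \<phi>' s"])
    fix s assume s: "s \<in> {0..t}"
    show "(\<phi> has_derivative (\<lambda>h. h *\<^sub>R \<phi>' s)) (at s within {0..t})"
      using assms(2)[of s] s by (auto simp: has_vector_derivative_def intro: has_derivative_at_withinI)
    show "onorm (\<lambda>h. h *\<^sub>R \<phi>' s) \<le> b"
    proof (rule onorm_le)
      fix h :: real
      show "norm (h *\<^sub>R \<phi>' s) \<le> b * norm h"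
        using mult_right_mono[OF assms(3)[of s], of "norm h"] s by (simp add: mult.commute)
    qed
  qed (use assms in auto)
  thus ?thesis using assms(1) by simp
qed

text \<open>The symmetric second difference approximates either mixed second derivative.\<close>

lemma second_difference:
  fixes f :: "plane \<Rightarrow> 'a::real_normed_vector"
  assumes S: "open S" "p \<in> S" and f: "Ck_on (Suc (Suc 0)) S f" and e: "0 < e"
  shows "\<forall>\<^sub>F t in at_right 0. norm (f (p + t *\<^sub>R u + t *\<^sub>R v) - f (p + t *\<^sub>R u) - f (p + t *\<^sub>R v) + f p
     - (t * t) *\<^sub>R dd v (dd u f) p) \<le> e * (t * t)"
proof -
  let ?A = "dd v (dd u f) p"
  have d1: "f differentiable (at z)" if "z \<in> S" for z using f that by (auto simp: Ck_on_Suc)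
  have C1: "C1_on S (dd u f)" using f unfolding Ck_on_Suc[of "Suc 0"] by blast
  have "isCont (dd v (dd u f)) p"
    using C1_onD(2)[OF C1, of v] S by (simp add: continuous_on_eq_continuous_at)
  then obtain d1' where d1': "0 < d1'" "\<And>z. dist z p < d1' \<Longrightarrow> norm (dd v (dd u f) z - ?A) < e"
    using e unfolding continuous_at_eps_delta by (metis dist_norm)
  obtain d2 where d2: "0 < d2" "ball p d2 \<subseteq> S" using S open_contains_ball by blast
  define d where "d = min d1' d2"
  have d: "0 < d" "\<And>z. norm (z - p) < d \<Longrightarrow> norm (dd v (dd u f) z - ?A) \<le> e" "\<And>z. norm (z - p) < d \<Longrightarrow> z \<in> S"
    using d1' d2 by (force simp: d_def dist_norm norm_minus_commute)+
  have near: "norm ((p + s *\<^sub>R u + r *\<^sub>R v) - p) < d" if "0 \<le> s" "s \<le> t" "0 \<le> r" "r \<le> t" "t * (norm u + norm v + 1) < d" for s r t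
  proof -
    have "norm ((p + s *\<^sub>R u + r *\<^sub>R v) - p) \<le> s * norm u + r * norm v"
      using norm_triangle_ineq[of "s *\<^sub>R u" "r *\<^sub>R v"] that by (simp add: add.assoc)
    also have "\<dots> \<le> t * norm u + t * norm v" using that by (intro add_mono mult_right_mono) auto
    finally show ?thesis using that by (simp add: algebra_simps)
  qed
  have "norm (f (p + t *\<^sub>R u + t *\<^sub>R v) - f (p + t *\<^sub>R u) - f (p + t *\<^sub>R v) + f p - (t * t) *\<^sub>R ?A) \<le> e * (t * t)"
    if t: "0 < t" "t * (norm u + norm v + 1) < d" for t
  proof -
    define \<phi> where "\<phi> = (\<lambda>s. f ((p + t *\<^sub>R v) + s *\<^sub>R u) - f (p + s *\<^sub>R u) - s *\<^sub>R (t *\<^sub>R ?A))"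
    define \<phi>' where "\<phi>' = (\<lambda>s. dd u f ((p + t *\<^sub>R v) + s *\<^sub>R u) - dd u f (p + s *\<^sub>R u) - t *\<^sub>R ?A)"
    have "norm (\<phi> t - \<phi> 0) \<le> (e * t) * t"
    proof (rule interval_mean_value)
      fix s assume s: "0 \<le> s" "s \<le> t"
      have "(p + t *\<^sub>R v) + s *\<^sub>R u \<in> S" "p + s *\<^sub>R u \<in> S"
        using d(3)[OF near[of s t t]] d(3)[OF near[of s t 0]] s t by (simp_all add: add_ac)
      thus "(\<phi> has_vector_derivative \<phi>' s) (at s)" unfolding \<phi>_def \<phi>'_def
        by (intro has_vector_derivative_diff line_derivative d1) (auto intro!: derivative_eq_intros)
      define g where "g = (\<lambda>r. dd u f ((p + s *\<^sub>R u) + r *\<^sub>R v) - r *\<^sub>R ?A)"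
      have "norm (g t - g 0) \<le> e * t"
      proof (rule interval_mean_value)
        fix r assume r: "0 \<le> r" "r \<le> t"
        have n: "norm ((p + s *\<^sub>R u + r *\<^sub>R v) - p) < d" using s r t by (intro near) auto
        show "(g has_vector_derivative (dd v (dd u f) ((p + s *\<^sub>R u) + r *\<^sub>R v) - ?A)) (at r)"
          unfolding g_def
          by (intro has_vector_derivative_diff line_derivative C1_onD(1)[OF C1] d(3) n) (auto intro!: derivative_eq_intros)
        show "norm (dd v (dd u f) ((p + s *\<^sub>R u) + r *\<^sub>R v) - ?A) \<le> e" by (rule d(2)[OF n])
      qed (use t in auto)
      moreover have "g t - g 0 = \<phi>' s" by (simp add: g_def \<phi>'_def add_ac)
      ultimately show "norm (\<phi>' s) \<le> e * t" by simp
    qed (use t in auto)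
    moreover have "\<phi> t - \<phi> 0 = f (p + t *\<^sub>R u + t *\<^sub>R v) - f (p + t *\<^sub>R u) - f (p + t *\<^sub>R v) + f p - (t * t) *\<^sub>R ?A"
      by (simp add: \<phi>_def add_ac)
    ultimately show ?thesis by (simp add: mult.assoc)
  qed
  moreover have "\<forall>\<^sub>F t in at_right (0::real). 0 < t \<and> t * (norm u + norm v + 1) < d"
  proof -
    have n: "0 < norm u + norm v + 1" by (simp add: add_nonneg_pos)
    have "0 < d / (norm u + norm v + 1)" using d n by simp
    hence "\<forall>\<^sub>F t in at_right (0::real). t \<in> {0<..<d / (norm u + norm v + 1)}" by (rule eventually_at_right_real)
    thus ?thesis by eventually_elim (use n in \<open>simp add: pos_less_divide_eq\<close>)
  qed
  ultimately show ?thesis by (auto elim: eventually_mono)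
qed

lemma dd_commute:
  fixes f :: "plane \<Rightarrow> 'a::real_normed_vector"
  assumes S: "open S" "p \<in> S" and f: "Ck_on (Suc (Suc 0)) S f"
  shows "dd u (dd v f) p = dd v (dd u f) p"
proof -
  have "norm (dd v (dd u f) p - dd u (dd v f) p) \<le> 0"
  proof (rule field_le_epsilon)
    fix e :: real assume e: "0 < e"
    have "\<forall>\<^sub>F t in at_right (0::real). 0 < t" by (simp add: eventually_at_right_less)
    with second_difference[OF S f half_gt_zero[OF e], of u v] second_difference[OF S f half_gt_zero[OF e], of v u]
    have "\<forall>\<^sub>F t in at_right (0::real). norm (dd v (dd u f) p - dd u (dd v f) p) \<le> e"
    proof eventually_elim
      case (elim t)
      define X where "X = f (p + t *\<^sub>R u + t *\<^sub>R v) - f (p + t *\<^sub>R u) - f (p + t *\<^sub>R v) + f p"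
      have 1: "norm (X - (t * t) *\<^sub>R dd v (dd u f) p) \<le> e / 2 * (t * t)" using elim(1) by (simp add: X_def)
      have "X = f (p + t *\<^sub>R v + t *\<^sub>R u) - f (p + t *\<^sub>R v) - f (p + t *\<^sub>R u) + f p" by (simp add: X_def add_ac)
      hence 2: "norm (X - (t * t) *\<^sub>R dd u (dd v f) p) \<le> e / 2 * (t * t)" using elim(2) by simp
      have "norm ((t * t) *\<^sub>R (dd v (dd u f) p - dd u (dd v f) p)) \<le> e / 2 * (t * t) + e / 2 * (t * t)"
        using norm_triangle_le_diff[OF add_mono[OF 2 1]] by (simp add: scaleR_diff_right)
      moreover have "e / 2 * (t * t) + e / 2 * (t * t) = (t * t) * e" by (simp add: algebra_simps)
      moreover have "norm ((t * t) *\<^sub>R X) = (t * t) * norm X" for X :: 'a by simp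
      ultimately have "(t * t) * norm (dd v (dd u f) p - dd u (dd v f) p) \<le> (t * t) * e" by (simp add: mult.commute)
      thus ?case using elim(3) by simp
    qed
    hence "norm (dd v (dd u f) p - dd u (dd v f) p) \<le> e" by (simp only: eventually_const trivial_limit_at_right_real not_False_eq_True)
    thus "norm (dd v (dd u f) p - dd u (dd v f) p) \<le> 0 + e" by simp
  qed
  thus ?thesis by simp
qed

lemma dbar_dd:
  assumes S: "open S" "p \<in> S" and f: "Ck_on (Suc (Suc 0)) S f"
  shows "dbar (dd v f) p = dd v (dbar f) p" "dbar f differentiable (at p)"
proof -
  have C1: "C1_on S (dd v f)" for v using f unfolding Ck_on_Suc[of "Suc 0"] by blast
  have 1: "((dd v f) has_derivative (\<lambda>u. dd u (dd v f) p)) (at p)" for v using dd_works[OF C1_onD(1)[OF C1 S(2)]] .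
  have "((\<lambda>z. (1/2) * dd ex f z + (\<i>/2) * dd ey f z) has_derivative (\<lambda>u. (1/2) * dd u (dd ex f) p + (\<i>/2) * dd u (dd ey f) p)) (at p)"
    by (intro has_derivative_add bounded_linear.has_derivative[OF bounded_linear_mult_right] 1)
  moreover have "dbar f = (\<lambda>z. (1/2) * dd ex f z + (\<i>/2) * dd ey f z)"
    by (rule ext) (simp add: dbar_def add_divide_distrib)
  ultimately have 2: "(dbar f has_derivative (\<lambda>u. (1/2) * dd u (dd ex f) p + (\<i>/2) * dd u (dd ey f) p)) (at p)" by simp
  show "dbar f differentiable (at p)" using 2 differentiableI by blast
  show "dbar (dd v f) p = dd v (dbar f) p"
    unfolding dd_eqI[OF 2] dbar_def dd_commute[OF S f, of _ v] by (simp add: add_divide_distrib)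
qed

section \<open>Hoelder continuity of first derivatives\<close>

text \<open>Hoelder continuity, with some positive exponent, on the punctured disk of radius \<open>R\<close> about the origin.\<close>

definition holder :: "real \<Rightarrow> (plane \<Rightarrow> complex) \<Rightarrow> bool" where
  "holder R f \<longleftrightarrow> (\<exists>\<alpha>>0. \<exists>C. \<forall>a\<in>ball 0 R - {0}. \<forall>b\<in>ball 0 R - {0}. norm (f a - f b) \<le> C * norm (a - b) powr \<alpha>)"

lemma holder_subset: "holder R f \<Longrightarrow> R' \<le> R \<Longrightarrow> holder R' f"
  unfolding holder_def by (meson Diff_iff subset_ball subsetD)

lemma ball_diff_norm: "a \<in> ball 0 R \<Longrightarrow> b \<in> ball (0::plane) R \<Longrightarrow> R \<le> 1/2 \<Longrightarrow> norm (a - b) \<le> 1"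
  using norm_triangle_ineq4[of a b] by simp

lemma holder_finite:
  assumes "finite I" "0 < R" "R \<le> 1/2" "\<And>i. i \<in> I \<Longrightarrow> holder R (w i)"
  shows "\<exists>\<alpha> C. 0 < \<alpha> \<and> \<alpha> < 1 \<and> 0 \<le> C \<and> (\<forall>i\<in>I. \<forall>a\<in>ball 0 R - {0}. \<forall>b\<in>ball 0 R - {0}. norm (w i a - w i b) \<le> C * norm (a - b) powr \<alpha>)"
  using assms(1,4)
proof (induction I rule: finite_induct)
  case empty
  show ?case by (intro exI[of _ "1/2"] exI[of _ 0]) auto
next
  case (insert i I)
  then obtain \<alpha> C where 1: "0 < \<alpha>" "\<alpha> < 1" "0 \<le> C" "\<And>j a b. j \<in> I \<Longrightarrow> a \<in> ball 0 R - {0} \<Longrightarrow> b \<in> ball 0 R - {0} \<Longrightarrow> norm (w j a - w j b) \<le> C * norm (a - b) powr \<alpha>"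
    by blast
  obtain \<beta> D where 2: "0 < \<beta>" "\<And>a b. a \<in> ball 0 R - {0} \<Longrightarrow> b \<in> ball 0 R - {0} \<Longrightarrow> norm (w i a - w i b) \<le> D * norm (a - b) powr \<beta>"
    using insert.prems[OF insertI1] unfolding holder_def by blast
  have mono: "X * norm (a - b) powr \<gamma> \<le> (C + \<bar>D\<bar>) * norm (a - b) powr min \<alpha> \<beta>"
    if "X \<le> C + \<bar>D\<bar>" "a \<in> ball 0 R - {0}" "b \<in> ball 0 R - {0}" "min \<alpha> \<beta> \<le> \<gamma>" for a b :: plane and X \<gamma>
  proof (cases "a = b")
    case False
    have "norm (a - b) \<le> 1" using that assms(3) by (intro ball_diff_norm) auto
    hence "norm (a - b) powr \<gamma> \<le> norm (a - b) powr min \<alpha> \<beta>" using that False by (intro powr_mono') auto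
    thus ?thesis using that 1(3) by (intro mult_mono) auto
  qed simp
  show ?case
  proof (intro exI conjI ballI)
    fix j and a b :: plane assume j: "j \<in> insert i I" and ab: "a \<in> ball 0 R - {0}" "b \<in> ball 0 R - {0}"
    show "norm (w j a - w j b) \<le> (C + \<bar>D\<bar>) * norm (a - b) powr min \<alpha> \<beta>"
    proof (cases "j = i")
      case True
      thus ?thesis using order_trans[OF 2(2)[OF ab] mono[of D a b \<beta>]] ab 1(3) by auto
    next
      case False
      hence "j \<in> I" using j by simp
      thus ?thesis using order_trans[OF 1(4)[OF _ ab] mono[of C a b \<alpha>]] ab by auto
    qed
  qed (use 1 2 in auto)
qed

lemma holder_bounded:
  assumes "holder R f" "0 < R" "R \<le> 1/2"
  shows "\<exists>C. \<forall>z\<in>ball 0 R - {0}. norm (f z) \<le> C"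
proof -
  obtain \<alpha> C where 1: "0 < \<alpha>" "\<And>a b. a \<in> ball 0 R - {0} \<Longrightarrow> b \<in> ball 0 R - {0} \<Longrightarrow> norm (f a - f b) \<le> C * norm (a - b) powr \<alpha>"
    using assms(1) unfolding holder_def by blast
  define b where "b = (R / 2, 0::real)"
  have b: "b \<in> ball 0 R - {0}" using assms by (simp add: b_def norm_first_axis prod_eq_iff)
  have "norm (f z) \<le> \<bar>C\<bar> + norm (f b)" if z: "z \<in> ball 0 R - {0}" for z
  proof -
    have "norm (z - b) \<le> 1" using z b assms by (intro ball_diff_norm) auto
    hence "norm (z - b) powr \<alpha> \<le> 1" using 1 by (intro powr_le1) auto
    hence "C * norm (z - b) powr \<alpha> \<le> \<bar>C\<bar> * 1" by (intro mult_mono) auto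
    thus ?thesis using 1(2)[OF z b] norm_triangle_sub[of "f z" "f b"] by linarith
  qed
  thus ?thesis by blast
qed

lemma norm_unit_axes: "norm ex = 1" "norm ey = 1"
  by (simp_all add: norm_prod_def)

text \<open>The family is treated as a whole: the hypothesis bounds the derivatives of each \<open>dbar (w i)\<close> by all first
  derivatives together, whose sum is \<open>Q\<close>.  Point picking for \<open>Q\<close> on a disk of radius \<open>|z0| / 2\<close> about \<open>z0\<close> makes
  the gradient estimate applicable with a Lipschitz constant proportional to \<open>1 + Q\<close> at the picked point.\<close>

proposition derivatives_holder:
  fixes w :: "'i \<Rightarrow> plane \<Rightarrow> complex"
  assumes I: "finite I" and R: "0 < R" "R \<le> 1/2"
    and w: "\<And>i. i \<in> I \<Longrightarrow> Ck_on (Suc (Suc 0)) (ball 0 R - {0}) (w i)"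
    and h: "\<And>i. i \<in> I \<Longrightarrow> holder R (w i)"
    and Q: "\<And>z. Q z = (\<Sum>i\<in>I. norm (dd ex (w i) z) + norm (dd ey (w i) z))"
    and K: "0 \<le> K" "\<And>i z. i \<in> I \<Longrightarrow> z \<in> ball 0 R - {0} \<Longrightarrow> norm (dbar (w i) z) \<le> K"
    and dK: "\<And>i z v. i \<in> I \<Longrightarrow> z \<in> ball 0 R - {0} \<Longrightarrow> v \<in> {ex, ey} \<Longrightarrow> norm (dd v (dbar (w i)) z) \<le> K * (1 + Q z)"
  shows "\<exists>R'. 0 < R' \<and> R' \<le> R \<and> (\<forall>i\<in>I. \<forall>v\<in>{ex, ey}. holder R' (dd v (w i)))"
proof -
  let ?B = "ball (0::plane) R - {0}"
  have oB: "open ?B" by auto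
  obtain \<alpha> A where \<alpha>: "0 < \<alpha>" "\<alpha> < 1" "0 \<le> A" "\<And>i a b. i \<in> I \<Longrightarrow> a \<in> ?B \<Longrightarrow> b \<in> ?B \<Longrightarrow> norm (w i a - w i b) \<le> A * norm (a - b) powr \<alpha>"
    using holder_finite[of I R w] I R h by blast
  obtain C where C: "0 < C" "\<And>S g p s L M v. \<lbrakk>open S; cball p s \<subseteq> S; 0 < s; C1_on S g; 0 \<le> L; 0 \<le> M;
       \<And>z. z \<in> cball p s \<Longrightarrow> norm (dbar g z - dbar g p) \<le> L * norm (z - p);
       \<And>z. z \<in> cball p s \<Longrightarrow> norm (g z - g p) \<le> M\<rbrakk>
      \<Longrightarrow> norm (dd v g p) \<le> C * (M / s + norm (dbar g p) + L * s) * norm v"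
    using gradient_estimate by blast
  have wC1: "C1_on ?B (w i)" if "i \<in> I" for i using Ck_on_SucD[OF w[OF that]] .
  have dwC1: "C1_on ?B (dd v (w i))" if "i \<in> I" for i v using w[OF that] unfolding Ck_on_Suc[of "Suc 0"] by blast
  have Q0: "0 \<le> Q z" for z unfolding Q by (intro sum_nonneg) auto
  have Qi: "norm (dd v (w i) z) \<le> Q z" if "i \<in> I" "v \<in> {ex, ey}" for i v z
  proof -
    have "norm (dd v (w i) z) \<le> norm (dd ex (w i) z) + norm (dd ey (w i) z)" using that by auto
    also have "\<dots> \<le> Q z" unfolding Q
      using that(1) I by (intro member_le_sum[of i I "\<lambda>i. norm (dd ex (w i) z) + norm (dd ey (w i) z)"]) auto
    finally show ?thesis .
  qed
  have Qc: "continuous_on ?B Q" unfolding Q[abs_def] by (intro continuous_intros C1_onD(2) wC1)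
  define n where "n = real (card I)"
  have n: "0 \<le> n" by (simp add: n_def)
  define D where "D = 2 * n * C"
  have D: "0 \<le> D" using n C by (simp add: D_def)
  \<comment> \<open>The radius is so small that the term with the Lipschitz constant can be absorbed.\<close>
  define R1 where "R1 = min (R / 2) (1 / (8 * D * K + 1))"
  have DK: "0 < 8 * D * K + 1" using D K by (simp add: add_nonneg_pos)
  have R1: "0 < R1" "R1 \<le> R / 2" "R1 \<le> 1 / (8 * D * K + 1)" using R DK by (auto simp: R1_def)
  define P where "P = 2 * D * (A + 3 * K)"
  have P: "0 \<le> P" using D \<alpha> K by (simp add: P_def)
  have grad: "Q z0 \<le> 2 * P * (1/2) powr (\<alpha> - 1) * norm z0 powr (\<alpha> - 1)" if z0: "z0 \<in> ball 0 R1 - {0}" for z0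
  proof -
    define r where "r = norm z0 / 2"
    have "0 < norm z0" "norm z0 < R1" using z0 by auto
    hence r: "0 < r" "r < R1" unfolding r_def by linarith+
    have sub: "cball z0 r \<subseteq> ?B"
    proof
      fix z assume "z \<in> cball z0 r"
      hence "norm (z0 - z) \<le> r" by (simp add: dist_norm)
      moreover have "norm z \<le> norm z0 + norm (z0 - z)" using norm_triangle_sub[of z z0] by (simp add: norm_minus_commute)
      moreover have "norm z0 \<le> norm z + norm (z0 - z)" using norm_triangle_sub[of z0 z] by simp
      ultimately have "0 < norm z" "norm z < R" using z0 R1 r by (auto simp: r_def)
      thus "z \<in> ?B" by simp
    qed
    obtain z1 \<sigma> where z1: "0 \<le> \<sigma>" "cball z1 \<sigma> \<subseteq> cball z0 r" "\<sigma> \<le> r" "Q z0 * r \<le> 2 * \<sigma> * Q z1"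
      and dbl: "\<And>z. z \<in> cball z1 \<sigma> \<Longrightarrow> Q z \<le> 2 * Q z1"
      by (rule point_picking[OF continuous_on_subset[OF Qc sub] Q0 r(1)]) (rule that; blast)
    have sub1: "cball z1 \<sigma> \<subseteq> ?B" using z1(2) sub by blast
    have "Q z0 * r \<le> 2 * P * r powr \<alpha>"
    proof (cases "\<sigma> = 0")
      case True
      thus ?thesis using z1(4) P by (metis mult_eq_0_iff mult_nonneg_nonneg order_trans powr_ge_zero zero_le_numeral)
    next
      case False
      hence \<sigma>: "0 < \<sigma>" using z1(1) by simp
      have \<sigma>1: "\<sigma> \<le> 1" "8 * D * K * \<sigma> \<le> 1"
      proof -
        have "\<sigma> \<le> R1" using z1(3) r by simp
        thus "\<sigma> \<le> 1" using R1 R by simp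
        have "\<sigma> \<le> 1 / (8 * D * K + 1)" using \<open>\<sigma> \<le> R1\<close> R1 by simp
        hence "\<sigma> * (8 * D * K + 1) \<le> 1" using DK by (simp add: pos_le_divide_eq)
        thus "8 * D * K * \<sigma> \<le> 1" using \<sigma> by (simp add: algebra_simps)
      qed
      define L where "L = 2 * (K * (1 + 2 * Q z1))"
      have L: "0 \<le> L" using K Q0[of z1] by (simp add: L_def)
      have z1B: "z1 \<in> ?B" using subsetD[OF sub1, of z1] \<sigma> by simp
      have one: "norm (dd v (w i) z1) \<le> C * (A * \<sigma> powr \<alpha> / \<sigma> + K + L * \<sigma>)" if i: "i \<in> I" and v: "v \<in> {ex, ey}" for i v
      proof -
        have "norm (dd v (w i) z1) \<le> C * ((A * \<sigma> powr \<alpha>) / \<sigma> + norm (dbar (w i) z1) + L * \<sigma>) * norm v"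
        proof (rule C(2)[OF oB sub1 \<sigma> wC1[OF i] L])
          show "0 \<le> A * \<sigma> powr \<alpha>" using \<alpha> by simp
          fix z assume z: "z \<in> cball z1 \<sigma>"
          have zz: "norm (z - z1) \<le> \<sigma>" using z by (simp add: dist_norm norm_minus_commute)
          show "norm (dbar (w i) z - dbar (w i) z1) \<le> L * norm (z - z1)"
          proof (rule differentiable_bound[of "cball z1 \<sigma>" _ "\<lambda>x v. dd v (dbar (w i)) x"])
            fix x assume x: "x \<in> cball z1 \<sigma>"
            have xB: "x \<in> ?B" using x sub1 by blast
            have df: "dbar (w i) differentiable (at x)" by (rule dbar_dd(2)[OF oB xB w[OF i]])
            show "(dbar (w i) has_derivative (\<lambda>v. dd v (dbar (w i)) x)) (at x within cball z1 \<sigma>)"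
              by (rule has_derivative_at_withinI[OF dd_works[OF df]])
            have "norm (dd ex (dbar (w i)) x) + norm (dd ey (dbar (w i)) x) \<le> K * (1 + Q x) + K * (1 + Q x)"
              by (intro add_mono dK i xB) auto
            also have "\<dots> \<le> L" using dbl[OF x] mult_left_mono[OF dbl[OF x] K(1)] by (simp add: L_def algebra_simps)
            finally have "norm (dd ex (dbar (w i)) x) + norm (dd ey (dbar (w i)) x) \<le> L" .
            hence "norm (dd v (dbar (w i)) x) \<le> L * norm v" for v
              using order_trans[OF norm_dd_le[OF df, of v] mult_left_mono[of _ L "norm v"]] by (simp add: mult.commute)
            thus "onorm (\<lambda>v. dd v (dbar (w i)) x) \<le> L" by (rule onorm_le)
          qed (use z \<sigma> in auto)
          have "norm (w i z - w i z1) \<le> A * norm (z - z1) powr \<alpha>" by (rule \<alpha>(4)[OF i subsetD[OF sub1 z] z1B])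
          also have "\<dots> \<le> A * \<sigma> powr \<alpha>" using zz \<alpha> by (intro mult_left_mono powr_mono2) auto
          finally show "norm (w i z - w i z1) \<le> A * \<sigma> powr \<alpha>" .
        qed
        also have "norm v = 1" using v norm_unit_axes by auto
        also have "C * ((A * \<sigma> powr \<alpha>) / \<sigma> + norm (dbar (w i) z1) + L * \<sigma>) * 1 \<le> C * (A * \<sigma> powr \<alpha> / \<sigma> + K + L * \<sigma>)"
          using K(2)[OF i z1B] C by simp
        finally show ?thesis .
      qed
      have "Q z1 \<le> (\<Sum>i\<in>I. C * (A * \<sigma> powr \<alpha> / \<sigma> + K + L * \<sigma>) + C * (A * \<sigma> powr \<alpha> / \<sigma> + K + L * \<sigma>))"
        unfolding Q by (intro sum_mono add_mono one) auto
      also have "\<dots> = D * (A * \<sigma> powr \<alpha> / \<sigma> + K + L * \<sigma>)" by (simp add: D_def n_def)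
      finally have "\<sigma> * Q z1 \<le> \<sigma> * (D * (A * \<sigma> powr \<alpha> / \<sigma> + K + L * \<sigma>))" using \<sigma> by (intro mult_left_mono) auto
      also have "\<dots> = D * (A * \<sigma> powr \<alpha> + K * \<sigma> + 2 * K * (\<sigma> * \<sigma>)) + (8 * D * K * \<sigma>) * (\<sigma> * Q z1) / 2"
        using \<sigma> by (simp add: L_def field_simps)
      also have "\<dots> \<le> D * (A * \<sigma> powr \<alpha> + K * \<sigma> powr \<alpha> + 2 * K * \<sigma> powr \<alpha>) + 1 * (\<sigma> * Q z1) / 2"
      proof -
        have s: "\<sigma> \<le> \<sigma> powr \<alpha>" using powr_mono'[of \<alpha> 1 \<sigma>] \<sigma> \<sigma>1 \<alpha> by simp
        moreover have "\<sigma> * \<sigma> \<le> 1 * \<sigma> powr \<alpha>" using s \<sigma> \<sigma>1 by (intro mult_mono) auto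
        ultimately show ?thesis using \<sigma>1 \<sigma> Q0[of z1] D K by (intro add_mono mult_left_mono mult_right_mono divide_right_mono) auto
      qed
      finally have "2 * \<sigma> * Q z1 \<le> 2 * P * \<sigma> powr \<alpha>" by (simp add: P_def algebra_simps)
      also have "\<dots> \<le> 2 * P * r powr \<alpha>" using \<sigma> z1(3) \<alpha> P by (intro mult_left_mono powr_mono2) auto
      finally show ?thesis using z1(4) by linarith
    qed
    hence "Q z0 \<le> 2 * P * r powr \<alpha> / r" using r by (simp add: pos_le_divide_eq)
    also have "\<dots> = 2 * P * r powr (\<alpha> - 1)" using r by (simp add: powr_diff)
    also have "r powr (\<alpha> - 1) = (1/2) powr (\<alpha> - 1) * norm z0 powr (\<alpha> - 1)"
      unfolding r_def by (simp add: powr_mult[symmetric])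
    finally show ?thesis by (simp add: mult.assoc)
  qed
  define T where "T = 2 * P * (1/2) powr (\<alpha> - 1)"
  have T: "0 \<le> T" using P by (simp add: T_def)
  have "holder (R1 / 4) (dd v (w i))" if i: "i \<in> I" and v: "v \<in> {ex, ey}" for i v
  proof -
    have subB: "ball 0 R1 - {0} \<subseteq> ?B" using R1 R by auto
    have QT: "Q z \<le> T * norm z powr (-(1 - \<alpha>))" if "z \<in> ball 0 R1 - {0}" for z
      using grad[OF that] by (simp add: T_def)
    have one: "1 \<le> norm z powr (-(1 - \<alpha>))" if "z \<in> ball 0 R1 - {0}" for z :: plane
    proof -
      have "norm z powr 0 \<le> norm z powr (-(1 - \<alpha>))" using that R1 R \<alpha> by (intro powr_mono') auto
      thus ?thesis using that by simp
    qed
    define E where "E = T + K * (1 + T)"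
    have E: "T \<le> E" "K * (1 + T) \<le> E" using T K by (auto simp: E_def)
    obtain X where X: "\<And>a b. a \<in> ball 0 (R1/4) - {0} \<Longrightarrow> b \<in> ball 0 (R1/4) - {0} \<Longrightarrow> norm (dd v (w i) a - dd v (w i) b) \<le> X * norm (a - b) powr (\<alpha>/2)"
    proof (rule holder_punctured[of R1 "1 - \<alpha>" "\<alpha>/2" "dd v (w i)" E])
      show "C1_on (ball 0 R1 - {0}) (dd v (w i))" by (rule Ck_on_subset[OF dwC1[OF i] subB])
      fix z :: plane assume z: "z \<in> ball 0 R1 - {0}"
      have zB: "z \<in> ?B" using z subB by blast
      have "norm (dd v (w i) z) \<le> T * norm z powr (-(1 - \<alpha>))" using Qi[OF i v, of z] QT[OF z] by linarith
      also have "\<dots> \<le> E * norm z powr (-(1 - \<alpha>))" using E by (intro mult_right_mono) auto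
      finally show "norm (dd v (w i) z) \<le> E * norm z powr (-(1 - \<alpha>))" .
      have "norm (dbar (dd v (w i)) z) \<le> K * (1 + Q z)"
        using dK[OF i zB v] dbar_dd(1)[OF oB zB w[OF i]] by simp
      also have "\<dots> \<le> K * (norm z powr (-(1 - \<alpha>)) + T * norm z powr (-(1 - \<alpha>)))"
        using K one[OF z] QT[OF z] by (intro mult_left_mono add_mono) auto
      also have "\<dots> = K * (1 + T) * norm z powr (-(1 - \<alpha>))" by (simp add: algebra_simps)
      also have "\<dots> \<le> E * norm z powr (-(1 - \<alpha>))" using E by (intro mult_right_mono) auto
      finally show "norm (dbar (dd v (w i)) z) \<le> E * norm z powr (-(1 - \<alpha>))" .
    qed (use R R1 \<alpha> in auto)
    show ?thesis unfolding holder_def using \<alpha> by (intro exI[of _ "\<alpha>/2"] exI[of _ X] conjI ballI X) auto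
  qed
  thus ?thesis using R1 R by (intro exI[of _ "R1 / 4"]) auto
qed

section \<open>Polynomial expressions in iterated derivatives\<close>

text \<open>The functions that agree on \<open>S\<close> with a polynomial, with complex coefficients, in elements of \<open>G\<close>.\<close>

inductive_set alg :: "plane set \<Rightarrow> (plane \<Rightarrow> complex) set \<Rightarrow> (plane \<Rightarrow> complex) set" for S G where
  gen: "g \<in> G \<Longrightarrow> g \<in> alg S G"
| const: "(\<lambda>z. c) \<in> alg S G"
| add: "f \<in> alg S G \<Longrightarrow> g \<in> alg S G \<Longrightarrow> (\<lambda>z. f z + g z) \<in> alg S G"
| mult: "f \<in> alg S G \<Longrightarrow> g \<in> alg S G \<Longrightarrow> (\<lambda>z. f z * g z) \<in> alg S G"
| cong: "f \<in> alg S G \<Longrightarrow> (\<And>z. z \<in> S \<Longrightarrow> f z = g z) \<Longrightarrow> g \<in> alg S G"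

lemma alg_subset: "f \<in> alg S G \<Longrightarrow> T \<subseteq> S \<Longrightarrow> f \<in> alg T G"
proof (induction rule: alg.induct)
  case (cong f g)
  show ?case by (rule alg.cong[of f]) (use cong in auto)
qed (auto intro: alg.intros)

lemma alg_mono: "f \<in> alg S G \<Longrightarrow> G \<subseteq> G' \<Longrightarrow> f \<in> alg S G'"
proof (induction rule: alg.induct)
  case (cong f g)
  show ?case by (rule alg.cong[of f]) (use cong in auto)
qed (auto intro: alg.intros)

lemma dd_const: "dd v (\<lambda>z. c) z = 0"
  by (rule dd_eqI[OF has_derivative_const])

text \<open>By the product rule, first derivatives of a polynomial are linear in first derivatives of its arguments.\<close>

lemma alg_gradient_bound:
  assumes S: "open S"
    and G: "\<And>g z. g \<in> G \<Longrightarrow> z \<in> S \<Longrightarrow> g differentiable (at z)"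
    and b: "\<And>g. g \<in> G \<Longrightarrow> \<exists>C. \<forall>z\<in>S. norm (g z) \<le> C"
    and d: "\<And>g. g \<in> G \<Longrightarrow> \<exists>C. \<forall>z\<in>S. norm (dd v g z) \<le> C * \<omega> z"
    and \<omega>: "\<And>z. 0 \<le> \<omega> z"
    and f: "f \<in> alg S G"
  shows "(\<forall>z\<in>S. f differentiable (at z)) \<and> (\<exists>C. \<forall>z\<in>S. norm (f z) \<le> C) \<and> (\<exists>C. \<forall>z\<in>S. norm (dd v f z) \<le> C * \<omega> z)"
  using f
proof (induction rule: alg.induct)
  case (gen g)
  thus ?case using G b d by blast
next
  case (const c)
  have "\<exists>C. \<forall>z\<in>S. norm ((\<lambda>z. c) z) \<le> C" by (rule exI[of _ "norm c"]) simp
  moreover have "\<exists>C. \<forall>z\<in>S. norm (dd v (\<lambda>z. c) z) \<le> C * \<omega> z" by (rule exI[of _ 0]) (simp add: dd_const)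
  ultimately show ?case by simp
next
  case (add f g)
  then obtain C1 D1 C2 D2 where 1: "\<And>z. z \<in> S \<Longrightarrow> f differentiable (at z)" "\<And>z. z \<in> S \<Longrightarrow> g differentiable (at z)"
    "\<And>z. z \<in> S \<Longrightarrow> norm (f z) \<le> C1" "\<And>z. z \<in> S \<Longrightarrow> norm (g z) \<le> C2"
    "\<And>z. z \<in> S \<Longrightarrow> norm (dd v f z) \<le> D1 * \<omega> z" "\<And>z. z \<in> S \<Longrightarrow> norm (dd v g z) \<le> D2 * \<omega> z" by blast
  show ?case
  proof (intro conjI ballI exI)
    fix z assume z: "z \<in> S"
    show "(\<lambda>z. f z + g z) differentiable (at z)" using 1(1,2)[OF z] by (rule differentiable_add)
    show "norm (f z + g z) \<le> C1 + C2" using 1(3,4)[OF z] by (rule norm_triangle_mono)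
    have "norm (dd v f z + dd v g z) \<le> D1 * \<omega> z + D2 * \<omega> z" using 1(5,6)[OF z] by (rule norm_triangle_mono)
    thus "norm (dd v (\<lambda>z. f z + g z) z) \<le> (D1 + D2) * \<omega> z"
      unfolding dd_add[OF 1(1)[OF z] 1(2)[OF z]] by (simp add: algebra_simps)
  qed
next
  case (mult f g)
  then obtain C1 D1 C2 D2 where 1: "\<And>z. z \<in> S \<Longrightarrow> f differentiable (at z)" "\<And>z. z \<in> S \<Longrightarrow> g differentiable (at z)"
    "\<And>z. z \<in> S \<Longrightarrow> norm (f z) \<le> C1" "\<And>z. z \<in> S \<Longrightarrow> norm (g z) \<le> C2"
    "\<And>z. z \<in> S \<Longrightarrow> norm (dd v f z) \<le> D1 * \<omega> z" "\<And>z. z \<in> S \<Longrightarrow> norm (dd v g z) \<le> D2 * \<omega> z" by blast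
  show ?case
  proof (intro conjI ballI exI)
    fix z assume z: "z \<in> S"
    show "(\<lambda>z. f z * g z) differentiable (at z)" using 1(1,2)[OF z] by (rule differentiable_mult)
    show "norm (f z * g z) \<le> C1 * C2" unfolding norm_mult
      using 1(3,4)[OF z] order_trans[OF norm_ge_zero 1(3)[OF z]] by (intro mult_mono) auto
    have "norm (f z * dd v g z) \<le> C1 * (D2 * \<omega> z)" unfolding norm_mult
      using 1(3)[OF z] 1(6)[OF z] order_trans[OF norm_ge_zero 1(3)[OF z]] by (intro mult_mono) auto
    moreover have "norm (dd v f z * g z) \<le> (D1 * \<omega> z) * C2" unfolding norm_mult
      using 1(4)[OF z] 1(5)[OF z] order_trans[OF norm_ge_zero 1(5)[OF z]] by (intro mult_mono) auto
    ultimately have "norm (f z * dd v g z + dd v f z * g z) \<le> C1 * (D2 * \<omega> z) + (D1 * \<omega> z) * C2" by (rule norm_triangle_mono)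
    thus "norm (dd v (\<lambda>z. f z * g z) z) \<le> (C1 * D2 + D1 * C2) * \<omega> z"
      unfolding dd_mult[OF 1(1)[OF z] 1(2)[OF z]] by (simp add: algebra_simps)
  qed
next
  case (cong f g)
  then obtain C D where 1: "\<And>z. z \<in> S \<Longrightarrow> f differentiable (at z)" "\<And>z. z \<in> S \<Longrightarrow> norm (f z) \<le> C"
    "\<And>z. z \<in> S \<Longrightarrow> norm (dd v f z) \<le> D * \<omega> z" by blast
  show ?case
  proof (intro conjI ballI exI)
    fix z assume z: "z \<in> S"
    show "g differentiable (at z)" by (rule differentiable_cong_open[OF S z cong(2) 1(1)[OF z]])
    show "norm (g z) \<le> C" using 1(2)[OF z] cong(2)[OF z] by simp
    show "norm (dd v g z) \<le> D * \<omega> z" using 1(3)[OF z] dd_cong[OF S z cong(2)] by simp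
  qed
qed

lemma alg_dd:
  assumes S: "open S"
    and G: "\<And>g. g \<in> G \<Longrightarrow> (\<forall>z\<in>S. g differentiable (at z)) \<and> g \<in> alg S G' \<and> dd v g \<in> alg S G'"
    and f: "f \<in> alg S G"
  shows "(\<forall>z\<in>S. f differentiable (at z)) \<and> f \<in> alg S G' \<and> dd v f \<in> alg S G'"
  using f
proof (induction rule: alg.induct)
  case (gen g)
  thus ?case by (rule G)
next
  case (const c)
  have "dd v (\<lambda>z. c) = (\<lambda>z. 0)" by (rule ext) (rule dd_const)
  thus ?case by (auto intro: alg.const)
next
  case (add f g)
  have "(\<lambda>z. dd v f z + dd v g z) \<in> alg S G'" using add by (intro alg.add) auto
  moreover have "dd v f z + dd v g z = dd v (\<lambda>z. f z + g z) z" if "z \<in> S" for z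
    using add that by (simp add: dd_add)
  ultimately have "dd v (\<lambda>z. f z + g z) \<in> alg S G'" by (rule alg.cong)
  thus ?case using add by (auto intro: alg.add differentiable_add)
next
  case (mult f g)
  have "(\<lambda>z. f z * dd v g z + dd v f z * g z) \<in> alg S G'" using mult by (intro alg.add alg.mult) auto
  moreover have "f z * dd v g z + dd v f z * g z = dd v (\<lambda>z. f z * g z) z" if "z \<in> S" for z
    using mult that by (simp add: dd_mult)
  ultimately have "dd v (\<lambda>z. f z * g z) \<in> alg S G'" by (rule alg.cong)
  thus ?case using mult by (auto intro: alg.mult differentiable_mult)
next
  case (cong f g)
  have "\<forall>z\<in>S. g differentiable (at z)"
  proof
    fix z assume z: "z \<in> S"
    show "g differentiable (at z)" by (rule differentiable_cong_open[OF S z cong(2)]) (use cong(3) z in auto)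
  qed
  moreover have "g \<in> alg S G'" using cong by (blast intro: alg.cong)
  moreover have "dd v g \<in> alg S G'"
    by (rule alg.cong[of "dd v f"]) (use cong(3) in blast, rule dd_cong[OF S _ cong(2)])
  ultimately show ?case by blast
qed

text \<open>The iterated directional derivative along a list of directions; the head of the list is applied last.\<close>

primrec iter_dd :: "plane list \<Rightarrow> (plane \<Rightarrow> 'a::real_normed_vector) \<Rightarrow> plane \<Rightarrow> 'a" where
  "iter_dd [] f = f"
| "iter_dd (v # l) f = dd v (iter_dd l f)"

lemma iter_dd_append: "iter_dd (l @ m) f = iter_dd l (iter_dd m f)"
  by (induction l) auto

lemma Ck_on_iter_dd: "Ck_on (length l + n) S f \<Longrightarrow> Ck_on n S (iter_dd l f)"
proof (induction l arbitrary: n)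
  case (Cons v l)
  hence "Ck_on (Suc n) S (iter_dd l f)" using Cons.IH[of "Suc n"] by simp
  hence "Ck_on n S (dd v (iter_dd l f))" unfolding Ck_on_Suc by blast
  thus ?case by simp
qed simp

text \<open>The multi-indices of order at most \<open>n\<close>, as lists of coordinate directions.\<close>

definition words :: "nat \<Rightarrow> plane list set" where
  "words n = {l. set l \<subseteq> {ex, ey} \<and> length l \<le> n}"

lemma finite_words: "finite (words n)"
  unfolding words_def by (rule finite_lists_length_le) simp

lemma words_simps: "[] \<in> words n" "l \<in> words n \<Longrightarrow> v \<in> {ex, ey} \<Longrightarrow> v # l \<in> words (Suc n)"
  "l \<in> words n \<Longrightarrow> n \<le> m \<Longrightarrow> l \<in> words m"
  "v # l \<in> words (Suc n) \<Longrightarrow> l \<in> words n \<and> v \<in> {ex, ey}"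
  by (auto simp: words_def)

text \<open>The derivatives up to order \<open>n\<close> of \<open>h\<close>, of the functions in \<open>W\<close> and of their conjugates.\<close>

definition gens :: "(plane \<Rightarrow> complex) set \<Rightarrow> (plane \<Rightarrow> complex) \<Rightarrow> nat \<Rightarrow> (plane \<Rightarrow> complex) set" where
  "gens W h n = (\<Union>l\<in>words n. insert (iter_dd l h) ((\<Union>w\<in>W. {iter_dd l w, \<lambda>z. cnj (iter_dd l w z)})))"

lemma gens_cases:
  assumes "g \<in> gens W h n"
  obtains l where "l \<in> words n" "g = iter_dd l h" | l w where "l \<in> words n" "w \<in> W" "g = iter_dd l w"
    | l w where "l \<in> words n" "w \<in> W" "g = (\<lambda>z. cnj (iter_dd l w z))"
  using assms unfolding gens_def by blast

lemma gens_mono: "m \<le> n \<Longrightarrow> gens W h m \<subseteq> gens W h n"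
  using words_simps(3) unfolding gens_def by blast

lemma gens_intros:
  "l \<in> words n \<Longrightarrow> iter_dd l h \<in> gens W h n" "l \<in> words n \<Longrightarrow> w \<in> W \<Longrightarrow> iter_dd l w \<in> gens W h n"
  "l \<in> words n \<Longrightarrow> w \<in> W \<Longrightarrow> (\<lambda>z. cnj (iter_dd l w z)) \<in> gens W h n"
  unfolding gens_def by blast+

lemma dbar_iter_dd_alg:
  assumes S: "open S" and W: "\<And>w m. w \<in> W \<Longrightarrow> Ck_on m S w" and h: "Ck_on n S h"
    and eq: "\<And>w. w \<in> W \<Longrightarrow> dbar w \<in> alg S (gens W h 0)" and w: "w \<in> W"
  shows "l \<in> words n \<Longrightarrow> dbar (iter_dd l w) \<in> alg S (gens W h (length l))"
proof (induction l)
  case Nil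
  thus ?case using eq[OF w] by simp
next
  case (Cons v l)
  then obtain n' where n': "n = Suc n'" by (cases n) (auto simp: words_def)
  have l: "l \<in> words n'" "v \<in> {ex, ey}" using Cons.prems words_simps(4) unfolding n' by blast+
  have len: "length l < n" using l by (auto simp: words_def n')
  have IH: "dbar (iter_dd l w) \<in> alg S (gens W h (length l))" using Cons.IH l words_simps(3)[of l n' n] n' by simp
  have "dd v (dbar (iter_dd l w)) \<in> alg S (gens W h (Suc (length l)))"
  proof (rule alg_dd[OF S _ IH, THEN conjunct2, THEN conjunct2])
    fix g assume g: "g \<in> gens W h (length l)"
    have g': "g \<in> alg S (gens W h (Suc (length l)))" using g gens_mono[of "length l" "Suc (length l)" W h] by (intro alg.gen) auto
    have hl: "Ck_on (Suc 0) S (iter_dd k f)" if "Ck_on (length k + Suc 0) S f" for k and f :: "plane \<Rightarrow> complex"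
      using Ck_on_iter_dd[OF that] .
    have wd: "iter_dd k u differentiable (at z)" if "u \<in> W" "z \<in> S" for k u z
      using C1_onD(1)[OF hl[OF W[OF that(1)]] that(2)] .
    from g show "(\<forall>z\<in>S. g differentiable (at z)) \<and> g \<in> alg S (gens W h (Suc (length l))) \<and> dd v g \<in> alg S (gens W h (Suc (length l)))"
    proof (cases rule: gens_cases)
      case (1 k)
      have "Ck_on (length k + Suc 0) S h" using 1(1) len by (intro Ck_on_mono[OF h]) (auto simp: words_def)
      hence "\<forall>z\<in>S. g differentiable (at z)" unfolding 1 using C1_onD(1)[OF hl] by blast
      moreover have "dd v g \<in> gens W h (Suc (length l))" using gens_intros(1)[OF words_simps(2)[OF 1(1) l(2)]] by (simp add: 1)
      ultimately show ?thesis using g' by (auto intro: alg.gen)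
    next
      case (2 k u)
      have "dd v g \<in> gens W h (Suc (length l))" using gens_intros(2)[OF words_simps(2)[OF 2(1) l(2)] 2(2)] by (simp add: 2)
      thus ?thesis using g' wd[OF 2(2)] by (auto simp: 2(3) intro: alg.gen)
    next
      case (3 k u)
      have d: "dd v g z = cnj (iter_dd (v # k) u z)" if "z \<in> S" for z
        unfolding 3(3) by (simp add: dd_linear[OF wd[OF 3(2) that] bounded_linear_cnj])
      have "\<forall>z\<in>S. g differentiable (at z)"
        unfolding 3(3) using bounded_linear.has_derivative[OF bounded_linear_cnj dd_works[OF wd[OF 3(2)]]] differentiableI by blast
      moreover have "dd v g \<in> alg S (gens W h (Suc (length l)))"
        by (rule alg.cong[OF alg.gen[OF gens_intros(3)[OF words_simps(2)[OF 3(1) l(2)] 3(2)]]]) (simp add: d)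
      ultimately show ?thesis using g' by blast
    qed
  qed
  moreover have "dd v (dbar (iter_dd l w)) z = dbar (iter_dd (v # l) w) z" if "z \<in> S" for z
    using dbar_dd(1)[OF S that Ck_on_iter_dd[OF W[OF w]]] by simp
  ultimately have "dbar (iter_dd (v # l) w) \<in> alg S (gens W h (Suc (length l)))" by (rule alg.cong)
  thus ?case by simp
qed

section \<open>Regularity of all orders\<close>

lemma finite_common_bound:
  assumes "finite I" "\<And>z. (0::real) \<le> g z" "\<And>i. i \<in> I \<Longrightarrow> \<exists>C. \<forall>z\<in>S. f i z \<le> C * g z"
  shows "\<exists>K\<ge>0. \<forall>i\<in>I. \<forall>z\<in>S. f i z \<le> K * g z"
proof -
  have "\<exists>C. \<forall>i\<in>I. \<forall>z\<in>S. f i z \<le> C i * g z" using assms(3) by (intro bchoice) blast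
  then obtain C where C: "\<And>i z. i \<in> I \<Longrightarrow> z \<in> S \<Longrightarrow> f i z \<le> C i * g z" by blast
  show ?thesis
  proof (intro exI conjI ballI)
    show "0 \<le> (\<Sum>i\<in>I. \<bar>C i\<bar>)" by (intro sum_nonneg) auto
    fix i z assume i: "i \<in> I" "z \<in> S"
    have "C i \<le> (\<Sum>i\<in>I. \<bar>C i\<bar>)" using member_le_sum[of i I "\<lambda>i. \<bar>C i\<bar>"] assms(1) i by force
    thus "f i z \<le> (\<Sum>i\<in>I. \<bar>C i\<bar>) * g z" using C[OF i] mult_right_mono[of "C i" _ "g z"] assms(2)[of z] by force
  qed
qed

text \<open>The preceding result on first derivatives is applied to the family of all derivatives up to order \<open>n\<close>.\<close>

lemma regularity_step:
  assumes R: "0 < R" "R \<le> 1/2" "R < R0" and W: "finite W" "\<And>w m. w \<in> W \<Longrightarrow> Ck_on m (ball 0 R - {0}) w"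
    and h: "Ck_on (Suc n) (ball 0 R0) h"
    and eq: "\<And>w. w \<in> W \<Longrightarrow> dbar w \<in> alg (ball 0 R - {0}) (gens W h 0)"
    and hol: "\<And>w l. w \<in> W \<Longrightarrow> l \<in> words n \<Longrightarrow> holder R (iter_dd l w)"
  shows "\<exists>R'. 0 < R' \<and> R' \<le> R \<and> (\<forall>w\<in>W. \<forall>l\<in>words (Suc n). holder R' (iter_dd l w))"
proof -
  let ?B = "ball (0::plane) R - {0}"
  have oB: "open ?B" by auto
  define I where "I = words n \<times> W"
  define f where "f = (\<lambda>(l, w). iter_dd l w :: plane \<Rightarrow> complex)"
  define Q where "Q = (\<lambda>z. \<Sum>i\<in>I. norm (dd ex (f i) z) + norm (dd ey (f i) z))"
  have fI: "finite I" using W finite_words by (simp add: I_def)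
  have Q0: "0 \<le> Q z" for z unfolding Q_def by (intro sum_nonneg) auto
  have sub: "?B \<subseteq> ball 0 R0" using R by auto
  have hB: "Ck_on (Suc n) ?B h" by (rule Ck_on_subset[OF h sub])
  have hbd: "\<exists>C. \<forall>z\<in>?B. norm (iter_dd l h z) \<le> C" if "l \<in> words (Suc n)" for l
  proof -
    have "Ck_on 0 (ball 0 R0) (iter_dd l h)" using that by (intro Ck_on_iter_dd Ck_on_mono[OF h]) (auto simp: words_def)
    hence "continuous_on (cball 0 R) (iter_dd l h)" using R by (auto intro: continuous_on_subset)
    hence "bounded (iter_dd l h ` cball 0 R)" by (intro compact_imp_bounded compact_continuous_image) auto
    then obtain C where C: "\<forall>x\<in>iter_dd l h ` cball 0 R. norm x \<le> C" unfolding bounded_iff by blast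
    have "norm (iter_dd l h z) \<le> C" if "z \<in> ?B" for z using C that by (auto intro: order.strict_implies_order)
    thus ?thesis by blast
  qed
  have wd: "iter_dd l w differentiable (at z)" if "w \<in> W" "z \<in> ?B" for l w z
    using C1_onD(1)[OF Ck_on_iter_dd[OF W(2)[OF that(1)]] that(2)] .
  have Qle: "norm (dd v (iter_dd l w) z) \<le> Q z" if "l \<in> words n" "w \<in> W" "v \<in> {ex, ey}" for l w v z
  proof -
    have "norm (dd v (iter_dd l w) z) \<le> norm (dd ex (f (l, w)) z) + norm (dd ey (f (l, w)) z)" using that by (auto simp: f_def)
    also have "\<dots> \<le> Q z" unfolding Q_def using that fI
      by (intro member_le_sum[of "(l, w)" I "\<lambda>i. norm (dd ex (f i) z) + norm (dd ey (f i) z)"]) (auto simp: I_def)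
    finally show ?thesis .
  qed
  have alg_bd: "(\<forall>z\<in>?B. F differentiable (at z)) \<and> (\<exists>C. \<forall>z\<in>?B. norm (F z) \<le> C) \<and> (\<exists>C. \<forall>z\<in>?B. norm (dd v F z) \<le> C * (1 + Q z))"
    if F: "F \<in> alg ?B (gens W h n)" and v: "v \<in> {ex, ey}" for F v
  proof (rule alg_gradient_bound[OF oB _ _ _ _ F])
    show "0 \<le> 1 + Q z" for z using Q0[of z] by simp
    fix g assume g: "g \<in> gens W h n"
    have "(\<forall>z\<in>?B. g differentiable (at z)) \<and> (\<exists>C. \<forall>z\<in>?B. norm (g z) \<le> C) \<and> (\<exists>C. \<forall>z\<in>?B. norm (dd v g z) \<le> C * (1 + Q z))"
      using g
    proof (cases rule: gens_cases)
      case (1 l)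
      have "Ck_on (Suc 0) ?B (iter_dd l h)" using 1(1) by (intro Ck_on_iter_dd Ck_on_mono[OF hB]) (auto simp: words_def)
      hence "\<forall>z\<in>?B. g differentiable (at z)" unfolding 1 using C1_onD(1) by blast
      moreover obtain C where C: "\<forall>z\<in>?B. norm (iter_dd (v # l) h z) \<le> C" using hbd[OF words_simps(2)[OF 1(1) v]] by blast
      moreover have "norm (dd v g z) \<le> \<bar>C\<bar> * (1 + Q z)" if "z \<in> ?B" for z
      proof -
        have "norm (dd v g z) \<le> \<bar>C\<bar> * 1" using bspec[OF C that] by (simp add: 1(2))
        also have "\<dots> \<le> \<bar>C\<bar> * (1 + Q z)" using Q0[of z] by (intro mult_left_mono) auto
        finally show ?thesis .
      qed
      ultimately show ?thesis using hbd[OF words_simps(3)[OF 1(1) le_SucI[OF order_refl]]] unfolding 1(2) by blast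
    next
      case (2 l w)
      have "norm (dd v g z) \<le> 1 * (1 + Q z)" for z using Qle[OF 2(1,2) v, of z] by (simp add: 2(3))
      thus ?thesis using wd[OF 2(2)] holder_bounded[OF hol[OF 2(2,1)] R(1,2)] unfolding 2(3) by blast
    next
      case (3 l w)
      have d: "(g has_derivative (\<lambda>v. cnj (dd v (iter_dd l w) z))) (at z)" if "z \<in> ?B" for z
        unfolding 3(3) by (rule bounded_linear.has_derivative[OF bounded_linear_cnj dd_works[OF wd[OF 3(2) that]]])
      have "norm (dd v g z) \<le> 1 * (1 + Q z)" if "z \<in> ?B" for z
        unfolding dd_eqI[OF d[OF that]] using Qle[OF 3(1,2) v, of z] by simp
      moreover obtain C where "\<forall>z\<in>?B. norm (iter_dd l w z) \<le> C" using holder_bounded[OF hol[OF 3(2,1)] R(1,2)] by blast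
      hence "\<forall>z\<in>?B. norm (g z) \<le> C" by (simp add: 3(3))
      ultimately show ?thesis using d differentiableI by blast
    qed
    thus "\<And>z. z \<in> ?B \<Longrightarrow> g differentiable (at z)" "\<exists>C. \<forall>z\<in>?B. norm (g z) \<le> C" "\<exists>C. \<forall>z\<in>?B. norm (dd v g z) \<le> C * (1 + Q z)"
      by blast+
  qed
  have dalg: "dbar (f i) \<in> alg ?B (gens W h n)" if "i \<in> I" for i
  proof -
    obtain l w where i: "i = (l, w)" "l \<in> words n" "w \<in> W" using \<open>i \<in> I\<close> unfolding I_def by blast
    have "dbar (iter_dd l w) \<in> alg ?B (gens W h (length l))"
      by (rule dbar_iter_dd_alg[OF oB W(2) Ck_on_SucD[OF hB] eq i(3,2)])
    moreover have "gens W h (length l) \<subseteq> gens W h n" using i(2) by (intro gens_mono) (auto simp: words_def)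
    ultimately show ?thesis unfolding i f_def by (auto intro: alg_mono)
  qed
  have "\<exists>K\<ge>0. \<forall>i\<in>I. \<forall>z\<in>?B. norm (dbar (f i) z) \<le> K * 1"
    using alg_bd[OF dalg, of _ ex] by (intro finite_common_bound fI) auto
  then obtain K1 where K1: "0 \<le> K1" "\<And>i z. i \<in> I \<Longrightarrow> z \<in> ?B \<Longrightarrow> norm (dbar (f i) z) \<le> K1" by auto
  have "\<exists>K\<ge>0. \<forall>i\<in>I \<times> {ex, ey}. \<forall>z\<in>?B. norm (dd (snd i) (dbar (f (fst i))) z) \<le> K * (1 + Q z)"
  proof (rule finite_common_bound)
    show "0 \<le> 1 + Q z" for z using Q0[of z] by simp
    fix i assume "i \<in> I \<times> {ex, ey}"
    hence "fst i \<in> I" "snd i \<in> {ex, ey}" by (auto simp only: mem_Times_iff)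
    thus "\<exists>C. \<forall>z\<in>?B. norm (dd (snd i) (dbar (f (fst i))) z) \<le> C * (1 + Q z)" using alg_bd[OF dalg] by blast
  qed (use fI in auto)
  then obtain K2 where K2: "0 \<le> K2" "\<And>i z. i \<in> I \<times> {ex, ey} \<Longrightarrow> z \<in> ?B \<Longrightarrow> norm (dd (snd i) (dbar (f (fst i))) z) \<le> K2 * (1 + Q z)" by blast
  have "\<exists>R'. 0 < R' \<and> R' \<le> R \<and> (\<forall>i\<in>I. \<forall>v\<in>{ex, ey}. holder R' (dd v (f i)))"
  proof (rule derivatives_holder[OF fI R(1,2), where Q = Q and K = "K1 + K2"])
    show "Q z = (\<Sum>i\<in>I. norm (dd ex (f i) z) + norm (dd ey (f i) z))" for z by (simp add: Q_def)
    show "0 \<le> K1 + K2" using K1 K2 by simp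
    fix i assume i: "i \<in> I"
    obtain l w where lw: "i = (l, w)" "l \<in> words n" "w \<in> W" using i unfolding I_def by blast
    show "Ck_on (Suc (Suc 0)) ?B (f i)" unfolding lw f_def using Ck_on_iter_dd[OF W(2)[OF lw(3)]] by simp
    show "holder R (f i)" unfolding lw f_def using hol[OF lw(3,2)] by simp
    fix z assume z: "z \<in> ?B"
    show "norm (dbar (f i) z) \<le> K1 + K2" using K1(2)[OF i z] K2(1) by linarith
    fix v assume v: "v \<in> {ex, ey}"
    have "norm (dd v (dbar (f i)) z) \<le> K2 * (1 + Q z)" using K2(2)[of "(i, v)" z] i v z by simp
    also have "\<dots> \<le> (K1 + K2) * (1 + Q z)" using K1(1) Q0[of z] by (intro mult_right_mono) auto
    finally show "norm (dd v (dbar (f i)) z) \<le> (K1 + K2) * (1 + Q z)" .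
  qed
  then obtain R' where R': "0 < R'" "R' \<le> R" "\<And>i v. i \<in> I \<Longrightarrow> v \<in> {ex, ey} \<Longrightarrow> holder R' (dd v (f i))" by blast
  have "holder R' (iter_dd l w)" if w: "w \<in> W" and l: "l \<in> words (Suc n)" for l w
  proof (cases l)
    case Nil
    thus ?thesis using holder_subset[OF hol[OF w words_simps(1)] R'(2)] by simp
  next
    case (Cons v k)
    hence "k \<in> words n" "v \<in> {ex, ey}" using l words_simps(4) by blast+
    thus ?thesis using R'(3)[of "(k, w)" v] w by (simp add: Cons I_def f_def)
  qed
  thus ?thesis using R' by blast
qed

proposition regularity:
  assumes R: "0 < R" "R \<le> 1/2" "R < R0" and W: "finite W" "\<And>w m. w \<in> W \<Longrightarrow> Ck_on m (ball 0 R - {0}) w"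
    and eq: "\<And>w. w \<in> W \<Longrightarrow> dbar w \<in> alg (ball 0 R - {0}) (gens W h 0)"
    and hol: "\<And>w. w \<in> W \<Longrightarrow> holder R w"
  shows "Ck_on n (ball 0 R0) h \<Longrightarrow> \<exists>R'. 0 < R' \<and> R' \<le> R \<and> (\<forall>w\<in>W. \<forall>l\<in>words n. holder R' (iter_dd l w))"
proof (induction n)
  case 0
  have "words 0 = {[]}" by (auto simp: words_def)
  thus ?case using hol R by auto
next
  case (Suc n)
  then obtain R' where R': "0 < R'" "R' \<le> R" "\<forall>w\<in>W. \<forall>l\<in>words n. holder R' (iter_dd l w)" using Ck_on_SucD by blast
  have sub: "ball 0 R' - {0} \<subseteq> ball (0::plane) R - {0}" using R'(2) by auto
  have "\<exists>R''. 0 < R'' \<and> R'' \<le> R' \<and> (\<forall>w\<in>W. \<forall>l\<in>words (Suc n). holder R'' (iter_dd l w))"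
    by (rule regularity_step[OF R'(1) _ _ W(1) Ck_on_subset[OF W(2) sub] Suc.prems alg_subset[OF eq sub]])
       (use R' R in auto)
  thus ?case using R'(2) order_trans by blast
qed

section \<open>Extension across the origin\<close>

lemma holder_limit:
  assumes "holder R f" "0 < R"
  shows "\<exists>l. (f \<longlongrightarrow> l) (at 0)"
proof -
  let ?B = "ball (0::plane) R - {0}"
  obtain \<alpha> C where 1: "0 < \<alpha>" "\<And>a b. a \<in> ?B \<Longrightarrow> b \<in> ?B \<Longrightarrow> norm (f a - f b) \<le> C * norm (a - b) powr \<alpha>"
    using assms(1) unfolding holder_def by blast
  have "uniformly_continuous_on ?B f"
    unfolding uniformly_continuous_on_def
  proof (intro allI impI)
    fix e :: real assume e: "0 < e"
    define d where "d = (e / (\<bar>C\<bar> + 1)) powr (1 / \<alpha>)"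
    have "norm (f b - f a) < e" if ab: "a \<in> ?B" "b \<in> ?B" "norm (b - a) < d" for a b
    proof -
      have "norm (b - a) powr \<alpha> \<le> d powr \<alpha>" using ab 1 by (intro powr_mono2) auto
      also have "d powr \<alpha> = e / (\<bar>C\<bar> + 1)" using e 1 by (simp add: d_def powr_powr)
      finally have p: "norm (b - a) powr \<alpha> \<le> e / (\<bar>C\<bar> + 1)" .
      have "norm (f b - f a) \<le> C * norm (b - a) powr \<alpha>" by (rule 1(2)[OF ab(2,1)])
      also have "\<dots> \<le> \<bar>C\<bar> * (e / (\<bar>C\<bar> + 1))" using p by (intro mult_mono) auto
      also have "\<dots> < (\<bar>C\<bar> + 1) * (e / (\<bar>C\<bar> + 1))" using e by (intro mult_strict_right_mono) auto
      also have "\<dots> = e" by simp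
      finally show ?thesis .
    qed
    moreover have "0 < d" using e by (simp add: d_def)
    ultimately show "\<exists>d>0. \<forall>x\<in>?B. \<forall>x'\<in>?B. dist x' x < d \<longrightarrow> dist (f x') (f x) < e"
      unfolding dist_norm by blast
  qed
  then obtain g where g: "uniformly_continuous_on (closure ?B) g" "\<And>x. x \<in> ?B \<Longrightarrow> f x = g x"
    using uniformly_continuous_on_extension_on_closure by metis
  have 0: "0 \<in> closure ?B"
    unfolding closure_approachable
  proof (intro allI impI)
    fix e :: real assume "0 < e"
    thus "\<exists>y\<in>?B. dist y 0 < e" using assms(2)
      by (intro bexI[of _ "(min e R / 2, 0)"]) (auto simp: norm_first_axis prod_eq_iff)
  qed
  have "(g \<longlongrightarrow> g 0) (at 0 within closure ?B)"
    using uniformly_continuous_imp_continuous[OF g(1)] 0 by (auto simp: continuous_on_def)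
  hence "(g \<longlongrightarrow> g 0) (at 0 within ?B)" by (rule tendsto_within_subset) (rule closure_subset)
  hence "(f \<longlongrightarrow> g 0) (at 0 within ?B)"
    by (rule Lim_transform_within[where d = R]) (use assms g(2) in auto)
  moreover have "at (0::plane) within ?B = at 0"
    using at_within_open[of "0::plane" "ball 0 R"] assms(2) by (simp add: at_within_def Diff_eq Int_ac)
  ultimately show ?thesis by auto
qed

text \<open>The value at the origin is replaced by the limit; this is meaningful only if the limit exists.\<close>

definition extend :: "(plane \<Rightarrow> complex) \<Rightarrow> plane \<Rightarrow> complex" where
  "extend f z = (if z = 0 then Lim (at 0) f else f z)"

lemma extend_tendsto:
  assumes "\<exists>l. (f \<longlongrightarrow> l) (at (0::plane))"
  shows "(f \<longlongrightarrow> extend f 0) (at 0)"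
proof -
  obtain l where l: "(f \<longlongrightarrow> l) (at 0)" using assms by blast
  have "extend f 0 = l" unfolding extend_def using tendsto_Lim[OF _ l] by simp
  thus ?thesis using l by simp
qed

lemma extend_continuous:
  assumes S: "open S" and f: "continuous_on (S - {0}) f" and l: "\<exists>l. (f \<longlongrightarrow> l) (at (0::plane))"
  shows "continuous_on S (extend f)"
  unfolding continuous_on_eq_continuous_at[OF S]
proof
  fix z assume z: "z \<in> S"
  show "isCont (extend f) z"
  proof (cases "z = 0")
    case True
    have "(extend f \<longlongrightarrow> extend f 0) (at 0)"
      using extend_tendsto[OF l]
      by (rule Lim_transform_eventually) (auto simp: extend_def eventually_at intro!: exI[of _ 1])
    thus ?thesis using True by (simp add: isCont_def)
  next
    case False
    have "isCont f z" using f z False S by (simp add: continuous_on_eq_continuous_at open_delete)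
    moreover have "\<forall>\<^sub>F x in nhds z. f x = extend f x"
      using t1_space_nhds[OF False] by eventually_elim (simp add: extend_def)
    ultimately show ?thesis using isCont_cong by blast
  qed
qed

lemma extend_dd:
  assumes "z \<noteq> 0" "f differentiable (at z)"
  shows "extend f differentiable (at z)" "dd v (extend f) z = dd v f z"
proof -
  have o: "open (- {0::plane})" by (simp add: open_Compl)
  have e: "f x = extend f x" if "x \<in> - {0}" for x using that by (simp add: extend_def)
  show "extend f differentiable (at z)" by (rule differentiable_cong_open[OF o _ e]) (use assms in auto)
  show "dd v (extend f) z = dd v f z" by (rule dd_cong[OF o, symmetric]) (use assms e in auto)
qed

text \<open>The mean value inequality on the segment from the origin to \<open>y\<close>, which needs the derivative only in the
  interior of the segment.\<close>

lemma extend_has_derivative: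
  assumes S: "open S" "0 \<in> S" and f: "C1_on (S - {0}) f" and l: "\<exists>l. (f \<longlongrightarrow> l) (at 0)"
    and lx: "(dd ex f \<longlongrightarrow> a) (at 0)" and ly: "(dd ey f \<longlongrightarrow> b) (at 0)"
  shows "(extend f has_derivative (\<lambda>h. fst h *\<^sub>R a + snd h *\<^sub>R b)) (at 0)"
  unfolding has_derivative_at_alt
proof (intro conjI allI impI)
  define L where "L = (\<lambda>h::plane. fst h *\<^sub>R a + snd h *\<^sub>R b)"
  show "bounded_linear (\<lambda>h. fst h *\<^sub>R a + snd h *\<^sub>R b)"
    by (intro bounded_linear_add bounded_linear_compose[OF bounded_linear_scaleR_left] bounded_linear_fst bounded_linear_snd)
  fix e :: real assume e: "0 < e"
  obtain r where r: "0 < r" "ball 0 r \<subseteq> S" using S open_contains_ball by blast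
  have "\<forall>\<^sub>F z in at 0. dist (dd ex f z) a < e / 2" "\<forall>\<^sub>F z in at 0. dist (dd ey f z) b < e / 2"
    using tendstoD[OF lx half_gt_zero[OF e]] tendstoD[OF ly half_gt_zero[OF e]] .
  hence "\<forall>\<^sub>F z in at 0. dist (dd ex f z) a < e / 2 \<and> dist (dd ey f z) b < e / 2" by (rule eventually_conj)
  then obtain d' where d': "0 < d'" "\<And>z. z \<noteq> 0 \<Longrightarrow> norm z < d' \<Longrightarrow> dist (dd ex f z) a < e / 2 \<and> dist (dd ey f z) b < e / 2"
    unfolding eventually_at by (auto simp del: split_paired_All)
  have cont: "continuous_on S (extend f)" by (rule extend_continuous[OF S(1) C1_on_continuous[OF f] l])
  show "\<exists>d>0. \<forall>y. norm (y - 0) < d \<longrightarrow> norm (extend f y - extend f 0 - (fst (y - 0) *\<^sub>R a + snd (y - 0) *\<^sub>R b)) \<le> e * norm (y - 0)"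
  proof (intro exI conjI allI impI)
    show "0 < min r d'" using r d' by simp
    fix y :: plane assume "norm (y - 0) < min r d'"
    hence y: "norm y < r" "norm y < d'" by auto
    have "norm (extend f y - extend f 0 - L y) \<le> e * norm y"
    proof (cases "y = 0")
      case False
      have pt: "s *\<^sub>R y \<in> S" "norm (s *\<^sub>R y) < d'" if "0 \<le> s" "s \<le> 1" for s
      proof -
        have "norm (s *\<^sub>R y) \<le> norm y" using that by (simp add: mult_left_le_one_le)
        thus "s *\<^sub>R y \<in> S" "norm (s *\<^sub>R y) < d'" using y r by auto
      qed
      define \<phi> where "\<phi> = (\<lambda>s. extend f (0 + s *\<^sub>R y) - s *\<^sub>R L y)"
      have "norm (\<phi> 1 - \<phi> 0) \<le> (e * norm y) * 1 - (e * norm y) * 0"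
      proof (rule differentiable_bound_general[where f' = "\<lambda>s. dd y (extend f) (0 + s *\<^sub>R y) - L y" and \<phi> = "\<lambda>s. (e * norm y) * s" and \<phi>' = "\<lambda>s. e * norm y"])
        show "continuous_on {0..1} \<phi>"
          unfolding \<phi>_def by (intro continuous_intros continuous_on_compose2[OF cont]) (use pt in auto)
        fix s :: real assume s: "0 < s" "s < 1"
        have nz: "s *\<^sub>R y \<noteq> 0" using s False by simp
        have df: "f differentiable (at (s *\<^sub>R y))" using C1_onD(1)[OF f] pt(1)[of s] nz s by simp
        have "((\<lambda>s. s *\<^sub>R L y) has_vector_derivative L y) (at s)" by (auto intro!: derivative_eq_intros)
        moreover have "((\<lambda>s. extend f (0 + s *\<^sub>R y)) has_vector_derivative dd y (extend f) (0 + s *\<^sub>R y)) (at s)"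
          by (rule line_derivative) (use extend_dd(1)[OF nz df] in simp)
        ultimately show "(\<phi> has_vector_derivative (dd y (extend f) (0 + s *\<^sub>R y) - L y)) (at s)"
          unfolding \<phi>_def by (intro has_vector_derivative_diff)
        show "((\<lambda>s. (e * norm y) * s) has_vector_derivative e * norm y) (at s)" by (auto intro!: derivative_eq_intros)
        have "dd y (extend f) (0 + s *\<^sub>R y) - L y = fst y *\<^sub>R (dd ex f (s *\<^sub>R y) - a) + snd y *\<^sub>R (dd ey f (s *\<^sub>R y) - b)"
          using extend_dd(2)[OF nz df, of y] trans[OF refl dd_decomp[OF df, of y]] by (simp add: L_def scaleR_diff_right)
        also have "norm \<dots> \<le> \<bar>fst y\<bar> * norm (dd ex f (s *\<^sub>R y) - a) + \<bar>snd y\<bar> * norm (dd ey f (s *\<^sub>R y) - b)"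
          by (rule order_trans[OF norm_triangle_ineq]) simp
        also have "\<dots> \<le> norm y * (e / 2) + norm y * (e / 2)"
          using d'(2)[OF nz pt(2)[of s]] s abs_coord_le_norm[of y] by (intro add_mono mult_mono) (auto simp: dist_norm)
        finally show "norm (dd y (extend f) (0 + s *\<^sub>R y) - L y) \<le> e * norm y" by (simp add: mult.commute)
      qed (auto intro!: continuous_intros)
      moreover have "\<phi> 1 - \<phi> 0 = extend f y - extend f 0 - L y" by (simp add: \<phi>_def)
      ultimately show ?thesis by simp
    qed (simp add: L_def)
    thus "norm (extend f y - extend f 0 - (fst (y - 0) *\<^sub>R a + snd (y - 0) *\<^sub>R b)) \<le> e * norm (y - 0)" by (simp add: L_def)
  qed
qed

proposition extend_Ck_on:
  assumes S: "open S" "0 \<in> S"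
  shows "Ck_on n (S - {0}) f \<Longrightarrow> (\<And>l. l \<in> words n \<Longrightarrow> \<exists>L. (iter_dd l f \<longlongrightarrow> L) (at 0)) \<Longrightarrow> Ck_on n S (extend f)"
proof (induction n arbitrary: f)
  case 0
  thus ?case using extend_continuous[OF S(1), of f] 0(2)[OF words_simps(1)] by simp
next
  case (Suc n)
  have C1: "C1_on (S - {0}) f" by (rule Ck_on_mono[OF Suc.prems(1)]) simp
  have df: "f differentiable (at z)" if "z \<in> S" "z \<noteq> 0" for z using C1_onD(1)[OF C1] that by simp
  have lim: "\<exists>l. (f \<longlongrightarrow> l) (at 0)" using Suc.prems(2)[OF words_simps(1)] by simp
  have limd: "(dd v f \<longlongrightarrow> extend (dd v f) 0) (at 0)" if v: "v \<in> {ex, ey}" for v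
  proof (rule extend_tendsto)
    show "\<exists>l. (dd v f \<longlongrightarrow> l) (at 0)"
      using Suc.prems(2)[of "[v]"] v by (auto simp: words_def)
  qed
  have hdv: "Ck_on n S (extend (dd v f))" if v: "v \<in> {ex, ey}" for v
  proof (rule Suc.IH)
    show "Ck_on n (S - {0}) (dd v f)" using Suc.prems(1) unfolding Ck_on_Suc by blast
    fix l assume l: "l \<in> words n"
    hence "l @ [v] \<in> words (Suc n)" using v by (auto simp: words_def)
    from Suc.prems(2)[OF this] show "\<exists>L. (iter_dd l (dd v f) \<longlongrightarrow> L) (at 0)" by (simp add: iter_dd_append)
  qed
  have d0: "(extend f has_derivative (\<lambda>h. fst h *\<^sub>R extend (dd ex f) 0 + snd h *\<^sub>R extend (dd ey f) 0)) (at 0)"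
    by (rule extend_has_derivative[OF S C1 lim limd limd]) auto
  have eq: "extend (dd v f) z = dd v (extend f) z" if "v \<in> {ex, ey}" "z \<in> S" for v z
  proof (cases "z = 0")
    case True
    thus ?thesis using dd_eqI[OF d0, of v] that(1) by auto
  next
    case False
    thus ?thesis using extend_dd(2)[OF False df[OF that(2) False], of v] by (simp add: extend_def)
  qed
  show ?case
  proof (rule Ck_on_basisI[OF S(1)])
    fix z assume z: "z \<in> S"
    show "extend f differentiable (at z)"
      using d0 differentiableI extend_dd(1)[OF _ df[OF z]] by (cases "z = 0") blast+
  next
    show "Ck_on n S (dd ex (extend f))" by (rule Ck_on_cong[OF S(1) hdv[of ex] eq]) simp_all
    show "Ck_on n S (dd ey (extend f))" by (rule Ck_on_cong[OF S(1) hdv[of ey] eq]) simp_all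
  qed
qed

section \<open>From finite energy to Hoelder continuity\<close>

lemma small_mass:
  fixes f :: "plane \<Rightarrow> real"
  assumes R: "0 < R" and f: "continuous_on (ball 0 R - {0}) f" "\<And>z. 0 \<le> f z"
    and fin: "(\<integral>\<^sup>+z. ennreal (f z) * indicator (ball 0 R - {0}) z \<partial>lborel) < \<infinity>" and e: "0 < e"
  shows "\<exists>r. 0 < r \<and> r \<le> R \<and> (\<integral>\<^sup>+z. ennreal (f z) * indicator (ball 0 r - {0}) z \<partial>lborel) \<le> ennreal e"
proof -
  define F where "F = (\<lambda>z. ennreal (f z) * indicator (ball 0 R - {0}) z)"
  have mF[measurable]: "F \<in> borel_measurable borel"
  proof -
    have "(\<lambda>z. indicator (ball 0 R - {0}) z *\<^sub>R f z) \<in> borel_measurable borel"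
      by (intro borel_measurable_continuous_on_indicator f) auto
    hence "(\<lambda>z. ennreal (indicator (ball 0 R - {0}) z *\<^sub>R f z)) \<in> borel_measurable borel" by simp
    also have "(\<lambda>z. ennreal (indicator (ball 0 R - {0}) z *\<^sub>R f z)) = F"
      by (rule ext) (simp add: F_def indicator_def)
    finally show ?thesis .
  qed
  define r where "r = (\<lambda>n. R / real (Suc n))"
  have r: "0 < r n" "r n \<le> R" for n using R by (auto simp: r_def field_simps)
  have r0: "r \<longlonglongrightarrow> 0" unfolding r_def by (rule LIMSEQ_Suc) (rule lim_const_over_n)
  have "(\<lambda>n. \<integral>\<^sup>+z. F z * indicator (ball 0 (r n)) z \<partial>lborel) \<longlonglongrightarrow> (\<integral>\<^sup>+z. 0 \<partial>(lborel :: plane measure))"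
  proof (rule nn_integral_dominated_convergence[where w = F])
    show "AE z in lborel. (\<lambda>n. F z * indicator (ball 0 (r n)) z) \<longlonglongrightarrow> 0"
    proof (rule AE_I2)
      fix z :: plane
      show "(\<lambda>n. F z * indicator (ball 0 (r n)) z) \<longlonglongrightarrow> 0"
      proof (cases "z = 0")
        case False
        hence "\<forall>\<^sub>F n in sequentially. r n < norm z" using order_tendstoD(2)[OF r0] by simp
        hence "\<forall>\<^sub>F n in sequentially. 0 = F z * indicator (ball 0 (r n)) z"
          by eventually_elim (simp add: indicator_def)
        thus ?thesis by (rule Lim_transform_eventually[OF tendsto_const])
      qed (simp add: F_def)
    qed
    show "(\<integral>\<^sup>+z. F z \<partial>lborel) < \<infinity>" using fin by (simp add: F_def)
    show "AE z in lborel. F z * indicator (ball 0 (r n)) z \<le> F z" for n by (intro AE_I2) (simp add: indicator_def)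
    show "(\<lambda>z. F z * indicator (ball 0 (r n)) z) \<in> borel_measurable lborel" for n
      by (intro borel_measurable_times_ennreal borel_measurable_indicator) auto
  qed simp_all
  hence "\<forall>\<^sub>F n in sequentially. (\<integral>\<^sup>+z. F z * indicator (ball 0 (r n)) z \<partial>lborel) < ennreal e"
    using e by (intro order_tendstoD(2)) auto
  then obtain n where n: "(\<integral>\<^sup>+z. F z * indicator (ball 0 (r n)) z \<partial>lborel) < ennreal e"
    by (auto dest!: eventually_happens)
  have "(\<integral>\<^sup>+z. ennreal (f z) * indicator (ball 0 (r n) - {0}) z \<partial>lborel) = (\<integral>\<^sup>+z. F z * indicator (ball 0 (r n)) z \<partial>lborel)"
    using r(2)[of n] by (intro nn_integral_cong) (auto simp: F_def indicator_def)
  thus ?thesis using n r by (intro exI[of _ "r n"]) auto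
qed

text \<open>The energy of small punctured disks tends to zero, so \<open>eps_regularity\<close>, \<open>critical_decay\<close> and
  \<open>holder_punctured\<close> apply in turn.\<close>

proposition removable_holder:
  assumes A: "0 < A" and R0: "0 < R0" and w: "C1_on (ball 0 R0 - {0}) w1" "C1_on (ball 0 R0 - {0}) w2"
    and d: "\<And>z. z \<in> ball 0 R0 - {0} \<Longrightarrow> norm (dbar w1 z) \<le> A * (norm (w1 z) + norm (w2 z)) ^ 3"
      "\<And>z. z \<in> ball 0 R0 - {0} \<Longrightarrow> norm (dbar w2 z) \<le> A * (norm (w1 z) + norm (w2 z)) ^ 3"
    and fin: "(\<integral>\<^sup>+z. ennreal ((norm (w1 z) + norm (w2 z)) ^ 4) * indicator (ball 0 R0 - {0}) z \<partial>lborel) < \<infinity>"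
  shows "\<exists>R. 0 < R \<and> R \<le> 1/2 \<and> R < R0 \<and> holder R w1 \<and> holder R w2"
proof -
  define q where "q = (\<lambda>z. norm (w1 z) + norm (w2 z))"
  have q0: "0 \<le> q z" for z by (simp add: q_def)
  have qc: "continuous_on (ball 0 R0 - {0}) q" unfolding q_def by (intro continuous_intros C1_on_continuous w)
  obtain C \<eta> where C: "0 < C" "0 < \<eta>"
    and reg: "\<And>w1 w2 S z0 \<rho> e. \<lbrakk>open S; cball z0 \<rho> \<subseteq> S; 0 < \<rho>; C1_on S w1; C1_on S w2;
       \<And>z. z \<in> cball z0 \<rho> \<Longrightarrow> norm (dbar w1 z) \<le> A * (norm (w1 z) + norm (w2 z)) ^ 3;
       \<And>z. z \<in> cball z0 \<rho> \<Longrightarrow> norm (dbar w2 z) \<le> A * (norm (w1 z) + norm (w2 z)) ^ 3;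
       (\<integral>\<^sup>+z. ennreal ((norm (w1 z) + norm (w2 z)) ^ 4) * indicator (cball z0 \<rho>) z \<partial>lborel) \<le> ennreal e;
       0 \<le> e; e \<le> \<eta>\<rbrakk> \<Longrightarrow> (norm (w1 z0) + norm (w2 z0)) ^ 4 * \<rho>\<^sup>2 \<le> C * e"
    using eps_regularity[OF A] by blast
  obtain \<kappa> where \<kappa>: "0 < \<kappa>"
    and crit: "\<And>w1 w2 R K. \<lbrakk>0 < R; R \<le> 1; C1_on (ball 0 R - {0}) w1; C1_on (ball 0 R - {0}) w2;
       \<And>z. z \<in> ball 0 R - {0} \<Longrightarrow> norm (w1 z) + norm (w2 z) \<le> K * norm z powr (-(1/2));
       \<And>z. z \<in> ball 0 R - {0} \<Longrightarrow> norm (dbar w1 z) \<le> \<kappa> / norm z * (norm (w1 z) + norm (w2 z));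
       \<And>z. z \<in> ball 0 R - {0} \<Longrightarrow> norm (dbar w2 z) \<le> \<kappa> / norm z * (norm (w1 z) + norm (w2 z))\<rbrakk>
      \<Longrightarrow> \<exists>N R'. 0 < R' \<and> R' \<le> R \<and> (\<forall>z\<in>ball 0 R' - {0}. norm (w1 z) + norm (w2 z) \<le> N * norm z powr (-(1/4)))"
    using critical_decay by blast
  \<comment> \<open>An energy at which the pointwise bound makes \<open>A q\<^sup>2 \<le> \<kappa> / |z|\<close>.\<close>
  define e where "e = min \<eta> (\<kappa>\<^sup>2 / (4 * A\<^sup>2 * C))"
  have e: "0 < e" "e \<le> \<eta>" "4 * A\<^sup>2 * (C * e) \<le> \<kappa>\<^sup>2"
  proof -
    show "0 < e" "e \<le> \<eta>" using C \<kappa> A by (auto simp: e_def)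
    have "e \<le> \<kappa>\<^sup>2 / (4 * A\<^sup>2 * C)" by (simp add: e_def)
    thus "4 * A\<^sup>2 * (C * e) \<le> \<kappa>\<^sup>2" using C A by (simp add: pos_le_divide_eq mult_ac)
  qed
  obtain r where r: "0 < r" "r \<le> R0" and mass: "(\<integral>\<^sup>+z. ennreal (q z ^ 4) * indicator (ball 0 r - {0}) z \<partial>lborel) \<le> ennreal e"
  proof -
    have c: "continuous_on (ball 0 R0 - {0}) (\<lambda>z. q z ^ 4)" by (intro continuous_intros qc)
    have "\<exists>r. 0 < r \<and> r \<le> R0 \<and> (\<integral>\<^sup>+z. ennreal (q z ^ 4) * indicator (ball 0 r - {0}) z \<partial>lborel) \<le> ennreal e"
      by (rule small_mass[OF R0 c _ _ e(1)]) (use fin q0 in \<open>simp_all add: q_def\<close>)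
    thus ?thesis using that by blast
  qed
  have pt: "A * (q z)\<^sup>2 * norm z \<le> \<kappa>" if z: "z \<in> ball 0 (r/2) - {0}" for z
  proof -
    define \<rho> where "\<rho> = norm z / 2"
    have zn: "0 < norm z" "norm z < r / 2" using z by auto
    have \<rho>: "0 < \<rho>" "norm z = 2 * \<rho>" using zn by (auto simp: \<rho>_def)
    have sub: "cball z \<rho> \<subseteq> ball 0 r - {0}"
    proof
      fix y assume "y \<in> cball z \<rho>"
      hence "norm (z - y) \<le> \<rho>" by (simp add: dist_norm)
      moreover have "norm y \<le> norm z + norm (z - y)" using norm_triangle_sub[of y z] by (simp add: norm_minus_commute)
      moreover have "norm z \<le> norm y + norm (z - y)" using norm_triangle_sub[of z y] by simp
      ultimately have "0 < norm y" "norm y < r" using zn \<rho> by linarith+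
      thus "y \<in> ball 0 r - {0}" by simp
    qed
    have sub0: "ball 0 r - {0} \<subseteq> ball (0::plane) R0 - {0}" using r by auto
    have dz: "norm (dbar w1 y) \<le> A * (norm (w1 y) + norm (w2 y)) ^ 3" "norm (dbar w2 y) \<le> A * (norm (w1 y) + norm (w2 y)) ^ 3" if "y \<in> cball z \<rho>" for y
      using d[OF subsetD[OF sub0 subsetD[OF sub that]]] .
    have "(\<integral>\<^sup>+y. ennreal (q y ^ 4) * indicator (cball z \<rho>) y \<partial>lborel) \<le> (\<integral>\<^sup>+y. ennreal (q y ^ 4) * indicator (ball 0 r - {0}) y \<partial>lborel)"
      by (intro nn_integral_mono mult_left_mono indicator_leI) (rule subsetD[OF sub], assumption, simp)
    also have "\<dots> \<le> ennreal e" by (rule mass)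
    finally have "(\<integral>\<^sup>+y. ennreal ((norm (w1 y) + norm (w2 y)) ^ 4) * indicator (cball z \<rho>) y \<partial>lborel) \<le> ennreal e"
      by (simp only: q_def)
    hence "q z ^ 4 * \<rho>\<^sup>2 \<le> C * e"
      unfolding q_def
      by (intro reg[of "ball 0 r - {0}" z \<rho> w1 w2 e] sub \<rho>(1) Ck_on_subset[OF w(1) sub0] Ck_on_subset[OF w(2) sub0] dz e(2) less_imp_le[OF e(1)]) auto
    hence "4 * A\<^sup>2 * (q z ^ 4 * \<rho>\<^sup>2) \<le> 4 * A\<^sup>2 * (C * e)" by (intro mult_left_mono) auto
    also have "\<dots> \<le> \<kappa>\<^sup>2" by (rule e(3))
    also have "4 * A\<^sup>2 * (q z ^ 4 * \<rho>\<^sup>2) = (A * (q z)\<^sup>2 * norm z)\<^sup>2"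
      unfolding \<rho>(2) by (simp add: power_mult_distrib power2_eq_square power4_eq_xxxx)
    finally show ?thesis by (rule power2_le_imp_le) (use \<kappa> in auto)
  qed
  define R where "R = min (r / 2) (1 / 2)"
  have R: "0 < R" "R \<le> 1/2" "R \<le> r / 2" "R < R0" using r by (auto simp: R_def min_def)
  have subR: "ball 0 R - {0} \<subseteq> ball (0::plane) R0 - {0}" using R by auto
  have crit_d: "A * (q z) ^ 3 \<le> \<kappa> / norm z * q z" if z: "z \<in> ball 0 R - {0}" for z
  proof -
    have "A * (q z)\<^sup>2 * norm z \<le> \<kappa>" using z R by (intro pt) auto
    hence "A * (q z)\<^sup>2 \<le> \<kappa> / norm z" using z by (simp add: pos_le_divide_eq)
    from mult_right_mono[OF this q0[of z]] show ?thesis by (simp add: power2_eq_square power3_eq_cube mult_ac)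
  qed
  have "\<exists>N R'. 0 < R' \<and> R' \<le> R \<and> (\<forall>z\<in>ball 0 R' - {0}. norm (w1 z) + norm (w2 z) \<le> N * norm z powr (-(1/4)))"
  proof (rule crit[OF R(1)])
    show "R \<le> 1" using R by simp
    show "C1_on (ball 0 R - {0}) w1" "C1_on (ball 0 R - {0}) w2" using Ck_on_subset[OF w(1) subR] Ck_on_subset[OF w(2) subR] .
    fix z :: plane assume z: "z \<in> ball 0 R - {0}"
    show "norm (dbar w1 z) \<le> \<kappa> / norm z * (norm (w1 z) + norm (w2 z))"
      using order_trans[OF d(1)[OF subsetD[OF subR z]] crit_d[OF z, unfolded q_def]] .
    show "norm (dbar w2 z) \<le> \<kappa> / norm z * (norm (w1 z) + norm (w2 z))"
      using order_trans[OF d(2)[OF subsetD[OF subR z]] crit_d[OF z, unfolded q_def]] .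
    have zn: "0 < norm z" using z by simp
    have "A * (q z)\<^sup>2 * norm z \<le> \<kappa>" using z R by (intro pt) auto
    hence "(q z)\<^sup>2 \<le> \<kappa> / A / norm z" using zn A by (simp add: pos_le_divide_eq mult_ac)
    also have "\<dots> = (sqrt (\<kappa> / A) * norm z powr (-(1/2)))\<^sup>2"
    proof -
      have "(norm z powr (-(1/2)))\<^sup>2 = norm z powr (-1)" by (simp add: power2_eq_square powr_add[symmetric])
      also have "\<dots> = 1 / norm z" using zn by (simp add: powr_minus_divide)
      finally have "(norm z powr (-(1/2)))\<^sup>2 = 1 / norm z" .
      moreover have "0 \<le> \<kappa> / A" using \<kappa> A by simp
      ultimately show ?thesis by (simp add: power_mult_distrib)
    qed
    finally have "q z \<le> sqrt (\<kappa> / A) * norm z powr (-(1/2))" by (rule power2_le_imp_le) (use \<kappa> A in auto)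
    thus "norm (w1 z) + norm (w2 z) \<le> sqrt (\<kappa> / A) * norm z powr (-(1/2))" by (simp add: q_def)
  qed
  then obtain N R' where R': "0 < R'" "R' \<le> R" and N: "\<And>z. z \<in> ball 0 R' - {0} \<Longrightarrow> q z \<le> N * norm z powr (-(1/4))"
    unfolding q_def by blast
  have subR': "ball 0 R' - {0} \<subseteq> ball (0::plane) R0 - {0}" using R' R by auto
  define K where "K = \<bar>N\<bar> + A * \<bar>N\<bar> ^ 3"
  have K: "\<bar>N\<bar> \<le> K" "A * \<bar>N\<bar> ^ 3 \<le> K" using A by (auto simp: K_def)
  have hol: "holder (R' / 4) w" if wC: "C1_on (ball 0 R0 - {0}) w" and wq: "\<And>z. norm (w z) \<le> q z"
    and wd: "\<And>z. z \<in> ball 0 R0 - {0} \<Longrightarrow> norm (dbar w z) \<le> A * (q z) ^ 3" for w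
  proof -
    obtain X where X: "\<And>a b. a \<in> ball 0 (R'/4) - {0} \<Longrightarrow> b \<in> ball 0 (R'/4) - {0} \<Longrightarrow> norm (w a - w b) \<le> X * norm (a - b) powr (1/8)"
    proof (rule holder_punctured[of R' "3/4" "1/8" w K])
      show "C1_on (ball 0 R' - {0}) w" by (rule Ck_on_subset[OF wC subR'])
      fix z :: plane assume z: "z \<in> ball 0 R' - {0}"
      have zn: "0 < norm z" "norm z \<le> 1" using z R' R by auto
      have "q z \<le> N * norm z powr (-(1/4))" by (rule N[OF z])
      also have "\<dots> \<le> \<bar>N\<bar> * norm z powr (-(1/4))" by (intro mult_right_mono) auto
      finally have qN: "q z \<le> \<bar>N\<bar> * norm z powr (-(1/4))" .
      also have "\<dots> \<le> K * norm z powr (-(3/4))" using zn K by (intro mult_mono powr_mono') auto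
      finally show "norm (w z) \<le> K * norm z powr (-(3/4))" using wq[of z] by linarith
      have "norm (dbar w z) \<le> A * (q z) ^ 3" by (rule wd[OF subsetD[OF subR' z]])
      also have "\<dots> \<le> A * (\<bar>N\<bar> * norm z powr (-(1/4))) ^ 3" using A qN q0 by (intro mult_left_mono power_mono) auto
      also have "\<dots> = A * \<bar>N\<bar> ^ 3 * (norm z powr (-(1/4))) ^ 3" by (simp add: power_mult_distrib)
      also have "(norm z powr (-(1/4))) ^ 3 = norm z powr (-(3/4))" using zn by (simp add: powr_power)
      also have "A * \<bar>N\<bar> ^ 3 * norm z powr (-(3/4)) \<le> K * norm z powr (-(3/4))" using K by (intro mult_right_mono) auto
      finally show "norm (dbar w z) \<le> K * norm z powr (-(3/4))" .
    qed (use R' R in auto)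
    show ?thesis unfolding holder_def by (intro exI[of _ "1/8"] exI[of _ X] conjI ballI X) auto
  qed
  have "holder (R' / 4) w1" "holder (R' / 4) w2"
    using hol[OF w(1)] hol[OF w(2)] d by (auto simp: q_def)
  thus ?thesis using R R' by (intro exI[of _ "R' / 4"]) auto
qed


section \<open>The Dirac equation\<close>

text \<open>The common shape of the six potentials, with \<open>h\<close> the value of \<open>H\<close> and \<open>s\<close> that of the spinor.\<close>

definition quad :: "complex \<Rightarrow> complex \<Rightarrow> potential" where
  "quad c d h s = - of_real h * of_real ((norm s)\<^sup>2) + c * of_real ((norm (s $ 1))\<^sup>2) + d * of_real ((norm (s $ 2))\<^sup>2)"

lemma norm_spinor_sq: "(norm (s :: spinor))\<^sup>2 = (norm (s $ 1))\<^sup>2 + (norm (s $ 2))\<^sup>2"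
  by (simp add: norm_vec_def L2_set_def UNIV_2)

lemma potentials_quad:
  assumes "(U, V) \<in> {(U_SU2, V_SU2), (U_Nil, V_Nil), (U_SL2, V_SL2)}"
  shows "\<exists>a b c d. U = quad a b \<and> V = quad c d"
proof -
  have "U_SU2 = quad \<i> \<i>" "V_SU2 = quad (- \<i>) (- \<i>)"
    "U_Nil = quad (- \<i> / 2) (\<i> / 2)" "V_Nil = quad (- \<i> / 2) (\<i> / 2)"
    "U_SL2 = quad \<i> (- 3 / 2 * \<i>)" "V_SL2 = quad (3 / 2 * \<i>) (- \<i>)"
    by (intro ext; simp add: U_SU2_def V_SU2_def U_Nil_def V_Nil_def U_SL2_def V_SL2_def quad_def norm_spinor_sq complex_eq_iff algebra_simps)+
  thus ?thesis using assms by blast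
qed

lemma Gamma_simps:
  "Gamma_plus s $ 1 = 0" "Gamma_plus s $ 2 = s $ 2" "Gamma_minus s $ 1 = s $ 1" "Gamma_minus s $ 2 = 0"
  by (simp_all add: Gamma_plus_def Gamma_minus_def chirality_def sigma1_def sigma2_def matrix_vector_mult_def sum_2 vector_2 vector_def)

lemma dbar_cnj:
  assumes "f differentiable (at z)"
  shows "dbar (\<lambda>z. cnj (f z)) z = cnj ((dd ex f z - \<i> * dd ey f z) / 2)"
  by (simp add: dbar_def dd_linear[OF assms bounded_linear_cnj])

text \<open>The first component of the Dirac operator is \<open>2 dbar \<phi>\<^sub>2\<close> and the second is \<open>- 2 \<partial> \<phi>\<^sub>1\<close>, where \<open>\<partial>\<close> is conjugate to
  \<open>dbar\<close>.  Conjugating the first component of the spinor therefore turns both equations into \<open>dbar\<close>-equations.\<close>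

lemma Dirac_eq:
  assumes "\<phi> differentiable (at p)"
  shows "Dirac \<phi> p = U *s Gamma_plus s + V *s Gamma_minus s \<longleftrightarrow>
    dbar (\<lambda>z. cnj (\<phi> z $ 1)) p = - (1/2) * cnj U * cnj (s $ 2) \<and> dbar (\<lambda>z. \<phi> z $ 2) p = (1/2) * V * (s $ 1)"
proof -
  have d: "dd v \<phi> p $ i = dd v (\<lambda>z. \<phi> z $ i) p" for v i by (simp add: dd_linear[OF assms bounded_linear_vec_nth])
  have di: "(\<lambda>z. \<phi> z $ i) differentiable (at p)" for i
    using bounded_linear.has_derivative[OF bounded_linear_vec_nth dd_works[OF assms]] differentiableI by blast
  have 1: "Dirac \<phi> p $ 1 = 2 * dbar (\<lambda>z. \<phi> z $ 2) p"
    by (simp add: Dirac_def sigma1_def sigma2_def partial_x_dd partial_y_dd matrix_vector_mult_def sum_2 vector_2 vector_def d dbar_def)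
  have 2: "Dirac \<phi> p $ 2 = - 2 * cnj (dbar (\<lambda>z. cnj (\<phi> z $ 1)) p)"
    unfolding dbar_cnj[OF di]
    by (simp add: Dirac_def sigma1_def sigma2_def partial_x_dd partial_y_dd matrix_vector_mult_def sum_2 vector_2 vector_def d)
  have "Dirac \<phi> p = U *s Gamma_plus s + V *s Gamma_minus s \<longleftrightarrow>
     2 * dbar (\<lambda>z. \<phi> z $ 2) p = V * s $ 1 \<and> - 2 * cnj (dbar (\<lambda>z. cnj (\<phi> z $ 1)) p) = U * s $ 2"
    by (simp add: vec_eq_iff forall_2 1 2 Gamma_simps)
  also have "- 2 * cnj (dbar (\<lambda>z. cnj (\<phi> z $ 1)) p) = U * s $ 2 \<longleftrightarrow> dbar (\<lambda>z. cnj (\<phi> z $ 1)) p = - (1/2) * cnj U * cnj (s $ 2)"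
  proof
    assume "- 2 * cnj (dbar (\<lambda>z. cnj (\<phi> z $ 1)) p) = U * s $ 2"
    hence e: "cnj (- 2 * cnj (dbar (\<lambda>z. cnj (\<phi> z $ 1)) p)) = cnj (U * s $ 2)" by simp
    have "dbar (\<lambda>z. cnj (\<phi> z $ 1)) p = - (1/2) * cnj (- 2 * cnj (dbar (\<lambda>z. cnj (\<phi> z $ 1)) p))" by simp
    also have "\<dots> = - (1/2) * cnj U * cnj (s $ 2)" unfolding e by simp
    finally show "dbar (\<lambda>z. cnj (\<phi> z $ 1)) p = - (1/2) * cnj U * cnj (s $ 2)" .
  qed simp
  also have "2 * dbar (\<lambda>z. \<phi> z $ 2) p = V * s $ 1 \<longleftrightarrow> dbar (\<lambda>z. \<phi> z $ 2) p = (1/2) * V * (s $ 1)"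
    by (auto simp: field_simps)
  finally show ?thesis by blast
qed

lemma disk_ball: "disk = ball 0 1"
proof -
  have "norm z < 1 \<longleftrightarrow> (fst z)\<^sup>2 + (snd z)\<^sup>2 < 1" for z :: plane
    unfolding norm_plane_sq[symmetric] by (simp add: power_less_one_iff)
  thus ?thesis by (auto simp: disk_def)
qed

lemma quad_alg:
  assumes "w1 \<in> W" "w2 \<in> W"
  shows "(\<lambda>z. - h z * (w1 z * cnj (w1 z) + w2 z * cnj (w2 z)) + c * (w1 z * cnj (w1 z)) + d * (w2 z * cnj (w2 z))) \<in> alg S (gens W h 0)"
proof -
  have g: "h \<in> alg S (gens W h 0)" "w \<in> alg S (gens W h 0)" "(\<lambda>z. cnj (w z)) \<in> alg S (gens W h 0)" if "w \<in> W" for w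
    using gens_intros[OF words_simps(1), of _ W] that by (auto intro!: alg.gen)
  have "(\<lambda>z. (-1) * h z * (w1 z * cnj (w1 z) + w2 z * cnj (w2 z)) + c * (w1 z * cnj (w1 z)) + d * (w2 z * cnj (w2 z))) \<in> alg S (gens W h 0)"
    by (intro alg.add alg.mult alg.const g assms g(1)[OF assms(1)])
  thus ?thesis by simp
qed

theorem corollary5p2:
  fixes H :: "plane \<Rightarrow> real" and \<psi> :: "plane \<Rightarrow> spinor" and U V :: potential
  assumes H_C1: "C_on 1 disk H"
    and H_bounded: "bdd_above ((\<lambda>p. \<bar>H p\<bar>) ` disk)"
    and grad_H_bounded: "bdd_above ((\<lambda>p. norm (grad H p)) ` disk)"
    and potentials: "(U, V) \<in> {(U_SU2, V_SU2), (U_Nil, V_Nil), (U_SL2, V_SL2)}"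
    and smooth: "C_on \<infinity> (disk - {0}) \<psi>"
    and solution: "solves_on (disk - {0}) H U V \<psi>"
    and L4: "(\<integral>\<^sup>+p\<in>disk. ennreal (norm (\<psi> p) ^ 4) \<partial>lborel) < \<infinity>"
  shows "\<exists>\<phi>. (\<forall>p \<in> disk - {0}. \<phi> p = \<psi> p)
           \<and> solves_on disk H U V \<phi>
           \<and> C_on 1 disk \<phi>
           \<and> (\<forall>k. C_on k disk H \<longrightarrow> C_on k disk \<phi>)"
proof -
  have od: "open disk" "0 \<in> disk" by (auto simp: disk_ball)
  have od0: "open (disk - {0})" by (simp add: disk_ball open_delete)
  obtain a b c d where UV: "U = quad a b" "V = quad c d" using potentials_quad[OF potentials] by blast
  define w1 where "w1 = (\<lambda>z. cnj (\<psi> z $ 1))"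
  define w2 where "w2 = (\<lambda>z. \<psi> z $ 2)"
  define h where "h = (\<lambda>z. complex_of_real (H z))"
  have sm: "Ck_on n (disk - {0}) \<psi>" for n using smooth by (simp add: C_on_def)
  have w_sm: "Ck_on n (disk - {0}) w1" "Ck_on n (disk - {0}) w2" for n
    using Ck_on_linear[OF od0 bounded_linear_compose[OF bounded_linear_cnj bounded_linear_vec_nth[of 1]] sm]
      Ck_on_linear[OF od0 bounded_linear_vec_nth[of 2] sm] unfolding w1_def w2_def by blast+
  have h_sm: "Ck_on n disk h" if "Ck_on n disk H" for n
    unfolding h_def by (rule Ck_on_linear[OF od(1) bounded_linear_of_real that])
  have H1: "Ck_on (Suc 0) disk H" using H_C1 unfolding C_on_def by (simp add: one_enat_def)
  \<comment> \<open>The conjugate of \<open>U\<close> and \<open>V\<close> as polynomials in \<open>h\<close>, \<open>w1\<close>, \<open>w2\<close> and their conjugates.\<close>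
  define Uw where "Uw = (\<lambda>z. - h z * (w1 z * cnj (w1 z) + w2 z * cnj (w2 z)) + cnj a * (w1 z * cnj (w1 z)) + cnj b * (w2 z * cnj (w2 z)))"
  define Vw where "Vw = (\<lambda>z. - h z * (w1 z * cnj (w1 z) + w2 z * cnj (w2 z)) + c * (w1 z * cnj (w1 z)) + d * (w2 z * cnj (w2 z)))"
  have UVw: "cnj (U (H z) (\<psi> z)) = Uw z" "V (H z) (\<psi> z) = Vw z" for z
    by (simp_all add: UV quad_def Uw_def Vw_def norm_spinor_sq h_def w1_def w2_def complex_norm_square[symmetric] mult.commute[of "cnj (\<psi> z $ 1)"])
  have eq: "dbar w1 z = - (1/2) * Uw z * cnj (w2 z)" "dbar w2 z = (1/2) * Vw z * cnj (w1 z)" if z: "z \<in> disk - {0}" for z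
  proof -
    have "Dirac \<psi> z = U (H z) (\<psi> z) *s Gamma_plus (\<psi> z) + V (H z) (\<psi> z) *s Gamma_minus (\<psi> z)"
      using solution z unfolding solves_on_def by blast
    thus "dbar w1 z = - (1/2) * Uw z * cnj (w2 z)" "dbar w2 z = (1/2) * Vw z * cnj (w1 z)"
      unfolding Dirac_eq[OF C1_onD(1)[OF sm z]] by (simp_all add: UVw w1_def w2_def)
  qed
  obtain M where M: "\<And>z. z \<in> disk \<Longrightarrow> \<bar>H z\<bar> \<le> M" using H_bounded unfolding bdd_above_def by blast
  define A where "A = \<bar>M\<bar> + norm a + norm b + norm c + norm d + 1"
  have A: "0 < A" by (simp add: A_def add_nonneg_pos)
  have bound: "norm ((- h z) * (w1 z * cnj (w1 z) + w2 z * cnj (w2 z)) + x * (w1 z * cnj (w1 z)) + y * (w2 z * cnj (w2 z))) \<le> A * (norm (w1 z) + norm (w2 z))\<^sup>2"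
    if z: "z \<in> disk" and xy: "norm x + norm y \<le> A - \<bar>M\<bar>" for x y z
  proof -
    define q where "q = norm (w1 z) + norm (w2 z)"
    have n1: "norm (w1 z * cnj (w1 z)) \<le> q\<^sup>2" "norm (w2 z * cnj (w2 z)) \<le> q\<^sup>2"
      unfolding norm_mult complex_mod_cnj power2_eq_square by (intro mult_mono; simp add: q_def)+
    have n2: "norm (w1 z * cnj (w1 z) + w2 z * cnj (w2 z)) \<le> q\<^sup>2"
    proof -
      have "norm (w1 z * cnj (w1 z) + w2 z * cnj (w2 z)) \<le> norm (w1 z * cnj (w1 z)) + norm (w2 z * cnj (w2 z))" by (rule norm_triangle_ineq)
      also have "\<dots> \<le> q\<^sup>2" unfolding norm_mult complex_mod_cnj by (simp add: q_def power2_eq_square algebra_simps)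
      finally show ?thesis .
    qed
    have "norm ((- h z) * (w1 z * cnj (w1 z) + w2 z * cnj (w2 z))) \<le> \<bar>M\<bar> * q\<^sup>2"
      unfolding norm_mult[of "- h z"] using M[OF z] n2 by (intro mult_mono) (auto simp: h_def)
    moreover have "norm (x * (w1 z * cnj (w1 z))) \<le> norm x * q\<^sup>2" unfolding norm_mult[of x] by (intro mult_left_mono n1) simp
    moreover have "norm (y * (w2 z * cnj (w2 z))) \<le> norm y * q\<^sup>2" unfolding norm_mult[of y] by (intro mult_left_mono n1) simp
    ultimately have "norm ((- h z) * (w1 z * cnj (w1 z) + w2 z * cnj (w2 z)) + x * (w1 z * cnj (w1 z)) + y * (w2 z * cnj (w2 z))) \<le> \<bar>M\<bar> * q\<^sup>2 + norm x * q\<^sup>2 + norm y * q\<^sup>2"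
      by (intro norm_triangle_mono)
    also have "\<dots> = (\<bar>M\<bar> + (norm x + norm y)) * q\<^sup>2" by (simp add: algebra_simps)
    also have "\<dots> \<le> A * q\<^sup>2" using xy by (intro mult_right_mono) auto
    finally show ?thesis by (simp add: q_def)
  qed
  have cubic: "norm (dbar w1 z) \<le> A * (norm (w1 z) + norm (w2 z)) ^ 3" "norm (dbar w2 z) \<le> A * (norm (w1 z) + norm (w2 z)) ^ 3"
    if z: "z \<in> disk - {0}" for z
  proof -
    define q where "q = norm (w1 z) + norm (w2 z)"
    have b: "norm (Uw z) \<le> A * q\<^sup>2" "norm (Vw z) \<le> A * q\<^sup>2"
      unfolding Uw_def Vw_def q_def by (intro bound; use z in \<open>simp add: A_def\<close>)+
    have q3: "(A * q\<^sup>2) * q = A * q ^ 3" by (simp add: power2_eq_square power3_eq_cube)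
    have "norm (Uw z) * norm (w2 z) \<le> A * q ^ 3" "norm (Vw z) * norm (w1 z) \<le> A * q ^ 3"
      unfolding q3[symmetric] by (intro mult_mono b; use A in \<open>simp add: q_def\<close>)+
    moreover have "norm (dbar w1 z) = (norm (Uw z) * norm (w2 z)) / 2" "norm (dbar w2 z) = (norm (Vw z) * norm (w1 z)) / 2"
      by (simp_all add: eq[OF z] norm_mult)
    moreover have "0 \<le> A * q ^ 3" using A by (simp add: q_def)
    ultimately show "norm (dbar w1 z) \<le> A * (norm (w1 z) + norm (w2 z)) ^ 3" "norm (dbar w2 z) \<le> A * (norm (w1 z) + norm (w2 z)) ^ 3"
      unfolding q_def[symmetric] by linarith+
  qed
  have fin: "(\<integral>\<^sup>+z. ennreal ((norm (w1 z) + norm (w2 z)) ^ 4) * indicator (disk - {0}) z \<partial>lborel) < \<infinity>"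
  proof -
    have le: "(norm (w1 z) + norm (w2 z)) ^ 4 \<le> 4 * norm (\<psi> z) ^ 4" for z
    proof -
      have "(norm (w1 z) + norm (w2 z))\<^sup>2 \<le> 2 * (norm (\<psi> z))\<^sup>2"
        using sum_squares_bound[of "norm (w1 z)" "norm (w2 z)"]
        unfolding norm_spinor_sq w1_def w2_def by (simp add: power2_sum)
      hence "((norm (w1 z) + norm (w2 z))\<^sup>2)\<^sup>2 \<le> (2 * (norm (\<psi> z))\<^sup>2)\<^sup>2" by (intro power_mono) auto
      thus ?thesis by (simp add: power_mult_distrib flip: power_mult)
    qed
    have meas: "(\<lambda>z. ennreal (norm (\<psi> z) ^ 4) * indicator (disk - {0}) z) \<in> borel_measurable borel"
    proof -
      have "continuous_on (disk - {0}) \<psi>" using sm[of 0] by simp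
      hence "(\<lambda>z. indicator (disk - {0}) z *\<^sub>R norm (\<psi> z) ^ 4) \<in> borel_measurable borel"
        by (intro borel_measurable_continuous_on_indicator continuous_intros) (use od0 in auto)
      hence "(\<lambda>z. ennreal (indicator (disk - {0}) z *\<^sub>R norm (\<psi> z) ^ 4)) \<in> borel_measurable borel" by simp
      also have "(\<lambda>z. ennreal (indicator (disk - {0}) z *\<^sub>R norm (\<psi> z) ^ 4)) = (\<lambda>z. ennreal (norm (\<psi> z) ^ 4) * indicator (disk - {0}) z)"
        by (rule ext) (simp add: indicator_def)
      finally show ?thesis .
    qed
    have "(\<integral>\<^sup>+z. ennreal ((norm (w1 z) + norm (w2 z)) ^ 4) * indicator (disk - {0}) z \<partial>lborel)
       \<le> (\<integral>\<^sup>+z. ennreal 4 * (ennreal (norm (\<psi> z) ^ 4) * indicator (disk - {0}) z) \<partial>lborel)"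
    proof (rule nn_integral_mono)
      fix z
      show "ennreal ((norm (w1 z) + norm (w2 z)) ^ 4) * indicator (disk - {0}) z \<le> ennreal 4 * (ennreal (norm (\<psi> z) ^ 4) * indicator (disk - {0}) z)"
        using ennreal_leI[OF le[of z]] by (cases "z \<in> disk - {0}") (simp_all add: ennreal_mult)
    qed
    also have "\<dots> = ennreal 4 * (\<integral>\<^sup>+z. ennreal (norm (\<psi> z) ^ 4) * indicator (disk - {0}) z \<partial>lborel)"
      using meas by (intro nn_integral_cmult) simp
    also have "(\<integral>\<^sup>+z. ennreal (norm (\<psi> z) ^ 4) * indicator (disk - {0}) z \<partial>lborel) \<le> (\<integral>\<^sup>+p\<in>disk. ennreal (norm (\<psi> p) ^ 4) \<partial>lborel)"
      by (intro nn_integral_mono mult_left_mono indicator_leI) auto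
    finally have "(\<integral>\<^sup>+z. ennreal ((norm (w1 z) + norm (w2 z)) ^ 4) * indicator (disk - {0}) z \<partial>lborel) \<le> ennreal 4 * (\<integral>\<^sup>+p\<in>disk. ennreal (norm (\<psi> p) ^ 4) \<partial>lborel)"
      by (simp add: mult_left_mono)
    also have "\<dots> < \<infinity>" using L4 by (simp add: ennreal_mult_less_top)
    finally show ?thesis .
  qed
  have "\<exists>R. 0 < R \<and> R \<le> 1/2 \<and> R < 1 \<and> holder R w1 \<and> holder R w2"
    using removable_holder[OF A, of 1 w1 w2] w_sm cubic fin unfolding disk_ball by simp
  then obtain R where R: "0 < R" "R \<le> 1/2" "R < 1" and hol: "holder R w1" "holder R w2" by blast
  have subR: "ball 0 R - {0} \<subseteq> disk - {0}" using R by (auto simp: disk_ball)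
  have dbar_alg: "dbar w1 \<in> alg (ball 0 R - {0}) (gens {w1, w2} h 0)" "dbar w2 \<in> alg (ball 0 R - {0}) (gens {w1, w2} h 0)"
  proof -
    let ?G = "alg (ball 0 R - {0}) (gens {w1, w2} h 0)"
    have g: "(\<lambda>z. cnj (w1 z)) \<in> ?G" "(\<lambda>z. cnj (w2 z)) \<in> ?G"
      using gens_intros(3)[OF words_simps(1), where w = w1 and W = "{w1, w2}" and h = h and n = 0] gens_intros(3)[OF words_simps(1), where w = w2 and W = "{w1, w2}" and h = h and n = 0]
      by (auto intro: alg.gen)
    have q: "Uw \<in> ?G" "Vw \<in> ?G" unfolding Uw_def Vw_def by (rule quad_alg; simp)+
    have m: "(\<lambda>z. - (1/2) * Uw z * cnj (w2 z)) \<in> ?G" "(\<lambda>z. (1/2) * Vw z * cnj (w1 z)) \<in> ?G"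
      by (intro alg.mult alg.const q g)+
    show "dbar w1 \<in> ?G" by (rule alg.cong[OF m(1)]) (rule eq(1)[OF subsetD[OF subR], symmetric])
    show "dbar w2 \<in> ?G" by (rule alg.cong[OF m(2)]) (rule eq(2)[OF subsetD[OF subR], symmetric])
  qed
  have ext_hd: "Ck_on n disk (extend w1) \<and> Ck_on n disk (extend w2)" if n: "Ck_on n disk H" for n
  proof -
    have hn: "Ck_on n (ball 0 1) h" using h_sm[OF n] by (simp add: disk_ball)
    have "\<exists>R'. 0 < R' \<and> R' \<le> R \<and> (\<forall>w\<in>{w1, w2}. \<forall>l\<in>words n. holder R' (iter_dd l w))"
      by (rule regularity[OF R(1,2,3) _ _ _ _ hn]) (use Ck_on_subset[OF w_sm(1) subR] Ck_on_subset[OF w_sm(2) subR] dbar_alg hol in auto)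
    then obtain R' where R': "0 < R'" "\<And>w l. w \<in> {w1, w2} \<Longrightarrow> l \<in> words n \<Longrightarrow> holder R' (iter_dd l w)" by blast
    show ?thesis
      by (intro conjI extend_Ck_on[OF od] w_sm holder_limit[OF R'(2) R'(1)]) auto
  qed
  define \<phi> where "\<phi> = (\<lambda>z. axis 1 (cnj (extend w1 z)) + axis 2 (extend w2 z) :: spinor)"
  have \<phi>_nth: "\<phi> z $ 1 = cnj (extend w1 z)" "\<phi> z $ 2 = extend w2 z" for z by (simp_all add: \<phi>_def axis_def)
  have \<phi>_eq: "\<phi> z = \<psi> z" if "z \<noteq> 0" for z
    using that by (simp add: vec_eq_iff forall_2 \<phi>_nth extend_def w1_def w2_def)
  have bl: "bounded_linear (axis i :: complex \<Rightarrow> spinor)" for i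
    unfolding linear_conv_bounded_linear[symmetric] by (rule linearI) (auto simp: vec_eq_iff axis_def)
  have \<phi>_hd: "Ck_on n disk \<phi>" if "Ck_on n disk H" for n
    unfolding \<phi>_def
    using Ck_on_add[OF od(1) Ck_on_linear[OF od(1) bounded_linear_compose[OF bl[of 1] bounded_linear_cnj] conjunct1[OF ext_hd[OF that]]]
        Ck_on_linear[OF od(1) bl[of 2] conjunct2[OF ext_hd[OF that]]]] by simp
  have C1: "C1_on disk \<phi>" "C1_on disk (extend w1)" "C1_on disk (extend w2)" using \<phi>_hd[OF H1] ext_hd[OF H1] by auto
  have solves: "solves_on disk H U V \<phi>"
    unfolding solves_on_def
  proof
    fix p assume p: "p \<in> disk"
    show "Dirac \<phi> p = U (H p) (\<phi> p) *s Gamma_plus (\<phi> p) + V (H p) (\<phi> p) *s Gamma_minus (\<phi> p)"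
    proof (cases "p = 0")
      case False
      have "dd v \<phi> p = dd v \<psi> p" for v
        by (rule dd_cong[of "- {0}"]) (use False \<phi>_eq in \<open>auto simp: open_Compl\<close>)
      hence "Dirac \<phi> p = Dirac \<psi> p" by (simp add: Dirac_def partial_x_dd partial_y_dd)
      thus ?thesis using solution p False \<phi>_eq[OF False] unfolding solves_on_def by simp
    next
      case True
      define E1 where "E1 = extend w1"
      define E2 where "E2 = extend w2"
      have cH: "continuous_on disk h" using h_sm[OF Ck_on_SucD[OF H1]] by simp
      have cE: "continuous_on disk E1" "continuous_on disk E2" unfolding E1_def E2_def by (intro C1_on_continuous C1)+
      define Ue where "Ue = (\<lambda>z. - h z * (E1 z * cnj (E1 z) + E2 z * cnj (E2 z)) + cnj a * (E1 z * cnj (E1 z)) + cnj b * (E2 z * cnj (E2 z)))"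
      define Ve where "Ve = (\<lambda>z. - h z * (E1 z * cnj (E1 z) + E2 z * cnj (E2 z)) + c * (E1 z * cnj (E1 z)) + d * (E2 z * cnj (E2 z)))"
      have UVe: "cnj (U (H z) (\<phi> z)) = Ue z" "V (H z) (\<phi> z) = Ve z" for z
        by (simp_all add: UV quad_def Ue_def Ve_def norm_spinor_sq h_def \<phi>_nth E1_def E2_def complex_norm_square[symmetric])
      have away: "dbar E1 z = - (1/2) * Ue z * cnj (E2 z)" "dbar E2 z = (1/2) * Ve z * cnj (E1 z)" if z: "z \<in> disk - {0}" for z
      proof -
        have e: "E1 z = w1 z" "E2 z = w2 z" using z by (auto simp: E1_def E2_def extend_def)
        have "dbar E1 z = dbar w1 z" "dbar E2 z = dbar w2 z"
          using z extend_dd(2)[of z w1] extend_dd(2)[of z w2] C1_onD(1)[OF w_sm(1) z] C1_onD(1)[OF w_sm(2) z]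
          by (simp_all add: E1_def E2_def dbar_def)
        thus "dbar E1 z = - (1/2) * Ue z * cnj (E2 z)" "dbar E2 z = (1/2) * Ve z * cnj (E1 z)"
          using eq[OF z] by (simp_all add: e Ue_def Ve_def Uw_def Vw_def)
      qed
      \<comment> \<open>Continuous functions that agree off the origin agree at the origin.\<close>
      have at0: "f 0 = g 0" if "continuous_on disk f" "continuous_on disk g" "\<And>z. z \<in> disk - {0} \<Longrightarrow> f z = g z" for f g :: "plane \<Rightarrow> complex"
      proof -
        have lim: "(f \<longlongrightarrow> f 0) (at 0)" "(g \<longlongrightarrow> g 0) (at 0)"
          using that(1,2) od by (simp_all add: continuous_on_eq_continuous_at isCont_def)
        have "\<forall>\<^sub>F z in at 0. f z = g z"
          using that(3) by (auto simp: eventually_at disk_ball intro!: exI[of _ 1])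
        hence "(g \<longlongrightarrow> f 0) (at 0)" by (rule Lim_transform_eventually[OF lim(1)])
        thus ?thesis by (rule tendsto_unique[OF at_neq_bot _ lim(2)])
      qed
      have "dbar E1 0 = - (1/2) * Ue 0 * cnj (E2 0)"
        by (rule at0[OF _ _ away(1)]) (use cH cE continuous_on_dbar[OF C1(2)] in \<open>auto simp: Ue_def E1_def[symmetric] intro!: continuous_intros\<close>)
      moreover have "dbar E2 0 = (1/2) * Ve 0 * cnj (E1 0)"
        by (rule at0[OF _ _ away(2)]) (use cH cE continuous_on_dbar[OF C1(3)] in \<open>auto simp: Ve_def E2_def[symmetric] intro!: continuous_intros\<close>)
      ultimately show ?thesis
        unfolding True Dirac_eq[OF C1_onD(1)[OF C1(1) od(2)]] UVe by (simp add: \<phi>_nth E1_def E2_def)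
    qed
  qed
  have Ck: "C_on k disk \<phi>" if "C_on k disk H" for k using that \<phi>_hd unfolding C_on_def by blast
  show ?thesis
    using \<phi>_eq solves Ck Ck[OF H_C1] by (intro exI[of _ \<phi>]) auto
qed

end
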